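(* Consider the Lévy-driven polling system with $N\ge1$ queues described in the context, in steady state, and suppose that the discipline at every queue $Q_i$ is such that: (a) for every $x\ge0$ the visit time $\tau_i(x)$ is an $\mathcal F_i$-stopping time; (b) for every $x\ge 0$, $\tau_i(x)\le T_i(x)$ a.s.; and (c) the branching property holds with Laplace exponent $\eta_i$. Then the Laplace–Stieltjes transform of the steady-state distribution of the joint amount of fluid $\boldsymbol F$ in the queues at an arbitrary epoch is given by $$\mathbb E e^{-\boldsymbol u\cdot\boldsymbol F}=\frac{N(\boldsymbol u)}{\sum_{i=1}^N\mathbb E S_i+\sum_{i=1}^N\mathbb E\tau_i(1)\,\mathbb E B_{i,i}},$$ where $B_{i,i}$ is the $i$th coordinate of $\boldsymbol B_i$ and $$N(\boldsymbol u)=\sum_{i=1}^N\left(\frac{\tilde{\boldsymbol B}_i(\boldsymbol u)-\tilde{\boldsymbol E}_i(\boldsymbol u)}{\phi_i^{\boldsymbol A}(\boldsymbol u)}+\frac{\tilde{\boldsymbol E}_i(\boldsymbol u)-\tilde{\boldsymbol B}_{i+1}(\boldsymbol u)}{\phi(\boldsymbol u)}\right),$$ for all $\boldsymbol u\ge\boldsymbol 0$ at which the denominators $\phi(\boldsymbol u)$ and $\phi_i^{\boldsymbol A}(\boldsymbol u)$, $i=1,\dots,N$, are non-zero. Here $\boldsymbol B_{N+1}:=\boldsymbol B_1$, and the transforms $\tilde{\boldsymbol B}_i,\tilde{\boldsymbol E}_i$ are determined by $$\tilde{\boldsymbol B}_{i+1}(\boldsymbol u)=\tilde{\boldsymbol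 E}_i(\boldsymbol u)\tilde S_i(\phi(\boldsymbol u)),\qquad \tilde{\boldsymbol E}_i(\boldsymbol u)=\tilde{\boldsymbol B}_i(u_1,\ldots,u_{i-1},\eta_i(\boldsymbol u),u_{i+1},\ldots,u_N),\qquad \tilde{\boldsymbol B}_1(\boldsymbol u)=\prod_{k=0}^\infty\tilde{\boldsymbol G}(\boldsymbol\kappa^{(k)}(\boldsymbol u)),$$ with $\kappa_i(\boldsymbol u)=\eta_i(u_1,\ldots,u_i,\kappa_{i+1}(\boldsymbol u),\ldots,\kappa_N(\boldsymbol u))$ for $i=1,\dots,N$ and $\tilde{\boldsymbol G}(\boldsymbol u)=\prod_{i=1}^N\tilde S_i(\phi(u_1,\ldots,u_i,\kappa_{i+1}(\boldsymbol u),\ldots,\kappa_N(\boldsymbol u)))$.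
   Context: Notation. An $N$-dimensional Lévy subordinator is an $\mathbb R^N$-valued Lévy process started at $\boldsymbol 0$ with paths non-decreasing in each coordinate (coordinates may be dependent). The Laplace exponent of a (multidimensional) spectrally positive Lévy process $\boldsymbol L$ is the function $\phi$ with $\mathbb E e^{-\boldsymbol u\cdot\boldsymbol L(t)}=e^{-t\phi(\boldsymbol u)}$, $\boldsymbol u\ge\boldsymbol 0$. For a random variable or vector $X$, $\tilde X(u)=\mathbb E e^{-u\cdot X}$. $\boldsymbol e_i$ is the $i$th unit vector. Iterates: $\boldsymbol\kappa^{(0)}(\boldsymbol u)=\boldsymbol u$, $\boldsymbol\kappa^{(k)}(\boldsymbol u)=\boldsymbol\kappa^{(k-1)}(\boldsymbol\kappa(\boldsymbol u))$. Polling system. There are $N$ infinite-buffer fluid queues $Q_1,\dots,Q_N$ and one server visiting them cyclically ($Q_{N+1}:=Q_1$). After leaving $Q_j$ and before reaching $Q_{j+1}$ the server incurs a switch-over period whose duration is a positive random variable $S_j$, independent of anything else. The queues are fed by an $N$-dimensional Lévy subordinator $\boldsymbol W$ with Laplace exponent $\phi$; during a switch-over period the workload vector evolves as its starting value plus $\boldsymbol W(t)$. While the server is at $Q_i$ the workload vector evolves as its value on arrival plus a Lévy process $\boldsymbol A_i(t)=(W_1(t),\dots,W_{i-1}(t),A_i(t),W_{i+1}(t),\dots,W_N(t))$, where $A_i$ is a spectrally positive Lévy process with $\mathbb E A_i(1)<0$; the Laplace exponent of $\boldsymbol A_i$ is denoted $\phi_i^{\boldsymbol A}$. Independent copies of these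 driving processes and switch-over durations are used in different visits and switch-over periods, independently of the past. Disciplines. $\mathcal F_i$ is an augmented right-continuous filtration such that $\boldsymbol A_i$ is a Lévy process with respect to $\mathcal F_i$. $\tau_i(x)$ is the time the server spends at $Q_i$ when it finds $x$ units of work in this queue on arrival. $T_i(x)=\inf\{t\ge0:A_i(t)=-x\}$. Under (a) and (b), $x$ units of work found in $Q_i$ on arrival are replaced during the visit by $\boldsymbol H_i(x)=x\boldsymbol e_i+\boldsymbol A_i(\tau_i(x))$, i.e. a workload vector $\boldsymbol x$ on arrival becomes $\boldsymbol x-x_i\boldsymbol e_i+\boldsymbol H_i(x_i)$ at the end of the visit. The branching property with Laplace exponent $\eta_i$ means that $\{\boldsymbol H_i(x),x\ge0\}$ is an $N$-dimensional Lévy subordinator with Laplace exponent $\eta_i$. Steady state. Let $M=(m_{i,j})$ with $m_{i,j}=\frac{\partial\kappa_i}{\partial u_j}(\boldsymbol 0)$ (finite). It is assumed that the spectral radius of $M$ is $<1$, that a non-negative random vector $\boldsymbol G$ with transform $\tilde{\boldsymbol G}$ has integrable norm, and that $\mathbb E S_i<\infty$ for all $i$. Then the workload vector at successive epochs at which the server reaches $Q_1$ converges in distribution; $\boldsymbol B_1$ has this limiting distribution, and $\boldsymbol B_i,\boldsymbol E_i$ are distributed as the workload vectors at the beginning, respectively end, of the visit to $Q_i$ in a cycle started with workload vector distributed as $\boldsymbol B_1$. A cycle is the period between two successive arrivals of the server at $Q_1$; let $C$ be its length and $\boldsymbol F(t)$, $0\le t\le C$, the workload vector at time $t$ within a cycle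 started in stationarity (workload distributed as $\boldsymbol B_1$ at time $0$). The steady-state distribution of $\boldsymbol F$ at an arbitrary epoch is the one with $\mathbb E e^{-\boldsymbol u\cdot\boldsymbol F}=\mathbb E\int_0^C e^{-\boldsymbol u\cdot\boldsymbol F(t)}\,dt\,/\,\mathbb E C$. *)

theory Defs
  imports "HOL-Probability.Probability" "Jordan_Normal_Form.Spectral_Radius"
begin

no_notation Matrix.vec_index (infixl "$" 100)

section \<open>Transforms and Levy processes\<close>

definition lst :: "'p measure \<Rightarrow> ('p \<Rightarrow> 'v::real_inner) \<Rightarrow> 'v \<Rightarrow> real" where
  "lst P X u = (\<integral>\<omega>. exp (- inner u (X \<omega>)) \<partial>P)"

text \<open>Two random variables with possibly different value types
  (\<open>prob_space.indep_var\<close> requires equal types).\<close>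

definition indep_rv ::
  "'p measure \<Rightarrow> 'b measure \<Rightarrow> ('p \<Rightarrow> 'b) \<Rightarrow> 'c measure \<Rightarrow> ('p \<Rightarrow> 'c) \<Rightarrow> bool" where
  "indep_rv P K X L Y \<longleftrightarrow> X \<in> measurable P K \<and> Y \<in> measurable P L \<and>
     prob_space.indep_set P {X -` A \<inter> space P | A. A \<in> sets K} {Y -` A \<inter> space P | A. A \<in> sets L}"

text \<open>A Levy process is understood as a process started at 0 with independent stationary
  increments that is stochastically continuous. Cadlag paths are required separately, and only of
  the driving processes: \<open>x \<mapsto> H\<^sub>i(x)\<close> is left-continuous, but not right-continuous, for
  exhaustive service.\<close>

definition levy_process :: "'a measure \<Rightarrow> (real \<Rightarrow> 'a \<Rightarrow> 'v::euclidean_space) \<Rightarrow> bool" where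
  "levy_process M X \<longleftrightarrow>
     prob_space M \<and>
     (\<forall>t\<ge>0. X t \<in> borel_measurable M) \<and>
     (AE \<omega> in M. X 0 \<omega> = 0) \<and>
     (\<forall>(t::nat \<Rightarrow> real) n. mono t \<and> 0 \<le> t 0 \<longrightarrow>
        prob_space.indep_vars M (\<lambda>_. borel) (\<lambda>k \<omega>. X (t (Suc k)) \<omega> - X (t k) \<omega>) {..<n}) \<and>
     (\<forall>s\<ge>0. \<forall>t\<ge>0. distr M borel (\<lambda>\<omega>. X (s + t) \<omega> - X s \<omega>) = distr M borel (X t)) \<and>
     (\<forall>s\<ge>0. \<forall>\<epsilon>>0.
        ((\<lambda>t. measure M {\<omega> \<in> space M. norm (X t \<omega> - X s \<omega>) > \<epsilon>}) \<longlongrightarrow> 0) (at s within {0..}))"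

text \<open>On \<open>real ^ 'n\<close> the order is componentwise.\<close>

definition levy_subordinator :: "'a measure \<Rightarrow> (real \<Rightarrow> 'a \<Rightarrow> real ^ 'n::finite) \<Rightarrow> bool" where
  "levy_subordinator M X \<longleftrightarrow> levy_process M X \<and>
     (AE \<omega> in M. \<forall>s t. 0 \<le> s \<longrightarrow> s \<le> t \<longrightarrow> X s \<omega> \<le> X t \<omega>)"

definition cadlag :: "(real \<Rightarrow> 'v::topological_space) \<Rightarrow> bool" where
  "cadlag f \<longleftrightarrow>
     (\<forall>t\<ge>0. (f \<longlongrightarrow> f t) (at_right t)) \<and> (\<forall>t>0. \<exists>l. (f \<longlongrightarrow> l) (at_left t))"

definition no_negative_jumps :: "(real \<Rightarrow> real) \<Rightarrow> bool" where
  "no_negative_jumps f \<longleftrightarrow> (\<forall>t>0. \<forall>l. (f \<longlongrightarrow> l) (at_left t) \<longrightarrow> l \<le> f t)"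

definition spectrally_positive_levy :: "'a measure \<Rightarrow> (real \<Rightarrow> 'a \<Rightarrow> real) \<Rightarrow> bool" where
  "spectrally_positive_levy M X \<longleftrightarrow> levy_process M X \<and>
     (AE \<omega> in M. cadlag (\<lambda>t. X t \<omega>) \<and> no_negative_jumps (\<lambda>t. X t \<omega>))"

definition laplace_exponent ::
  "'a measure \<Rightarrow> (real \<Rightarrow> 'a \<Rightarrow> real ^ 'n::finite) \<Rightarrow> (real ^ 'n \<Rightarrow> real) \<Rightarrow> bool" where
  "laplace_exponent M X \<phi> \<longleftrightarrow> (\<forall>u\<ge>0. \<forall>t\<ge>0. lst M (X t) u = exp (- (t * \<phi> u)))"

text \<open>Time runs through \<open>ennreal\<close>, i.e. through \<open>[0,\<infinity>]\<close>.\<close>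

definition augmented_right_continuous_filtration ::
  "'a measure \<Rightarrow> (ennreal \<Rightarrow> 'a measure) \<Rightarrow> bool" where
  "augmented_right_continuous_filtration M F \<longleftrightarrow>
     filtration (space M) F \<and>
     (\<forall>t. subalgebra M (F t) \<and> null_sets M \<subseteq> sets (F t)) \<and>
     (\<forall>t<\<infinity>. sets (F t) = (\<Inter>s\<in>{t<..}. sets (F s)))"

definition levy_process_wrt ::
  "'a measure \<Rightarrow> (ennreal \<Rightarrow> 'a measure) \<Rightarrow> (real \<Rightarrow> 'a \<Rightarrow> 'v::euclidean_space) \<Rightarrow> bool" where
  "levy_process_wrt M F X \<longleftrightarrow> levy_process M X \<and>
     (\<forall>t\<ge>0. X t \<in> borel_measurable (F (ennreal t))) \<and>
     (\<forall>s\<ge>0. \<forall>t\<ge>s. prob_space.indep_set M (sets (F (ennreal s)))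
        {(\<lambda>\<omega>. X t \<omega> - X s \<omega>) -` A \<inter> space M | A. A \<in> sets borel})"

definition hitting_time :: "(real \<Rightarrow> 'a \<Rightarrow> real) \<Rightarrow> real \<Rightarrow> 'a \<Rightarrow> ennreal" where
  "hitting_time A x \<omega> = Inf {ennreal t | t. 0 \<le> t \<and> A t \<omega> = - x}"

definition converges_in_distribution ::
  "'p measure \<Rightarrow> (nat \<Rightarrow> 'p \<Rightarrow> real ^ 'n::finite) \<Rightarrow> ('p \<Rightarrow> real ^ 'n) \<Rightarrow> bool" where
  "converges_in_distribution P X Y \<longleftrightarrow>
     (\<forall>f::real ^ 'n \<Rightarrow> real. continuous_on UNIV f \<and> bounded (range f) \<longrightarrow>
        (\<lambda>n. \<integral>\<omega>. f (X n \<omega>) \<partial>P) \<longlonglongrightarrow> (\<integral>\<omega>. f (Y \<omega>) \<partial>P))"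


section \<open>The polling system\<close>

definition vec_upd :: "real ^ 'n \<Rightarrow> 'n \<Rightarrow> real \<Rightarrow> real ^ 'n::finite" where
  "vec_upd u j a = (\<chi> k. if k = j then a else u $ k)"

datatype role = Visit | Inflow | Duration

text \<open>
  Queues are numbered \<open>1, \<dots>, N\<close> with \<open>N = CARD('n)\<close>; \<open>q i\<close> is the coordinate of queue \<open>i\<close>.
  \<open>W\<close>, \<open>A i\<close>, \<open>S i\<close> and \<open>\<tau> i x\<close> live on one template space with points of type \<open>'a\<close>. A copy of a
  template is obtained by evaluating it at a random element of that space. The randomness \<open>d\<close> of
  one cycle consists of three such elements for each queue \<open>i\<close>: \<open>d Visit i\<close> drives the visit
  (net input together with the service discipline), \<open>d Inflow i\<close> the input during the
  subsequent switch-over period, and \<open>d Duration i\<close> the length of that period.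
\<close>

locale polling =
  fixes q :: "nat \<Rightarrow> 'n::finite"
    and W :: "real \<Rightarrow> 'a \<Rightarrow> real ^ 'n"
    and A :: "nat \<Rightarrow> real \<Rightarrow> 'a \<Rightarrow> real"
    and S :: "nat \<Rightarrow> 'a \<Rightarrow> real"
    and \<tau> :: "nat \<Rightarrow> real \<Rightarrow> 'a \<Rightarrow> ennreal"
begin

definition net_input :: "nat \<Rightarrow> real \<Rightarrow> 'a \<Rightarrow> real ^ 'n" where
  "net_input i t \<omega> = vec_upd (W t \<omega>) (q i) (A i t \<omega>)"

definition replacement :: "nat \<Rightarrow> real \<Rightarrow> 'a \<Rightarrow> real ^ 'n" where
  "replacement i x \<omega> = x *\<^sub>R axis (q i) 1 + net_input i (enn2real (\<tau> i x \<omega>)) \<omega>"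

definition after_visit :: "nat \<Rightarrow> real ^ 'n \<Rightarrow> 'a \<Rightarrow> real ^ 'n" where
  "after_visit i x \<omega> = x - (x $ q i) *\<^sub>R axis (q i) 1 + replacement i (x $ q i) \<omega>"

text \<open>\<open>workload d x k\<close> is the workload in a cycle started with workload \<open>x\<close>, right after the
  switch-over period that follows the visit to queue \<open>k\<close>; \<open>epoch d x k\<close> is the corresponding time.\<close>

primrec workload :: "(role \<Rightarrow> nat \<Rightarrow> 'a) \<Rightarrow> real ^ 'n \<Rightarrow> nat \<Rightarrow> real ^ 'n" where
  "workload d x 0 = x"
| "workload d x (Suc k) =
     after_visit (Suc k) (workload d x k) (d Visit (Suc k))
       + W (S (Suc k) (d Duration (Suc k))) (d Inflow (Suc k))"

definition workload_begin :: "(role \<Rightarrow> nat \<Rightarrow> 'a) \<Rightarrow> real ^ 'n \<Rightarrow> nat \<Rightarrow> real ^ 'n" where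
  "workload_begin d x i = workload d x (i - 1)"

definition workload_end :: "(role \<Rightarrow> nat \<Rightarrow> 'a) \<Rightarrow> real ^ 'n \<Rightarrow> nat \<Rightarrow> real ^ 'n" where
  "workload_end d x i = after_visit i (workload_begin d x i) (d Visit i)"

definition visit_length :: "(role \<Rightarrow> nat \<Rightarrow> 'a) \<Rightarrow> real ^ 'n \<Rightarrow> nat \<Rightarrow> real" where
  "visit_length d x i = enn2real (\<tau> i (workload_begin d x i $ q i) (d Visit i))"

primrec epoch :: "(role \<Rightarrow> nat \<Rightarrow> 'a) \<Rightarrow> real ^ 'n \<Rightarrow> nat \<Rightarrow> real" where
  "epoch d x 0 = 0"
| "epoch d x (Suc k) =
     epoch d x k + visit_length d x (Suc k) + S (Suc k) (d Duration (Suc k))"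

definition cycle_length :: "(role \<Rightarrow> nat \<Rightarrow> 'a) \<Rightarrow> real ^ 'n \<Rightarrow> real" where
  "cycle_length d x = epoch d x CARD('n)"

text \<open>\<open>fluid_upto d x k t\<close> is the workload at time \<open>t\<close>, for \<open>0 \<le> t \<le> epoch d x k\<close>.\<close>

primrec fluid_upto :: "(role \<Rightarrow> nat \<Rightarrow> 'a) \<Rightarrow> real ^ 'n \<Rightarrow> nat \<Rightarrow> real \<Rightarrow> real ^ 'n" where
  "fluid_upto d x 0 t = x"
| "fluid_upto d x (Suc k) t =
     (let b = epoch d x k; e = b + visit_length d x (Suc k) in
      if t < b then fluid_upto d x k t
      else if t < e then workload_begin d x (Suc k) + net_input (Suc k) (t - b) (d Visit (Suc k))
      else workload_end d x (Suc k) + W (t - e) (d Inflow (Suc k)))"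

definition fluid :: "(role \<Rightarrow> nat \<Rightarrow> 'a) \<Rightarrow> real ^ 'n \<Rightarrow> real \<Rightarrow> real ^ 'n" where
  "fluid d x t = fluid_upto d x CARD('n) t"

text \<open>Workload at the \<open>n\<close>-th arrival of the server at queue 1, cycle \<open>n\<close> using the randomness \<open>D n\<close>.\<close>

primrec embedded :: "(nat \<Rightarrow> role \<Rightarrow> nat \<Rightarrow> 'a) \<Rightarrow> real ^ 'n \<Rightarrow> nat \<Rightarrow> real ^ 'n" where
  "embedded D x 0 = x"
| "embedded D x (Suc n) = workload (D n) (embedded D x n) CARD('n)"

end

text \<open>Transform of the steady-state distribution at an arbitrary epoch, given the length \<open>C\<close> of a
  stationary cycle and the workload process \<open>Fl\<close> within it.\<close>

definition steady_state_lst ::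
  "'p measure \<Rightarrow> ('p \<Rightarrow> real) \<Rightarrow> (real \<Rightarrow> 'p \<Rightarrow> real ^ 'n::finite) \<Rightarrow> real ^ 'n \<Rightarrow> real" where
  "steady_state_lst P C Fl u =
     (\<integral>\<omega>. (LINT t:{0..C \<omega>}|lborel. exp (- inner u (Fl t \<omega>))) \<partial>P) / (\<integral>\<omega>. C \<omega> \<partial>P)"


section \<open>The functions \<open>\<kappa>\<close> and the transform of the immigration\<close>

text \<open>The coordinates \<open>q N, q (N - 1), \<dots>\<close> are replaced one after the other; the result is
  characterised by \<open>kappa_eq\<close> below.\<close>

primrec kappa_rec ::
  "(nat \<Rightarrow> 'n::finite) \<Rightarrow> (nat \<Rightarrow> real ^ 'n \<Rightarrow> real) \<Rightarrow> real ^ 'n \<Rightarrow> nat \<Rightarrow> real ^ 'n" where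
  "kappa_rec q \<eta> u 0 = u"
| "kappa_rec q \<eta> u (Suc k) =
     (let v = kappa_rec q \<eta> u k; i = CARD('n) - k in vec_upd v (q i) (\<eta> i v))"

definition kappa ::
  "(nat \<Rightarrow> 'n::finite) \<Rightarrow> (nat \<Rightarrow> real ^ 'n \<Rightarrow> real) \<Rightarrow> real ^ 'n \<Rightarrow> real ^ 'n" where
  "kappa q \<eta> u = kappa_rec q \<eta> u CARD('n)"

text \<open>\<open>(u\<^sub>1, \<dots>, u\<^sub>i, \<kappa>\<^sub>i\<^sub>+\<^sub>1(u), \<dots>, \<kappa>\<^sub>N(u))\<close>\<close>

definition kappa_tail ::
  "(nat \<Rightarrow> 'n::finite) \<Rightarrow> (nat \<Rightarrow> real ^ 'n \<Rightarrow> real) \<Rightarrow> nat \<Rightarrow> real ^ 'n \<Rightarrow> real ^ 'n" where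
  "kappa_tail q \<eta> i u = (\<chi> j. if j \<in> q ` {1..i} then u $ j else kappa q \<eta> u $ j)"

lemma kappa_rec_head:
  fixes q :: "nat \<Rightarrow> 'n::finite"
  assumes q: "bij_betw q {1..CARD('n)} UNIV" and "k \<le> CARD('n)" "1 \<le> i" "i \<le> CARD('n) - k"
  shows "kappa_rec q \<eta> u k $ q i = u $ q i"
  using assms(2,4)
proof (induction k)
  case (Suc k)
  have "q i \<noteq> q (CARD('n) - k)"
  proof
    assume "q i = q (CARD('n) - k)"
    moreover have "i \<in> {1..CARD('n)}" "CARD('n) - k \<in> {1..CARD('n)}"
      using Suc.prems \<open>1 \<le> i\<close> by simp_all
    ultimately have "i = CARD('n) - k" by (rule inj_onD[OF bij_betw_imp_inj_on[OF q]])
    then show False using Suc.prems by linarith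
  qed
  then show ?case using Suc by (simp add: Let_def vec_upd_def)
qed simp

lemma kappa_rec_last:
  fixes q :: "nat \<Rightarrow> 'n::finite"
  assumes q: "bij_betw q {1..CARD('n)} UNIV" and i: "i \<le> CARD('n)"
    and k: "CARD('n) - i < k" "k \<le> CARD('n)"
  shows "kappa_rec q \<eta> u k $ q i = \<eta> i (kappa_rec q \<eta> u (CARD('n) - i))"
  using k
proof (induction k)
  case (Suc k)
  show ?case
  proof (cases "CARD('n) - i = k")
    case True
    then have "CARD('n) - k = i" using i by linarith
    then show ?thesis using True by (simp add: Let_def vec_upd_def)
  next
    case False
    have "q i \<noteq> q (CARD('n) - k)"
    proof
      assume "q i = q (CARD('n) - k)"
      moreover have "i \<in> {1..CARD('n)}" "CARD('n) - k \<in> {1..CARD('n)}"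
        using Suc.prems i by simp_all
      ultimately have "i = CARD('n) - k" by (rule inj_onD[OF bij_betw_imp_inj_on[OF q]])
      then show False using Suc.prems False by linarith
    qed
    then show ?thesis using Suc False by (simp add: Let_def vec_upd_def)
  qed
qed simp

lemma kappa_rec_eq_tail:
  fixes q :: "nat \<Rightarrow> 'n::finite"
  assumes q: "bij_betw q {1..CARD('n)} UNIV" and i: "i \<le> CARD('n)"
  shows "kappa_rec q \<eta> u (CARD('n) - i) = kappa_tail q \<eta> i u"
proof (subst Finite_Cartesian_Product.vec_eq_iff, intro allI)
  fix c
  obtain j where j: "c = q j" "1 \<le> j" "j \<le> CARD('n)"
    using bij_betw_imp_surj_on[OF q] by (metis UNIV_I atLeastAtMost_iff imageE)
  have mem: "c \<in> q ` {1..i} \<longleftrightarrow> j \<le> i"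
    using j i inj_onD[OF bij_betw_imp_inj_on[OF q]] by force
  show "kappa_rec q \<eta> u (CARD('n) - i) $ c = kappa_tail q \<eta> i u $ c"
  proof (cases "j \<le> i")
    case True
    then show ?thesis using kappa_rec_head[OF q, of "CARD('n) - i" j] i j mem
      by (simp add: kappa_tail_def)
  next
    case False
    then show ?thesis
      using kappa_rec_last[OF q j(3), of "CARD('n) - i"] kappa_rec_last[OF q j(3), of "CARD('n)"] j mem
      by (simp add: kappa_tail_def kappa_def)
  qed
qed

lemma kappa_eq:
  fixes q :: "nat \<Rightarrow> 'n::finite"
  assumes q: "bij_betw q {1..CARD('n)} UNIV" and i: "i \<in> {1..CARD('n)}"
  shows "kappa q \<eta> u $ q i = \<eta> i (kappa_tail q \<eta> i u)"
  using kappa_rec_last[OF q, of i "CARD('n)"] kappa_rec_eq_tail[OF q, of i] i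
  by (simp add: kappa_def)

definition immigration_lst ::
  "'a measure \<Rightarrow> (nat \<Rightarrow> 'n::finite) \<Rightarrow> (nat \<Rightarrow> 'a \<Rightarrow> real) \<Rightarrow> (real ^ 'n \<Rightarrow> real)
     \<Rightarrow> (nat \<Rightarrow> real ^ 'n \<Rightarrow> real) \<Rightarrow> real ^ 'n \<Rightarrow> real" where
  "immigration_lst M q S \<phi> \<eta> u = (\<Prod>i=1..CARD('n). lst M (S i) (\<phi> (kappa_tail q \<eta> i u)))"

end

theory Submission
  imports Defs
begin

text \<open>
  During a visit, optional stopping for \<open>exp (- u \<bullet> A\<^sub>i(t)) + \<phi>\<^sub>i\<^sup>A(u) \<integral>\<^sub>0\<^sup>t exp (- u \<bullet> A\<^sub>i(s)) ds\<close> at the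
  visit time expresses the mean of \<open>\<integral> exp (- u \<bullet> F(t)) dt\<close> over the visit by the transforms of the
  workload at its two ends; this is legitimate because \<open>A\<^sub>i\<close> stays above \<open>- x\<close> until it hits \<open>- x\<close>. A
  switch-over period is treated in the same way, with a deterministic horizon, by Fubini. Summing
  over the queues gives the numerator. For the denominator, \<open>u = h e\<^sub>i\<close> and \<open>h \<rightarrow> 0\<close> show that visit
  times have finite mean, linear in the workload found.

  Over one cycle the transform of the workload vector satisfies
  \<open>X\<^sub>n\<^sub>+\<^sub>1(u) = X\<^sub>n(\<kappa>(u)) G(u)\<close>. The exponents \<open>\<eta>\<^sub>i\<close> are increasing, subadditive and concave along rays, so
  \<open>\<kappa>(u) \<le> M u\<close>, and the iterates of \<open>\<kappa>\<close> decay geometrically. Letting \<open>n\<close> tend to infinity yields the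
  infinite product for \<open>B\<^sub>1\<close>, its stationarity, and its finite mean.
\<close>


section \<open>Optional stopping for exponentials of Levy processes\<close>

text \<open>No moments are assumed for the visit times, the switch-over input, the initial workload
  or the limit law. Finite means are extracted from transforms: a bound on 1 - E exp(- h Z) that is
  linear in h gives a finite mean of Z by Fatou's lemma. This matters for the denominator, because a
  Bochner integral of a nonintegrable function is 0 by convention. A finite input rate is read off
  from the finite mean of \<open>G\<close> and from \<open>S N\<close> being positive. Visit times
  are not known to be finite beforehand, so optional stopping is done at times truncated at K, with
  bounds uniform in K. Measurability is the other obstacle. Visits are evaluated at a random
  workload, which calls for joint measurability in the workload and the sample point. The given
  processes are replaced by modifications that agree with them almost surely; completeness of
  \<open>P\<close> carries measurability back to the original workloads. All limits h -> 0 run along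
  the sequence \<open>hseq\<close>, so that Fatou's lemma and dominated convergence apply; the same
  numbers are the mesh sizes of time grids.\<close>

definition hseq :: "nat \<Rightarrow> real" where
  "hseq n = 1 / real (Suc n)"

lemma hseq: "0 < hseq n" "hseq n \<le> 1" "0 \<le> hseq n"
  by (auto simp: hseq_def)

lemma hseq_lim: "hseq \<longlonglongrightarrow> 0"
  using LIMSEQ_inverse_real_of_nat by (simp add: hseq_def[abs_def] inverse_eq_divide)

lemma hseq_at_right: "filterlim hseq (at_right 0) sequentially"
  unfolding filterlim_at using hseq hseq_lim by (auto intro!: always_eventually simp: less_imp_neq[THEN not_sym])

lemma eventually_hseq_less: "0 < e \<Longrightarrow> \<forall>\<^sub>F n in sequentially. hseq n < e"
  using order_tendstoD(2)[OF hseq_lim] .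

lemma at_within_atLeast: "at a within {a..} = at_right (a :: real)"
  unfolding at_within_def by (rule arg_cong[where f="\<lambda>S. inf _ (principal S)"]) auto

lemma tendsto_hseq_above:
  fixes r :: "nat \<Rightarrow> real"
  assumes "\<And>n. t \<le> r n" "\<And>n. r n \<le> t + hseq n"
  shows "r \<longlonglongrightarrow> t"
proof (rule tendsto_sandwich[of "\<lambda>_. t" _ _ "\<lambda>n. t + hseq n"])
  show "(\<lambda>n. t + hseq n) \<longlonglongrightarrow> t" using tendsto_add[OF tendsto_const hseq_lim, of t] by simp
qed (use assms in auto)

lemma one_minus_exp_derivative: "(\<lambda>n. (1 - exp (- (hseq n * a))) / hseq n) \<longlonglongrightarrow> a"
proof -
  have "((\<lambda>r. 1 - exp (- (r * a))) has_real_derivative a) (at 0)"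
    by (auto intro!: derivative_eq_intros)
  then have "((\<lambda>r. (1 - exp (- (r * a))) / r) \<longlongrightarrow> a) (at_right 0)"
    by (simp add: DERIV_def filterlim_at_split)
  from filterlim_compose[OF this hseq_at_right] show ?thesis .
qed

section \<open>Joint measurability, and convergence of means under a second moment bound\<close>

lemma indicator_measurable_lborel:
  fixes f g :: "'c \<Rightarrow> real"
  assumes [measurable]: "f \<in> borel_measurable K" "g \<in> borel_measurable K"
  shows "(\<lambda>p. indicator {f (fst p)<..g (fst p)} (snd p) :: ennreal) \<in> borel_measurable (K \<Otimes>\<^sub>M lborel)"
proof -
  have "{p \<in> space (K \<Otimes>\<^sub>M lborel). snd p \<in> {f (fst p)<..g (fst p)}} \<in> sets (K \<Otimes>\<^sub>M lborel)"
    unfolding greaterThanAtMost_iff by measurable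
  then show ?thesis by (rule_tac borel_measurable_indicator') auto
qed

text \<open>Sampling the process at the right end of the grid cell containing t gives a map with
  countably many pieces, each measurable. By right-continuity these maps converge pointwise as the
  mesh shrinks.\<close>

lemma joint_measurable_right_continuous:
  fixes X :: "real \<Rightarrow> 'a \<Rightarrow> 'v::{real_normed_vector, second_countable_topology}"
  assumes \<Omega>: "\<Omega> \<in> sets M"
    and X: "\<And>t. 0 \<le> t \<Longrightarrow> X t \<in> borel_measurable M"
    and rc: "\<And>t \<omega>. 0 \<le> t \<Longrightarrow> \<omega> \<in> \<Omega> \<Longrightarrow> ((\<lambda>s. X s \<omega>) \<longlongrightarrow> X t \<omega>) (at_right t)"
  shows "(\<lambda>(t, \<omega>). if 0 \<le> t \<and> \<omega> \<in> \<Omega> then X t \<omega> else 0) \<in> borel_measurable (borel \<Otimes>\<^sub>M M)"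
proof -
  \<comment> \<open>Floor plus one instead of the ceiling: the sampling time must exceed t strictly,
    because right-continuity is stated with the filter \<open>at_right t\<close>, which leaves out t
    itself.\<close>
  define r where "r n t = (real_of_int \<lfloor>t * real (Suc n)\<rfloor> + 1) / real (Suc n)" for n :: nat and t :: real
  have r_gt: "t < r n t" for n t
    unfolding r_def by (simp add: field_simps) (smt (verit) floor_correct mult.commute of_nat_Suc real_of_int_floor_add_one_gt ring_class.ring_distribs)
  have r_le: "r n t \<le> t + hseq n" for n t
  proof -
    have "r n t \<le> (t * real (Suc n) + 1) / real (Suc n)"
      unfolding r_def by (intro divide_right_mono) auto
    also have "\<dots> = t + hseq n" by (simp add: field_simps hseq_def)
    finally show ?thesis .
  qed
  have r_lim: "(\<lambda>n. r n t) \<longlonglongrightarrow> t" for t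
    by (intro tendsto_hseq_above r_le less_imp_le r_gt)
  define g where "g n = (\<lambda>(t, \<omega>). if 0 \<le> t \<and> \<omega> \<in> \<Omega> then X (r n t) \<omega> else 0)" for n
  have g: "g n \<in> borel_measurable (borel \<Otimes>\<^sub>M M)" for n
  proof -
    \<comment> \<open>The inner test is needed because \<open>X\<close> is only known to be
      measurable at nonnegative times. For t at least 0 it always succeeds, since the right end of
      the cell lies beyond t.\<close>
    define f where "f i = (\<lambda>(t::real, \<omega>). if 0 \<le> t \<and> \<omega> \<in> \<Omega> then (if 0 \<le> (real_of_int i + 1) / real (Suc n) then X ((real_of_int i + 1) / real (Suc n)) \<omega> else 0) else 0)" for i
    have "f i \<in> borel_measurable (borel \<Otimes>\<^sub>M M)" for i
    proof (cases "0 \<le> (real_of_int i + 1) / real (Suc n)")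
      case True
      have [measurable]: "X ((real_of_int i + 1) / real (Suc n)) \<in> borel_measurable M" "\<Omega> \<in> sets M"
        using X True \<Omega> by auto
      show ?thesis unfolding f_def using True by simp
    next
      case False
      then have "f i = (\<lambda>_. 0)" unfolding f_def by (auto simp: fun_eq_iff)
      then show ?thesis by simp
    qed
    then have "(\<lambda>p. f (\<lfloor>fst p * real (Suc n)\<rfloor>) p) \<in> borel_measurable (borel \<Otimes>\<^sub>M M)"
      by (rule measurable_compose_countable) measurable
    moreover have "f (\<lfloor>fst p * real (Suc n)\<rfloor>) p = g n p" for p
    proof -
      have "0 \<le> fst p \<Longrightarrow> 0 \<le> r n (fst p)" using r_gt[of "fst p" n] by linarith
      then show ?thesis unfolding f_def g_def r_def by (cases p) auto
    qed
    ultimately show ?thesis by simp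
  qed
  have "(\<lambda>n. g n p) \<longlonglongrightarrow> (\<lambda>(t, \<omega>). if 0 \<le> t \<and> \<omega> \<in> \<Omega> then X t \<omega> else 0) p" for p
  proof (cases p)
    case (Pair t \<omega>)
    show ?thesis
    proof (cases "0 \<le> t \<and> \<omega> \<in> \<Omega>")
      case True
      have "filterlim (\<lambda>n. r n t) (at_right t) sequentially"
        unfolding filterlim_at using r_gt[of t] r_lim[of t]
        by (auto intro!: always_eventually simp: less_imp_neq[THEN not_sym])
      then have "(\<lambda>n. X (r n t) \<omega>) \<longlonglongrightarrow> X t \<omega>"
        using rc[of t \<omega>] True by (rule_tac filterlim_compose) auto
      then show ?thesis using True by (simp add: Pair g_def)
    next
      case False
      then show ?thesis by (auto simp: Pair g_def)
    qed
  qed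
  then show ?thesis by (rule borel_measurable_LIMSEQ_metric[OF g])
qed

text \<open>A bound on second moments gives uniform integrability: cutting y off at level k costs at
  most y^2 / k. The cut-off means converge by dominated convergence, and the error is uniform in
  n.\<close>

lemma (in prob_space) tendsto_integral_L2_bounded:
  fixes Y :: "nat \<Rightarrow> 'a \<Rightarrow> real"
  assumes Y [measurable]: "\<And>n. Y n \<in> borel_measurable M" and Z [measurable]: "Z \<in> borel_measurable M"
    and nn: "\<And>n. AE \<omega> in M. 0 \<le> Y n \<omega>"
    and lim: "AE \<omega> in M. (\<lambda>n. Y n \<omega>) \<longlonglongrightarrow> Z \<omega>"
    and int: "\<And>n. integrable M (Y n)"
    and bound: "\<And>n. integrable M (\<lambda>\<omega>. (Y n \<omega>)\<^sup>2)" "\<And>n. (\<integral>\<omega>. (Y n \<omega>)\<^sup>2 \<partial>M) \<le> c"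
    and Z_int: "integrable M Z"
  shows "(\<lambda>n. \<integral>\<omega>. Y n \<omega> \<partial>M) \<longlonglongrightarrow> (\<integral>\<omega>. Z \<omega> \<partial>M)"
proof -
  have c0: "0 \<le> c" using bound(2)[of 0] by (smt (verit) integral_nonneg_AE AE_I2 zero_le_power2)
  have trunc: "(\<lambda>n. \<integral>\<omega>. min (Y n \<omega>) (real k) \<partial>M) \<longlonglongrightarrow> (\<integral>\<omega>. min (Z \<omega>) (real k) \<partial>M)" for k :: nat
  proof (rule integral_dominated_convergence[where w="\<lambda>_. real k"])
    show "AE \<omega> in M. (\<lambda>n. min (Y n \<omega>) (real k)) \<longlonglongrightarrow> min (Z \<omega>) (real k)"
      using lim by eventually_elim (intro tendsto_intros)
    show "AE \<omega> in M. norm (min (Y n \<omega>) (real k)) \<le> real k" for n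
      using nn[of n] by eventually_elim auto
  qed auto
  have err: "(\<integral>\<omega>. Y n \<omega> \<partial>M) - (\<integral>\<omega>. min (Y n \<omega>) (real (Suc k)) \<partial>M) \<le> c / real (Suc k)"
    "(\<integral>\<omega>. min (Y n \<omega>) (real (Suc k)) \<partial>M) \<le> (\<integral>\<omega>. Y n \<omega> \<partial>M)" for n k
  proof -
    have i: "integrable M (\<lambda>\<omega>. min (Y n \<omega>) (real (Suc k)))"
      using int by (intro integrable_min) auto
    show "(\<integral>\<omega>. min (Y n \<omega>) (real (Suc k)) \<partial>M) \<le> (\<integral>\<omega>. Y n \<omega> \<partial>M)"
      using i int by (intro integral_mono) auto
    have "(\<integral>\<omega>. Y n \<omega> \<partial>M) - (\<integral>\<omega>. min (Y n \<omega>) (real (Suc k)) \<partial>M)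
      = (\<integral>\<omega>. Y n \<omega> - min (Y n \<omega>) (real (Suc k)) \<partial>M)"
      using i int by simp
    also have "\<dots> \<le> (\<integral>\<omega>. (Y n \<omega>)\<^sup>2 / real (Suc k) \<partial>M)"
    proof (rule integral_mono)
      fix \<omega>
      show "Y n \<omega> - min (Y n \<omega>) (real (Suc k)) \<le> (Y n \<omega>)\<^sup>2 / real (Suc k)"
      proof (cases "Y n \<omega> \<le> real (Suc k)")
        case False
        then have "Y n \<omega> * real (Suc k) \<le> (Y n \<omega>)\<^sup>2"
          by (simp add: power2_eq_square mult_left_mono)
        then have "Y n \<omega> \<le> (Y n \<omega>)\<^sup>2 / real (Suc k)" by (simp add: field_simps)
        then show ?thesis using False by simp
      qed simp
    qed (use i int bound in auto)
    also have "\<dots> \<le> c / real (Suc k)" using bound(2)[of n] by (simp add: divide_right_mono)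
    finally show "(\<integral>\<omega>. Y n \<omega> \<partial>M) - (\<integral>\<omega>. min (Y n \<omega>) (real (Suc k)) \<partial>M) \<le> c / real (Suc k)" .
  qed
  have Zk: "(\<lambda>k. \<integral>\<omega>. min (Z \<omega>) (real (Suc k)) \<partial>M) \<longlonglongrightarrow> (\<integral>\<omega>. Z \<omega> \<partial>M)"
  proof (rule integral_dominated_convergence[where w="\<lambda>\<omega>. \<bar>Z \<omega>\<bar>"])
    show "AE \<omega> in M. (\<lambda>k. min (Z \<omega>) (real (Suc k))) \<longlonglongrightarrow> Z \<omega>"
    proof (rule AE_I2, rule tendsto_eventually)
      fix \<omega>
      obtain k0 :: nat where "Z \<omega> \<le> real k0" using real_arch_simple by blast
      then show "\<forall>\<^sub>F k in sequentially. min (Z \<omega>) (real (Suc k)) = Z \<omega>"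
        by (auto simp: eventually_sequentially intro!: exI[of _ k0])
    qed
  qed (use Z_int in auto)
  show ?thesis
  proof (rule LIMSEQ_I)
    fix e :: real assume e: "0 < e"
    have "(\<lambda>k. c / real (Suc k)) \<longlonglongrightarrow> 0"
      using tendsto_mult[OF tendsto_const[of c] hseq_lim] by (simp add: hseq_def)
    then have "\<forall>\<^sub>F k in sequentially. c / real (Suc k) < e / 3"
      using e by (intro order_tendstoD) auto
    moreover have "\<forall>\<^sub>F k in sequentially. dist (\<integral>\<omega>. min (Z \<omega>) (real (Suc k)) \<partial>M) (\<integral>\<omega>. Z \<omega> \<partial>M) < e / 3"
      using tendstoD[OF Zk, of "e/3"] e by simp
    ultimately have "\<forall>\<^sub>F k in sequentially. c / real (Suc k) < e / 3 \<and>
        dist (\<integral>\<omega>. min (Z \<omega>) (real (Suc k)) \<partial>M) (\<integral>\<omega>. Z \<omega> \<partial>M) < e / 3" by eventually_elim auto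
    then obtain k where k: "c / real (Suc k) < e / 3"
        "dist (\<integral>\<omega>. min (Z \<omega>) (real (Suc k)) \<partial>M) (\<integral>\<omega>. Z \<omega> \<partial>M) < e / 3"
      by (auto simp: eventually_sequentially)
    have "\<forall>\<^sub>F n in sequentially. dist (\<integral>\<omega>. min (Y n \<omega>) (real (Suc k)) \<partial>M) (\<integral>\<omega>. min (Z \<omega>) (real (Suc k)) \<partial>M) < e / 3"
      using tendstoD[OF trunc[of "Suc k"], of "e/3"] e by simp
    then obtain n0 where n0: "\<And>n. n \<ge> n0 \<Longrightarrow>
        dist (\<integral>\<omega>. min (Y n \<omega>) (real (Suc k)) \<partial>M) (\<integral>\<omega>. min (Z \<omega>) (real (Suc k)) \<partial>M) < e / 3"
      by (auto simp: eventually_sequentially)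
    have "norm ((\<integral>\<omega>. Y n \<omega> \<partial>M) - (\<integral>\<omega>. Z \<omega> \<partial>M)) < e" if "n \<ge> n0" for n
      using n0[OF that] k err[of n k] by (simp only: real_norm_def dist_real_def)
    then show "\<exists>n0. \<forall>n\<ge>n0. norm ((\<integral>\<omega>. Y n \<omega> \<partial>M) - (\<integral>\<omega>. Z \<omega> \<partial>M)) < e" by blast
  qed
qed

section \<open>The optional stopping identity\<close>

lemma nn_integral_exp_interval:
  fixes a b \<psi> :: real
  assumes "a \<le> b"
  shows "(\<integral>\<^sup>+t. ennreal (exp (- ((t - a) * \<psi>))) * indicator {a<..b} t \<partial>lborel)
      = ennreal (if \<psi> = 0 then b - a else (1 - exp (- ((b - a) * \<psi>))) / \<psi>)"
proof -
  define \<Phi> where "\<Phi> t = (if \<psi> = 0 then t else - exp (- ((t - a) * \<psi>)) / \<psi>)" for t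
  have "(\<integral>\<^sup>+t. ennreal (exp (- ((t - a) * \<psi>))) * indicator {a<..b} t \<partial>lborel)
      = (\<integral>\<^sup>+t. ennreal (exp (- ((t - a) * \<psi>))) * indicator {a..b} t \<partial>lborel)"
    by (intro nn_integral_cong_AE, use AE_lborel_singleton[of a] in eventually_elim)
       (auto simp: indicator_def)
  also have "\<dots> = ennreal (\<Phi> b - \<Phi> a)"
  proof (rule nn_integral_FTC_Icc)
    fix t
    show "(\<Phi> has_real_derivative exp (- ((t - a) * \<psi>))) (at t)"
      unfolding \<Phi>_def by (cases "\<psi> = 0") (auto intro!: derivative_eq_intros)
  qed (use assms in auto)
  also have "\<Phi> b - \<Phi> a = (if \<psi> = 0 then b - a else (1 - exp (- ((b - a) * \<psi>))) / \<psi>)"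
    unfolding \<Phi>_def by (auto simp: diff_divide_distrib)
  finally show ?thesis .
qed

text \<open>The model case of \<open>y\<close> is the inner product of u with a Levy process of
  exponent \<open>\<psi>\<close> in direction u. The condition \<open>increment\<close> says that
  exp(- y t + t \<psi>) is a martingale, tested on events of \<open>F s\<close>; as it uses
  nonnegative integrals, no integrability has to be carried along.\<close>

locale exp_levy = prob_space M for M :: "'a measure" +
  fixes F :: "real \<Rightarrow> 'a measure" and y :: "real \<Rightarrow> 'a \<Rightarrow> real" and \<psi> :: real
  assumes sub: "\<And>t. 0 \<le> t \<Longrightarrow> subalgebra M (F t)"
    and joint [measurable]: "(\<lambda>(t, \<omega>). y t \<omega>) \<in> borel_measurable (borel \<Otimes>\<^sub>M M)"
    and zero: "\<And>\<omega>. \<omega> \<in> space M \<Longrightarrow> y 0 \<omega> = 0"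
    and right_cont: "\<And>t \<omega>. 0 \<le> t \<Longrightarrow> \<omega> \<in> space M \<Longrightarrow> ((\<lambda>s. y s \<omega>) \<longlongrightarrow> y t \<omega>) (at_right t)"
    and increment: "\<And>s t A. 0 \<le> s \<Longrightarrow> s \<le> t \<Longrightarrow> A \<in> sets (F s) \<Longrightarrow>
      (\<integral>\<^sup>+\<omega>. ennreal (exp (- y t \<omega>)) * indicator A \<omega> \<partial>M) =
        ennreal (exp (- ((t - s) * \<psi>))) * (\<integral>\<^sup>+\<omega>. ennreal (exp (- y s \<omega>)) * indicator A \<omega> \<partial>M)"
begin

lemma measurable_y [measurable]: "y t \<in> borel_measurable M"
  using measurable_compose[OF measurable_Pair1' joint, of t] by simp

lemma measurable_y_at [measurable]:
  assumes "\<sigma> \<in> borel_measurable M"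
  shows "(\<lambda>\<omega>. y (\<sigma> \<omega>) \<omega>) \<in> borel_measurable M"
  using assms by (rule_tac measurable_compose[OF measurable_Pair[OF assms measurable_ident_sets[OF refl]] joint, simplified])

lemma moment: "0 \<le> t \<Longrightarrow> (\<integral>\<^sup>+\<omega>. ennreal (exp (- y t \<omega>)) \<partial>M) = ennreal (exp (- (t * \<psi>)))"
proof -
  assume t: "0 \<le> t"
  have sp: "space M \<in> sets (F 0)" using sub[of 0] by (metis order_refl sets.top subalgebra_def)
  have "(\<integral>\<^sup>+\<omega>. ennreal (exp (- y t \<omega>)) \<partial>M) = (\<integral>\<^sup>+\<omega>. ennreal (exp (- y t \<omega>)) * indicator (space M) \<omega> \<partial>M)"
    by (intro nn_integral_cong) auto
  also have "\<dots> = ennreal (exp (- ((t - 0) * \<psi>))) * (\<integral>\<^sup>+\<omega>. ennreal (exp (- y 0 \<omega>)) * indicator (space M) \<omega> \<partial>M)"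
    using t sp by (intro increment) auto
  also have "(\<integral>\<^sup>+\<omega>. ennreal (exp (- y 0 \<omega>)) * indicator (space M) \<omega> \<partial>M) = (\<integral>\<^sup>+\<omega>. 1 \<partial>M)"
    by (intro nn_integral_cong) (auto simp: zero)
  finally show ?thesis by (simp add: emeasure_space_1)
qed

text \<open>Half-open intervals make the values on adjacent intervals add up exactly; values in
  \<open>ennreal\<close> make the integral meaningful without integrability.\<close>

definition occ :: "real \<Rightarrow> real \<Rightarrow> 'a \<Rightarrow> ennreal" where
  "occ a b \<omega> = (\<integral>\<^sup>+t. ennreal (exp (- y t \<omega>)) * indicator {a<..b} t \<partial>lborel)"

lemma joint_lborel [measurable]: "(\<lambda>(t, \<omega>). y t \<omega>) \<in> borel_measurable (lborel \<Otimes>\<^sub>M M)"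
  "(\<lambda>(\<omega>, t). y t \<omega>) \<in> borel_measurable (M \<Otimes>\<^sub>M lborel)"
proof -
  show "(\<lambda>(t, \<omega>). y t \<omega>) \<in> borel_measurable (lborel \<Otimes>\<^sub>M M)"
    using joint by (simp cong: measurable_cong_sets sets_pair_measure_cong)
  then show "(\<lambda>(\<omega>, t). y t \<omega>) \<in> borel_measurable (M \<Otimes>\<^sub>M lborel)"
    by (subst measurable_pair_swap_iff) (simp add: case_prod_beta')
qed

lemma measurable_path [measurable]: "\<omega> \<in> space M \<Longrightarrow> (\<lambda>t. y t \<omega>) \<in> borel_measurable borel"
  using measurable_compose[OF measurable_Pair1'[of \<omega> M lborel] joint_lborel(2)] by simp

lemma measurable_occ [measurable]:
  assumes [measurable]: "f \<in> borel_measurable M" "g \<in> borel_measurable M"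
  shows "(\<lambda>\<omega>. occ (f \<omega>) (g \<omega>) \<omega>) \<in> borel_measurable M"
proof -
  have [measurable]: "(\<lambda>p. y (snd p) (fst p)) \<in> borel_measurable (M \<Otimes>\<^sub>M lborel)"
    using joint_lborel(2) by (simp add: case_prod_beta')
  note [measurable] = indicator_measurable_lborel[OF assms]
  show ?thesis unfolding occ_def
    by (rule lborel.borel_measurable_nn_integral_fst[where f="\<lambda>p. ennreal (exp (- y (snd p) (fst p))) * indicator {f (fst p)<..g (fst p)} (snd p)", simplified]) measurable
qed

text \<open>With c = E[exp(- y a); A], both sides equal c (1 - exp(- (b - a) \<psi>)): the left one
  by the martingale property, the right one by Fubini and integration of exp(- (t - a) \<psi>) over
  the interval. Keeping \<psi> as a factor, not as a divisor, includes the case \<psi> = 0.\<close>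

lemma identity_on_event:
  assumes ab: "0 \<le> a" "a \<le> b" and A: "A \<in> sets (F a)"
  shows "integrable M (\<lambda>\<omega>. indicator A \<omega> * (exp (- y a \<omega>) - exp (- y b \<omega>)))" (is ?i)
    and "(\<integral>\<^sup>+\<omega>. indicator A \<omega> * occ a b \<omega> \<partial>M) < \<infinity>" (is ?f)
    and "(\<integral>\<omega>. indicator A \<omega> * (exp (- y a \<omega>) - exp (- y b \<omega>)) \<partial>M)
      = \<psi> * enn2real (\<integral>\<^sup>+\<omega>. indicator A \<omega> * occ a b \<omega> \<partial>M)" (is ?e)
proof -
  have [measurable]: "A \<in> sets M" using A sub[OF ab(1)] by (auto simp: subalgebra_def)
  define c where "c = enn2real (\<integral>\<^sup>+\<omega>. ennreal (exp (- y a \<omega>)) * indicator A \<omega> \<partial>M)"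
  have fin: "(\<integral>\<^sup>+\<omega>. ennreal (exp (- y a \<omega>)) * indicator A \<omega> \<partial>M) < \<infinity>"
  proof -
    have "(\<integral>\<^sup>+\<omega>. ennreal (exp (- y a \<omega>)) * indicator A \<omega> \<partial>M) \<le> (\<integral>\<^sup>+\<omega>. ennreal (exp (- y a \<omega>)) \<partial>M)"
      by (intro nn_integral_mono) (auto simp: indicator_def)
    then show ?thesis by (simp add: moment ab order_le_less_trans)
  qed
  then have c: "(\<integral>\<^sup>+\<omega>. ennreal (exp (- y a \<omega>)) * indicator A \<omega> \<partial>M) = ennreal c"
    unfolding c_def by simp
  have c0: "0 \<le> c" unfolding c_def by simp
  have ct: "(\<integral>\<^sup>+\<omega>. ennreal (exp (- y t \<omega>)) * indicator A \<omega> \<partial>M) = ennreal (c * exp (- ((t - a) * \<psi>)))"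
    if "a \<le> t" for t
    using increment[OF ab(1) that A] c c0 by (simp add: ennreal_mult mult.commute)
  have hb: "has_bochner_integral M (\<lambda>\<omega>. exp (- y t \<omega>) * indicator A \<omega>) (c * exp (- ((t - a) * \<psi>)))"
    if "a \<le> t" for t
    using ct[OF that] c0
    by (intro has_bochner_integral_nn_integral) (auto simp: ennreal_mult' ennreal_indicator)
  have d: "has_bochner_integral M (\<lambda>\<omega>. indicator A \<omega> * (exp (- y a \<omega>) - exp (- y b \<omega>)))
     (c - c * exp (- ((b - a) * \<psi>)))"
    using has_bochner_integral_diff[OF hb[of a] hb[of b]] ab by (simp add: algebra_simps)
  then show ?i by (simp add: has_bochner_integral_iff)
  define l where "l = (if \<psi> = 0 then b - a else (1 - exp (- ((b - a) * \<psi>))) / \<psi>)"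
  have l: "(\<integral>\<^sup>+t. ennreal (exp (- ((t - a) * \<psi>))) * indicator {a<..b} t \<partial>lborel) = ennreal l"
    unfolding l_def using nn_integral_exp_interval[OF ab(2)] .
  have l0: "0 \<le> l"
  proof (cases "\<psi> > 0")
    case True
    then have "0 \<le> (b - a) * \<psi>" using ab by simp
    then show ?thesis using True by (auto simp: l_def)
  next
    case False
    then have "(b - a) * \<psi> \<le> 0" using ab by (simp add: mult_nonneg_nonpos)
    then have "1 \<le> exp (- ((b - a) * \<psi>))" by simp
    then show ?thesis using False ab by (auto simp: l_def intro!: divide_nonpos_neg)
  qed
  interpret pair_sigma_finite lborel M ..
  have "(\<integral>\<^sup>+\<omega>. indicator A \<omega> * occ a b \<omega> \<partial>M)
      = (\<integral>\<^sup>+\<omega>. (\<integral>\<^sup>+t. (ennreal (exp (- y t \<omega>)) * indicator A \<omega>) * indicator {a<..b} t \<partial>lborel) \<partial>M)"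
    unfolding occ_def
    by (intro nn_integral_cong, subst nn_integral_cmult[symmetric]) (auto simp: ac_simps)
  also have "\<dots> = (\<integral>\<^sup>+t. (\<integral>\<^sup>+\<omega>. (ennreal (exp (- y t \<omega>)) * indicator A \<omega>) * indicator {a<..b} t \<partial>M) \<partial>lborel)"
    by (rule Fubini') measurable
  also have "\<dots> = (\<integral>\<^sup>+t. ennreal c * (ennreal (exp (- ((t - a) * \<psi>))) * indicator {a<..b} t) \<partial>lborel)"
  proof (rule nn_integral_cong)
    fix t :: real
    show "(\<integral>\<^sup>+\<omega>. (ennreal (exp (- y t \<omega>)) * indicator A \<omega>) * indicator {a<..b} t \<partial>M)
      = ennreal c * (ennreal (exp (- ((t - a) * \<psi>))) * indicator {a<..b} t)"
      using ct[of t] c0 by (auto simp: indicator_def ennreal_mult)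
  qed
  also have "\<dots> = ennreal (c * l)"
    by (subst nn_integral_cmult) (auto simp: l ennreal_mult c0 l0)
  finally have o: "(\<integral>\<^sup>+\<omega>. indicator A \<omega> * occ a b \<omega> \<partial>M) = ennreal (c * l)" .
  then show ?f by simp
  have \<psi>l: "\<psi> * l = 1 - exp (- ((b - a) * \<psi>))" by (simp add: l_def)
  have "\<psi> * (c * l) = c * (\<psi> * l)" by simp
  then have "c - c * exp (- ((b - a) * \<psi>)) = \<psi> * (c * l)"
    unfolding \<psi>l by (simp only: right_diff_distrib mult_1_right)
  then show ?e using d c0 l0 by (simp add: o has_bochner_integral_iff)
qed

lemma occ_add: "a \<le> b \<Longrightarrow> b \<le> c \<Longrightarrow> \<omega> \<in> space M \<Longrightarrow> occ a b \<omega> + occ b c \<omega> = occ a c \<omega>"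
proof -
  assume "a \<le> b" "b \<le> c" and [measurable]: "\<omega> \<in> space M"
  show ?thesis unfolding occ_def
    by (subst nn_integral_add[symmetric]) (auto intro!: nn_integral_cong simp: indicator_def \<open>a \<le> b\<close> \<open>b \<le> c\<close> order_trans[OF _ \<open>b \<le> c\<close>] less_le_trans le_less_trans[OF \<open>a \<le> b\<close>])
qed

lemma occ_fin: "0 \<le> b \<Longrightarrow> (\<integral>\<^sup>+\<omega>. occ 0 b \<omega> \<partial>M) < \<infinity>"
proof -
  assume b: "0 \<le> b"
  have "space M \<in> sets (F 0)" using sub[of 0] by (metis order_refl sets.top subalgebra_def)
  from identity_on_event(2)[OF order_refl b this]
  show ?thesis by (subst (asm) nn_integral_cong[where v="occ 0 b"]) auto
qed

text \<open>Rounding \<open>\<sigma>\<close> up to the grid means that the cell starting at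
  \<open>g k\<close> is traversed exactly when \<open>g k < \<sigma>\<close>, an event known at time
  \<open>g k\<close>. So \<open>identity_on_event\<close> applies to every cell, and the sum over
  the finitely many cells telescopes.\<close>

lemma optional_stopping_grid:
  fixes K n :: nat
  assumes \<sigma>: "\<And>\<omega>. \<omega> \<in> space M \<Longrightarrow> 0 \<le> \<sigma> \<omega> \<and> \<sigma> \<omega> \<le> real K"
    and ev: "\<And>t. 0 \<le> t \<Longrightarrow> {\<omega> \<in> space M. t < \<sigma> \<omega>} \<in> sets (F t)"
  defines "s \<equiv> \<lambda>\<omega>. real_of_int \<lceil>\<sigma> \<omega> * real (Suc n)\<rceil> / real (Suc n)"
  shows "integrable M (\<lambda>\<omega>. exp (- y (s \<omega>) \<omega>))"
    and "(\<integral>\<omega>. exp (- y (s \<omega>) \<omega>) \<partial>M) = 1 - \<psi> * enn2real (\<integral>\<^sup>+\<omega>. occ 0 (s \<omega>) \<omega> \<partial>M)"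
proof -
  define g where "g k = real k / real (Suc n)" for k
  define A where "A k = {\<omega> \<in> space M. g k < \<sigma> \<omega>}" for k
  \<comment> \<open>Number of cells of length 1 / (n + 1) that cover [0, K].\<close>
  define L where "L = K * Suc n"
  have g: "0 \<le> g k" "g k \<le> g (Suc k)" "g 0 = 0" for k by (auto simp: g_def divide_right_mono)
  have A: "A k \<in> sets (F (g k))" for k unfolding A_def using ev g by auto
  have [measurable]: "A k \<in> sets M" for k using A[of k] sub[OF g(1)[of k]] by (auto simp: subalgebra_def)
  define c where "c \<omega> = nat \<lceil>\<sigma> \<omega> * real (Suc n)\<rceil>" for \<omega>
  have s: "s \<omega> = g (c \<omega>)" if "\<omega> \<in> space M" for \<omega>
    using \<sigma>[OF that] unfolding s_def c_def g_def by (simp add: of_nat_nat)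
  have cL: "c \<omega> \<le> L" if "\<omega> \<in> space M" for \<omega>
  proof -
    have "\<sigma> \<omega> * real (Suc n) \<le> real K * real (Suc n)"
      using \<sigma>[OF that] by (intro mult_right_mono) auto
    also have "\<dots> = real_of_int (int L)" by (simp add: L_def algebra_simps)
    finally have "\<lceil>\<sigma> \<omega> * real (Suc n)\<rceil> \<le> int L" by (rule ceiling_le)
    then show ?thesis by (simp only: c_def nat_le_iff)
  qed
  have Ac: "\<omega> \<in> A k \<longleftrightarrow> k < c \<omega>" if "\<omega> \<in> space M" for \<omega> k
  proof -
    have "\<omega> \<in> A k \<longleftrightarrow> real_of_int (int k) < \<sigma> \<omega> * real (Suc n)"
      using that by (simp add: A_def g_def pos_divide_less_eq)
    also have "\<dots> \<longleftrightarrow> int k < \<lceil>\<sigma> \<omega> * real (Suc n)\<rceil>" by (simp add: less_ceiling_iff)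
    finally show ?thesis by (simp add: c_def zless_nat_eq_int_zless)
  qed
  have tel: "exp (- y (s \<omega>) \<omega>) = 1 - (\<Sum>k<L. indicator (A k) \<omega> * (exp (- y (g k) \<omega>) - exp (- y (g (Suc k)) \<omega>)))"
    if w: "\<omega> \<in> space M" for \<omega>
  proof -
    have "(\<Sum>k<L. indicator (A k) \<omega> * (exp (- y (g k) \<omega>) - exp (- y (g (Suc k)) \<omega>)))
      = (\<Sum>k<c \<omega>. exp (- y (g k) \<omega>) - exp (- y (g (Suc k)) \<omega>))"
      using cL[OF w] Ac[OF w] by (intro sum.mono_neutral_cong_right) (auto simp: indicator_def)
    also have "\<dots> = exp (- y (g 0) \<omega>) - exp (- y (g (c \<omega>)) \<omega>)"
      by (rule sum_lessThan_telescope')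
    finally show ?thesis using w by (simp add: g zero s)
  qed
  have occ_sum: "occ 0 (s \<omega>) \<omega> = (\<Sum>k<L. indicator (A k) \<omega> * occ (g k) (g (Suc k)) \<omega>)"
    if w: "\<omega> \<in> space M" for \<omega>
  proof -
    have "(\<Sum>k<L. indicator (A k) \<omega> * occ (g k) (g (Suc k)) \<omega>) = (\<Sum>k<c \<omega>. occ (g k) (g (Suc k)) \<omega>)"
      using cL[OF w] Ac[OF w] by (intro sum.mono_neutral_cong_right) (auto simp: indicator_def)
    also have "\<dots> = occ 0 (g m) \<omega>" if "m = c \<omega>" for m
      unfolding that[symmetric]
    proof (induction m)
      case 0 then show ?case by (simp add: g occ_def)
    next
      case (Suc m) then show ?case using w g by (simp add: occ_add)
    qed
    finally show ?thesis using s[OF w] by simp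
  qed
  note I = identity_on_event[OF g(1) g(2) A]
  have int: "integrable M (\<lambda>\<omega>. 1 - (\<Sum>k<L. indicator (A k) \<omega> * (exp (- y (g k) \<omega>) - exp (- y (g (Suc k)) \<omega>))))"
    using I(1) by (intro Bochner_Integration.integrable_diff Bochner_Integration.integrable_sum) auto
  then show "integrable M (\<lambda>\<omega>. exp (- y (s \<omega>) \<omega>))"
    by (subst Bochner_Integration.integrable_cong[OF refl tel]) auto
  have "(\<integral>\<omega>. exp (- y (s \<omega>) \<omega>) \<partial>M) = 1 - (\<Sum>k<L. \<psi> * enn2real (\<integral>\<^sup>+\<omega>. indicator (A k) \<omega> * occ (g k) (g (Suc k)) \<omega> \<partial>M))"
  proof -
    have "(\<integral>\<omega>. exp (- y (s \<omega>) \<omega>) \<partial>M)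
      = (\<integral>\<omega>. 1 - (\<Sum>k<L. indicator (A k) \<omega> * (exp (- y (g k) \<omega>) - exp (- y (g (Suc k)) \<omega>))) \<partial>M)"
      by (rule Bochner_Integration.integral_cong[OF refl tel])
    also have "\<dots> = (\<integral>\<omega>. 1 \<partial>M) - (\<integral>\<omega>. (\<Sum>k<L. indicator (A k) \<omega> * (exp (- y (g k) \<omega>) - exp (- y (g (Suc k)) \<omega>))) \<partial>M)"
      using I(1) by (intro Bochner_Integration.integral_diff Bochner_Integration.integrable_sum) auto
    also have "(\<integral>\<omega>. (\<Sum>k<L. indicator (A k) \<omega> * (exp (- y (g k) \<omega>) - exp (- y (g (Suc k)) \<omega>))) \<partial>M)
      = (\<Sum>k<L. \<psi> * enn2real (\<integral>\<^sup>+\<omega>. indicator (A k) \<omega> * occ (g k) (g (Suc k)) \<omega> \<partial>M))"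
      by (subst Bochner_Integration.integral_sum[OF I(1)]) (simp only: I(3))
    finally show ?thesis by (simp add: prob_space)
  qed
  also have "\<dots> = 1 - \<psi> * enn2real (\<Sum>k<L. \<integral>\<^sup>+\<omega>. indicator (A k) \<omega> * occ (g k) (g (Suc k)) \<omega> \<partial>M)"
    using I(2) by (subst enn2real_sum) (auto simp: sum_distrib_left)
  also have "(\<Sum>k<L. \<integral>\<^sup>+\<omega>. indicator (A k) \<omega> * occ (g k) (g (Suc k)) \<omega> \<partial>M) = (\<integral>\<^sup>+\<omega>. occ 0 (s \<omega>) \<omega> \<partial>M)"
    by (subst nn_integral_sum[symmetric]) (auto intro!: nn_integral_cong simp: occ_sum)
  finally show "(\<integral>\<omega>. exp (- y (s \<omega>) \<omega>) \<partial>M) = 1 - \<psi> * enn2real (\<integral>\<^sup>+\<omega>. occ 0 (s \<omega>) \<omega> \<partial>M)" .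
qed

end

text \<open>The identity is exact on a grid; second moments, controlled by the same identity for \<open>2y\<close>,
  give the uniform integrability needed to refine the grid.\<close>

lemma optional_stopping_bounded:
  fixes K :: nat
  assumes 1: "exp_levy M F y \<psi>" and 2: "exp_levy M F (\<lambda>t \<omega>. 2 * y t \<omega>) \<psi>2"
    and \<sigma> [measurable]: "\<sigma> \<in> borel_measurable M"
    and \<sigma>K: "\<And>\<omega>. \<omega> \<in> space M \<Longrightarrow> 0 \<le> \<sigma> \<omega> \<and> \<sigma> \<omega> \<le> real K"
    and ev: "\<And>t. 0 \<le> t \<Longrightarrow> {\<omega> \<in> space M. t < \<sigma> \<omega>} \<in> sets (F t)"
    and int: "integrable M (\<lambda>\<omega>. exp (- y (\<sigma> \<omega>) \<omega>))"
  shows "(\<integral>\<^sup>+\<omega>. \<integral>\<^sup>+t. ennreal (exp (- y t \<omega>)) * indicator {0<..\<sigma> \<omega>} t \<partial>lborel \<partial>M) < \<infinity>"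
    and "(\<integral>\<omega>. exp (- y (\<sigma> \<omega>) \<omega>) \<partial>M) = 1 - \<psi> *
      enn2real (\<integral>\<^sup>+\<omega>. \<integral>\<^sup>+t. ennreal (exp (- y t \<omega>)) * indicator {0<..\<sigma> \<omega>} t \<partial>lborel \<partial>M)"
proof -
  interpret E1: exp_levy M F y \<psi> by fact
  interpret E2: exp_levy M F "\<lambda>t \<omega>. 2 * y t \<omega>" \<psi>2 by fact
  define s where "s n \<omega> = real_of_int \<lceil>\<sigma> \<omega> * real (Suc n)\<rceil> / real (Suc n)" for n \<omega>
  have [measurable]: "s n \<in> borel_measurable M" for n unfolding s_def by measurable
  have s_ge: "\<sigma> \<omega> \<le> s n \<omega>" for n \<omega>
    unfolding s_def by (simp add: pos_le_divide_eq)
  have s_le: "s n \<omega> \<le> \<sigma> \<omega> + hseq n" for n \<omega>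
  proof -
    have "s n \<omega> \<le> (\<sigma> \<omega> * real (Suc n) + 1) / real (Suc n)"
      unfolding s_def by (intro divide_right_mono) linarith+
    also have "\<dots> = \<sigma> \<omega> + hseq n" by (simp add: field_simps hseq_def)
    finally show ?thesis .
  qed
  have s_lim: "(\<lambda>n. s n \<omega>) \<longlonglongrightarrow> \<sigma> \<omega>" for \<omega>
    by (intro tendsto_hseq_above s_le s_ge)
  \<comment> \<open>Rounding up overshoots by at most one mesh, which is at most 1; hence the common
    horizon K + 1 below.\<close>
  have s_K: "s n \<omega> \<le> real (Suc K)" if "\<omega> \<in> space M" for n \<omega>
    using s_le[of n \<omega>] \<sigma>K[OF that] hseq(2)[of n] by linarith
  have grid1: "integrable M (\<lambda>\<omega>. exp (- y (s n \<omega>) \<omega>))"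
    "(\<integral>\<omega>. exp (- y (s n \<omega>) \<omega>) \<partial>M) = 1 - \<psi> * enn2real (\<integral>\<^sup>+\<omega>. E1.occ 0 (s n \<omega>) \<omega> \<partial>M)" for n
    unfolding s_def using E1.optional_stopping_grid[OF \<sigma>K ev] by auto
  have grid2: "integrable M (\<lambda>\<omega>. exp (- (2 * y (s n \<omega>) \<omega>)))"
    "(\<integral>\<omega>. exp (- (2 * y (s n \<omega>) \<omega>)) \<partial>M) = 1 - \<psi>2 * enn2real (\<integral>\<^sup>+\<omega>. E2.occ 0 (s n \<omega>) \<omega> \<partial>M)" for n
    unfolding s_def using E2.optional_stopping_grid[OF \<sigma>K ev] by auto
  have occ1: "E1.occ 0 (s n \<omega>) \<omega> \<le> E1.occ 0 (real (Suc K)) \<omega>" if "\<omega> \<in> space M" for n \<omega>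
    unfolding E1.occ_def using s_K[OF that, of n]
    by (intro nn_integral_mono mult_left_mono) (auto simp: indicator_def)
  have occ2: "E2.occ 0 (s n \<omega>) \<omega> \<le> E2.occ 0 (real (Suc K)) \<omega>" if "\<omega> \<in> space M" for n \<omega>
    unfolding E2.occ_def using s_K[OF that, of n]
    by (intro nn_integral_mono mult_left_mono) (auto simp: indicator_def)
  have fin1: "(\<integral>\<^sup>+\<omega>. E1.occ 0 (real (Suc K)) \<omega> \<partial>M) < \<infinity>" by (rule E1.occ_fin) simp
  have fin2: "(\<integral>\<^sup>+\<omega>. E2.occ 0 (real (Suc K)) \<omega> \<partial>M) < \<infinity>" by (rule E2.occ_fin) simp
  have occ_s: "E1.occ 0 (\<sigma> \<omega>) \<omega> \<le> E1.occ 0 (real (Suc K)) \<omega>" if "\<omega> \<in> space M" for \<omega>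
    unfolding E1.occ_def using \<sigma>K[OF that]
    by (intro nn_integral_mono mult_left_mono) (auto simp: indicator_def)
  have *: "(\<integral>\<^sup>+\<omega>. E1.occ 0 (\<sigma> \<omega>) \<omega> \<partial>M) < \<infinity>"
    using order_le_less_trans[OF nn_integral_mono[OF occ_s] fin1] by simp
  then show "(\<integral>\<^sup>+\<omega>. \<integral>\<^sup>+t. ennreal (exp (- y t \<omega>)) * indicator {0<..\<sigma> \<omega>} t \<partial>lborel \<partial>M) < \<infinity>"
    by (simp add: E1.occ_def)
  have "(\<lambda>n. \<integral>\<omega>. exp (- y (s n \<omega>) \<omega>) \<partial>M) \<longlonglongrightarrow> (\<integral>\<omega>. exp (- y (\<sigma> \<omega>) \<omega>) \<partial>M)"
  \<comment> \<open>The bound on second moments is the grid identity for 2y, with the occupation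
    integral enlarged to the horizon K + 1. The absolute value is there because
    \<open>\<psi>2\<close> may have either sign.\<close>
  proof (rule E1.tendsto_integral_L2_bounded[where c="1 + \<bar>\<psi>2\<bar> * enn2real (\<integral>\<^sup>+\<omega>. E2.occ 0 (real (Suc K)) \<omega> \<partial>M)"])
    show "AE \<omega> in M. (\<lambda>n. exp (- y (s n \<omega>) \<omega>)) \<longlonglongrightarrow> exp (- y (\<sigma> \<omega>) \<omega>)"
    proof (rule AE_I2)
      fix \<omega> assume w: "\<omega> \<in> space M"
      have "((\<lambda>t. y t \<omega>) \<longlongrightarrow> y (\<sigma> \<omega>) \<omega>) (at (\<sigma> \<omega>) within {\<sigma> \<omega>..})"
        using E1.right_cont[OF _ w, of "\<sigma> \<omega>"] \<sigma>K[OF w] by (simp add: at_within_atLeast)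
      then have "continuous (at (\<sigma> \<omega>) within {\<sigma> \<omega>..}) (\<lambda>t. y t \<omega>)" by (simp add: continuous_within)
      then have "((\<lambda>t. y t \<omega>) \<circ> (\<lambda>n. s n \<omega>)) \<longlonglongrightarrow> y (\<sigma> \<omega>) \<omega>"
        unfolding continuous_within_sequentially using s_ge s_lim by auto
      then show "(\<lambda>n. exp (- y (s n \<omega>) \<omega>)) \<longlonglongrightarrow> exp (- y (\<sigma> \<omega>) \<omega>)"
        by (intro tendsto_intros) (simp add: o_def)
    qed
    have sq: "(exp (- y (s n \<omega>) \<omega>))\<^sup>2 = exp (- (2 * y (s n \<omega>) \<omega>))" for n \<omega>
      by (simp add: exp_double[symmetric])
    show "integrable M (\<lambda>\<omega>. (exp (- y (s n \<omega>) \<omega>))\<^sup>2)" for n unfolding sq by (rule grid2)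
    show "(\<integral>\<omega>. (exp (- y (s n \<omega>) \<omega>))\<^sup>2 \<partial>M) \<le> 1 + \<bar>\<psi>2\<bar> * enn2real (\<integral>\<^sup>+\<omega>. E2.occ 0 (real (Suc K)) \<omega> \<partial>M)" for n
    proof -
      define e where "e = enn2real (\<integral>\<^sup>+\<omega>. E2.occ 0 (s n \<omega>) \<omega> \<partial>M)"
      have "e \<le> enn2real (\<integral>\<^sup>+\<omega>. E2.occ 0 (real (Suc K)) \<omega> \<partial>M)"
        unfolding e_def using fin2 by (intro enn2real_mono nn_integral_mono occ2) auto
      moreover have "- (\<psi>2 * e) \<le> \<bar>\<psi>2\<bar> * e"
        using mult_right_mono[of "- \<psi>2" "\<bar>\<psi>2\<bar>" e] by (simp add: e_def)
      ultimately show ?thesis unfolding sq grid2 e_def[symmetric]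
        by (smt (verit) mult_left_mono abs_ge_zero)
    qed
  qed (use grid1 int in auto)
  moreover have "(\<lambda>n. \<integral>\<omega>. exp (- y (s n \<omega>) \<omega>) \<partial>M) \<longlonglongrightarrow> 1 - \<psi> * enn2real (\<integral>\<^sup>+\<omega>. E1.occ 0 (\<sigma> \<omega>) \<omega> \<partial>M)"
  proof -
    have "(\<lambda>n. \<integral>\<^sup>+\<omega>. E1.occ 0 (s n \<omega>) \<omega> \<partial>M) \<longlonglongrightarrow> (\<integral>\<^sup>+\<omega>. E1.occ 0 (\<sigma> \<omega>) \<omega> \<partial>M)"
    proof (rule nn_integral_dominated_convergence[where w="E1.occ 0 (real (Suc K))"])
      have "AE \<omega> in M. E1.occ 0 (real (Suc K)) \<omega> \<noteq> \<infinity>"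
        using fin1 by (intro nn_integral_noteq_infinite) auto
      then show "AE \<omega> in M. (\<lambda>n. E1.occ 0 (s n \<omega>) \<omega>) \<longlonglongrightarrow> E1.occ 0 (\<sigma> \<omega>) \<omega>"
      proof (rule AE_mp, intro AE_I2 impI)
        fix \<omega> assume [measurable]: "\<omega> \<in> space M" and f: "E1.occ 0 (real (Suc K)) \<omega> \<noteq> \<infinity>"
        show "(\<lambda>n. E1.occ 0 (s n \<omega>) \<omega>) \<longlonglongrightarrow> E1.occ 0 (\<sigma> \<omega>) \<omega>"
          unfolding E1.occ_def
        proof (rule nn_integral_dominated_convergence[where w="\<lambda>t. ennreal (exp (- y t \<omega>)) * indicator {0<..real (Suc K)} t"])
          show "AE t in lborel. ennreal (exp (- y t \<omega>)) * indicator {0<..s n \<omega>} t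
              \<le> ennreal (exp (- y t \<omega>)) * indicator {0<..real (Suc K)} t" for n
            using s_K[OF \<open>\<omega> \<in> space M\<close>, of n] by (intro AE_I2 mult_left_mono) (auto simp: indicator_def)
          show "AE t in lborel. (\<lambda>n. ennreal (exp (- y t \<omega>)) * indicator {0<..s n \<omega>} t)
              \<longlonglongrightarrow> ennreal (exp (- y t \<omega>)) * indicator {0<..\<sigma> \<omega>} t"
          proof (rule AE_I2, rule tendsto_eventually)
            fix t
            show "\<forall>\<^sub>F n in sequentially. ennreal (exp (- y t \<omega>)) * indicator {0<..s n \<omega>} t
                = ennreal (exp (- y t \<omega>)) * indicator {0<..\<sigma> \<omega>} t"
            proof (cases "t \<le> \<sigma> \<omega>")
              case True
              then have "t \<le> s n \<omega>" for n using s_ge[of \<omega> n] by linarith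
              then show ?thesis using True by (auto simp: indicator_def)
            next
              case False
              then have "\<forall>\<^sub>F n in sequentially. s n \<omega> < t"
                using s_lim[of \<omega>] by (intro order_tendstoD(2)) auto
              then show ?thesis by eventually_elim (use False in \<open>auto simp: indicator_def\<close>)
            qed
          qed
        qed (use f in \<open>auto simp: E1.occ_def top.not_eq_extremum\<close>)
      qed
    qed (use fin1 occ1 in auto)
    then show ?thesis unfolding grid1
      using * by (intro tendsto_intros tendsto_enn2real) auto
  qed
  ultimately have "(\<integral>\<omega>. exp (- y (\<sigma> \<omega>) \<omega>) \<partial>M) = 1 - \<psi> * enn2real (\<integral>\<^sup>+\<omega>. E1.occ 0 (\<sigma> \<omega>) \<omega> \<partial>M)"
    by (rule LIMSEQ_unique)
  then show "(\<integral>\<omega>. exp (- y (\<sigma> \<omega>) \<omega>) \<partial>M) = 1 - \<psi> *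
      enn2real (\<integral>\<^sup>+\<omega>. \<integral>\<^sup>+t. ennreal (exp (- y t \<omega>)) * indicator {0<..\<sigma> \<omega>} t \<partial>lborel \<partial>M)"
    by (simp add: E1.occ_def)
qed

text \<open>Let s be the infimum of the times up to t at which the path is below - x.
  Right-continuity gives f s <= - x; since f >= - x before s and there is no downward jump at s,
  also f s >= - x. So the level is hit exactly, and before t because f t < - x.\<close>

lemma level_crossing:
  fixes f :: "real \<Rightarrow> real"
  assumes f: "cadlag f" "no_negative_jumps f" "f 0 = 0" and x: "0 \<le> x" and t: "0 \<le> t" "f t < - x"
  shows "\<exists>s. 0 \<le> s \<and> s < t \<and> f s = - x"
proof -
  define D where "D = {r. 0 \<le> r \<and> r \<le> t \<and> f r < - x}"
  define s where "s = Inf D"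
  have D: "D \<noteq> {}" "bdd_below D" using t by (auto simp: D_def intro!: bdd_belowI[of _ 0])
  have s: "0 \<le> s" "s \<le> t" unfolding s_def
    using D t by (auto simp: D_def intro!: cInf_greatest cInf_lower)
  have before: "- x \<le> f r" if "0 \<le> r" "r < s" for r
    using that s D cInf_lower[of r D] by (force simp: D_def s_def)
  have "f s \<le> - x"
  proof (cases "s \<in> D")
    case False
    have lim: "(f \<longlongrightarrow> f s) (at_right s)" using f s by (auto simp: cadlag_def)
    show ?thesis
    proof (rule ccontr)
      assume "\<not> f s \<le> - x"
      then have "\<forall>\<^sub>F r in at_right s. - x < f r" using lim by (intro order_tendstoD(1)) auto
      then obtain b where b: "s < b" "\<And>r. s < r \<Longrightarrow> r < b \<Longrightarrow> - x < f r"
        by (auto simp: eventually_at_right_field)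
      obtain r where "r \<in> D" "r < b" using b D cInf_lessD[of D b] by (auto simp: s_def)
      moreover have "s \<le> r" using \<open>r \<in> D\<close> D by (auto simp: s_def intro!: cInf_lower)
      ultimately show False using b(2)[of r] False by (cases "r = s") (auto simp: D_def)
    qed
  qed (auto simp: D_def)
  moreover have "- x \<le> f s"
  proof (cases "s = 0")
    case False
    then obtain l where l: "(f \<longlongrightarrow> l) (at_left s)" using f(1) s unfolding cadlag_def by (metis order_le_less)
    have "\<forall>\<^sub>F r in at_left s. - x \<le> f r"
      using False s by (auto simp: eventually_at_left_field intro!: exI[of _ 0] before)
    then have "- x \<le> l" using l by (intro tendsto_lowerbound[OF l]) auto
    also have "l \<le> f s" using f l s False by (auto simp: no_negative_jumps_def)
    finally show ?thesis .
  qed (use f x in auto)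
  ultimately have "f s = - x" by simp
  moreover have "s \<noteq> t" using \<open>f s = - x\<close> t by auto
  ultimately show ?thesis using s by (intro exI[of _ s]) auto
qed

text \<open>The hitting time itself is included: a path below - x at time t has hit - x strictly
  earlier. This is the bound that keeps the exponentials bounded during a visit.\<close>

lemma above_before_hitting_time:
  assumes f: "cadlag (\<lambda>t. A t \<omega>)" "no_negative_jumps (\<lambda>t. A t \<omega>)" "A 0 \<omega> = 0"
    and x: "0 \<le> x" and t: "0 \<le> t" "ennreal t \<le> hitting_time A x \<omega>"
  shows "- x \<le> A t \<omega>"
proof (rule ccontr)
  assume "\<not> - x \<le> A t \<omega>"
  then obtain s where s: "0 \<le> s" "s < t" "A s \<omega> = - x"
    using level_crossing[OF f x t(1)] by auto
  then have "hitting_time A x \<omega> \<le> ennreal s"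
    unfolding hitting_time_def by (intro Inf_lower) auto
  also have "\<dots> < ennreal t" using s t by (simp add: ennreal_lessI)
  finally show False using t by simp
qed

text \<open>The Bochner integral of a nonintegrable function is 0, so a nonzero transform certifies
  integrability. Any formula giving the transform as an exponential therefore supplies integrability
  as well.\<close>

lemma lst_pos_integrable:
  assumes "lst M X u \<noteq> 0"
  shows "integrable M (\<lambda>\<omega>. exp (- inner u (X \<omega>)))"
  using assms not_integrable_integral_eq unfolding lst_def by blast

text \<open>On an event A of \<open>F s\<close>, exp(- u X_t) splits into exp(- u X_s) restricted to
  A, which is known at time s, and the exponential of the increment, which is independent of
  \<open>F s\<close> and has the law of X_(t-s) in the exponent. Setting the process to 0 outside
  \<open>\<Omega>\<close> changes it on a null set only.\<close>

lemma exp_levyI: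
  fixes X :: "real \<Rightarrow> 'a \<Rightarrow> real ^ 'n::finite"
  assumes X: "levy_process_wrt M F X" and F: "augmented_right_continuous_filtration M F"
    and \<Omega>: "\<Omega> \<in> sets M" "AE \<omega> in M. \<omega> \<in> \<Omega>"
    and zero: "\<And>\<omega>. \<omega> \<in> \<Omega> \<Longrightarrow> X 0 \<omega> = 0"
    and rc: "\<And>t \<omega>. 0 \<le> t \<Longrightarrow> \<omega> \<in> \<Omega> \<Longrightarrow> ((\<lambda>s. X s \<omega>) \<longlongrightarrow> X t \<omega>) (at_right t)"
    and \<psi>: "\<And>t. 0 \<le> t \<Longrightarrow> lst M (X t) u = exp (- (t * \<psi>))"
  shows "exp_levy M (\<lambda>t. F (ennreal t)) (\<lambda>t \<omega>. if 0 \<le> t \<and> \<omega> \<in> \<Omega> then inner u (X t \<omega>) else 0) \<psi>"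
proof -
  have L: "levy_process M X" using X by (simp add: levy_process_wrt_def)
  then interpret prob_space M by (simp add: levy_process_def)
  have Xm: "X t \<in> borel_measurable M" if "0 \<le> t" for t using L that by (simp add: levy_process_def)
  have sub: "subalgebra M (F t)" for t using F by (simp add: augmented_right_continuous_filtration_def)
  define y where "y = (\<lambda>t \<omega>. if 0 \<le> t \<and> \<omega> \<in> \<Omega> then inner u (X t \<omega>) else 0)"
  have "exp_levy M (\<lambda>t. F (ennreal t)) y \<psi>"
  proof
    show "subalgebra M (F (ennreal t))" for t by (rule sub)
    show "(\<lambda>(t, \<omega>). y t \<omega>) \<in> borel_measurable (borel \<Otimes>\<^sub>M M)"
      unfolding y_def
      by (rule joint_measurable_right_continuous[OF \<Omega>(1)])
         (use Xm rc in \<open>auto intro!: tendsto_intros\<close>)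
    show "y 0 \<omega> = 0" for \<omega> by (simp add: y_def zero)
    show "((\<lambda>s. y s \<omega>) \<longlongrightarrow> y t \<omega>) (at_right t)" if t: "0 \<le> t" for t \<omega>
    proof (cases "\<omega> \<in> \<Omega>")
      case True
      then have "((\<lambda>s. inner u (X s \<omega>)) \<longlongrightarrow> inner u (X t \<omega>)) (at_right t)"
        using rc t by (intro tendsto_intros) auto
      moreover have "\<forall>\<^sub>F s in at_right t. y s \<omega> = inner u (X s \<omega>)"
        using t True by (auto simp: y_def eventually_at_filter)
      ultimately show ?thesis using True t by (simp add: y_def tendsto_cong)
    qed (simp add: y_def)
    fix s t A assume st: "0 \<le> s" "s \<le> t" and A: "A \<in> sets (F (ennreal s))"
    have AM [measurable]: "A \<in> sets M" using A sub by (auto simp: subalgebra_def)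
    have [measurable]: "X s \<in> borel_measurable M" "X t \<in> borel_measurable M" using Xm st by auto
    define Y where "Y \<omega> = exp (- inner u (X s \<omega>)) * indicator A \<omega>" for \<omega>
    define Z where "Z \<omega> = exp (- inner u (X t \<omega> - X s \<omega>))" for \<omega>
    have [measurable]: "Y \<in> borel_measurable M" "Z \<in> borel_measurable M" unfolding Y_def Z_def by measurable
    have spF: "space (F (ennreal s)) = space M" using sub by (simp add: subalgebra_def)
    have YF: "Y \<in> borel_measurable (F (ennreal s))"
    proof -
      have [measurable]: "X s \<in> borel_measurable (F (ennreal s))" "A \<in> sets (F (ennreal s))"
        using X st A by (auto simp: levy_process_wrt_def)
      show ?thesis unfolding Y_def by measurable
    qed
    define \<Delta> where "\<Delta> \<omega> = X t \<omega> - X s \<omega>" for \<omega>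
    have \<Delta> [measurable]: "\<Delta> \<in> borel_measurable M" unfolding \<Delta>_def by measurable
    \<comment> \<open>Independence is assumed between \<open>F s\<close> and the events generated by
      the increment. The sigma-algebras generated by \<open>Y\<close> and \<open>Z\<close> are
      contained in these two families.\<close>
    have ind: "indep_var borel Y borel Z"
      unfolding indep_var_eq
    proof (intro conjI)
      have "indep_set (sets (F (ennreal s))) {\<Delta> -` B \<inter> space M | B. B \<in> sets borel}"
        using X st unfolding levy_process_wrt_def \<Delta>_def by auto
      then have "indep_sets (case_bool (sets (F (ennreal s))) {\<Delta> -` B \<inter> space M | B. B \<in> sets borel}) UNIV"
        by (simp add: indep_set_def)
      then show "indep_set (sigma_sets (space M) {Y -` A \<inter> space M |A. A \<in> sets borel})
          (sigma_sets (space M) {Z -` A \<inter> space M |A. A \<in> sets borel})"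
        unfolding indep_set_def
      proof (rule indep_sets_mono_sets)
        fix b :: bool
        show "(case b of True \<Rightarrow> sigma_sets (space M) {Y -` A \<inter> space M |A. A \<in> sets borel}
            | False \<Rightarrow> sigma_sets (space M) {Z -` A \<inter> space M |A. A \<in> sets borel})
          \<subseteq> (case b of True \<Rightarrow> sets (F (ennreal s)) | False \<Rightarrow> {\<Delta> -` B \<inter> space M | B. B \<in> sets borel})"
        proof (cases b)
          case True
          have "sigma_sets (space (F (ennreal s))) {Y -` A \<inter> space M |A. A \<in> sets borel} \<subseteq> sets (F (ennreal s))"
            using YF by (intro sets.sigma_sets_subset) (auto simp: measurable_def spF)
          then show ?thesis using True by (simp add: spF)
        next
          case False
          have eq: "sigma_sets (space M) {\<Delta> -` B \<inter> space M | B. B \<in> sets borel} = {\<Delta> -` B \<inter> space M | B. B \<in> sets borel}"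
            using sets_vimage_algebra[of "space M" \<Delta> borel] sets_vimage_algebra2[of \<Delta> "space M" borel] by simp
          have subset: "{Z -` A \<inter> space M |A. A \<in> sets borel} \<subseteq> {\<Delta> -` B \<inter> space M | B. B \<in> sets borel}"
          proof safe
            fix B :: "real set" assume B: "B \<in> sets borel"
            have "Z -` B \<inter> space M = \<Delta> -` ((\<lambda>v. exp (- inner u v)) -` B) \<inter> space M"
              by (auto simp: Z_def \<Delta>_def)
            moreover have "(\<lambda>v. exp (- inner u v)) -` B \<in> sets borel"
              using measurable_sets_borel[OF _ B, of "\<lambda>v. exp (- inner u v)"] by simp
            ultimately show "\<exists>B'. Z -` B \<inter> space M = \<Delta> -` B' \<inter> space M \<and> B' \<in> sets borel" by blast
          qed
          have "sigma_sets (space M) {Z -` A \<inter> space M |A. A \<in> sets borel} \<subseteq> {\<Delta> -` B \<inter> space M | B. B \<in> sets borel}"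
            by (rule order_trans[OF sigma_sets_mono'[OF subset] equalityD1[OF eq]])
          then show ?thesis using False by simp
        qed
      qed
    qed auto
    have int_s: "integrable M (\<lambda>\<omega>. exp (- inner u (X s \<omega>)))"
      using \<psi>[of s] st by (intro lst_pos_integrable) auto
    then have Yi: "integrable M Y"
      unfolding Y_def by (intro integrable_real_mult_indicator) auto
    have dist: "distr M borel \<Delta> = distr M borel (X (t - s))"
    proof -
      have "\<forall>s\<ge>0. \<forall>t\<ge>0. distr M borel (\<lambda>\<omega>. X (s + t) \<omega> - X s \<omega>) = distr M borel (X t)"
        using L unfolding levy_process_def by (elim conjE)
      from this[rule_format, of s "t - s"] st
      have "distr M borel (\<lambda>\<omega>. X (s + (t - s)) \<omega> - X s \<omega>) = distr M borel (X (t - s))" by simp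
      then show ?thesis by (simp add: \<Delta>_def[abs_def])
    qed
    have hb: "has_bochner_integral M Z (exp (- ((t - s) * \<psi>)))"
    proof -
      have [measurable]: "X (t - s) \<in> borel_measurable M" using Xm st by simp
      have i: "integrable M (\<lambda>\<omega>. exp (- inner u (X (t - s) \<omega>)))"
        using \<psi>[of "t - s"] st by (intro lst_pos_integrable) auto
      have "integrable (distr M borel (X (t - s))) (\<lambda>v. exp (- inner u v))"
        using i by (subst integrable_distr_eq) auto
      then have "integrable M Z"
        unfolding dist[symmetric] by (subst (asm) integrable_distr_eq) (auto simp: Z_def[abs_def] \<Delta>_def[abs_def])
      moreover have "integral\<^sup>L M Z = (\<integral>v. exp (- inner u v) \<partial>distr M borel \<Delta>)"
        by (subst integral_distr) (auto simp: Z_def[abs_def] \<Delta>_def[abs_def])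
      moreover have "\<dots> = exp (- ((t - s) * \<psi>))"
        unfolding dist using \<psi>[of "t - s"] st by (subst integral_distr) (auto simp: lst_def)
      ultimately show ?thesis by (simp add: has_bochner_integral_iff)
    qed
    have YZ: "has_bochner_integral M (\<lambda>\<omega>. Y \<omega> * Z \<omega>) (integral\<^sup>L M Y * exp (- ((t - s) * \<psi>)))"
      using indep_var_integrable[OF ind Yi] indep_var_lebesgue_integral[OF ind Yi] hb
      by (simp add: has_bochner_integral_iff)
    have YZ_eq: "Y \<omega> * Z \<omega> = exp (- inner u (X t \<omega>)) * indicator A \<omega>" for \<omega>
      by (simp add: Y_def Z_def exp_add[symmetric] inner_diff_right indicator_def)
    have nnY: "(\<integral>\<^sup>+\<omega>. ennreal (Y \<omega>) \<partial>M) = ennreal (integral\<^sup>L M Y)"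
      by (intro nn_integral_eq_integral Yi) (auto simp: Y_def)
    have nnYZ: "(\<integral>\<^sup>+\<omega>. ennreal (Y \<omega> * Z \<omega>) \<partial>M) = ennreal (integral\<^sup>L M Y * exp (- ((t - s) * \<psi>)))"
      using YZ by (subst nn_integral_eq_integral) (auto simp: has_bochner_integral_iff Y_def Z_def)
    have e: "AE \<omega> in M. y r \<omega> = inner u (X r \<omega>)" if "0 \<le> r" for r
      using \<Omega>(2) by eventually_elim (simp add: y_def that)
    have "(\<integral>\<^sup>+\<omega>. ennreal (exp (- y t \<omega>)) * indicator A \<omega> \<partial>M) = (\<integral>\<^sup>+\<omega>. ennreal (Y \<omega> * Z \<omega>) \<partial>M)"
      by (rule nn_integral_cong_AE, use e[OF order_trans[OF st]] in eventually_elim) (simp add: YZ_eq indicator_def)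
    also have "\<dots> = ennreal (exp (- ((t - s) * \<psi>))) * (\<integral>\<^sup>+\<omega>. ennreal (Y \<omega>) \<partial>M)"
      unfolding nnY nnYZ by (simp add: ennreal_mult'' mult.commute)
    also have "(\<integral>\<^sup>+\<omega>. ennreal (Y \<omega>) \<partial>M) = (\<integral>\<^sup>+\<omega>. ennreal (exp (- y s \<omega>)) * indicator A \<omega> \<partial>M)"
      by (rule nn_integral_cong_AE, use e[OF st(1)] in eventually_elim) (simp add: Y_def indicator_def)
    finally show "(\<integral>\<^sup>+\<omega>. ennreal (exp (- y t \<omega>)) * indicator A \<omega> \<partial>M)
      = ennreal (exp (- ((t - s) * \<psi>))) * (\<integral>\<^sup>+\<omega>. ennreal (exp (- y s \<omega>)) * indicator A \<omega> \<partial>M)" .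
  qed
  then show ?thesis by (simp add: y_def)
qed

text \<open>The right derivative of exp(- f) at 0 is - E Y > 0, so f must fall below a negative
  multiple of h. The statement is kept as an inequality along \<open>hseq\<close>, the only form in
  which it is used.\<close>

lemma (in prob_space) exponent_le_drift:
  fixes Y :: "'a \<Rightarrow> real"
  assumes Y: "integrable M Y" "(\<integral>\<omega>. Y \<omega> \<partial>M) < 0"
    and f: "\<And>h. 0 \<le> h \<Longrightarrow> (\<integral>\<omega>. exp (- (h * Y \<omega>)) \<partial>M) = exp (- f h)"
  shows "\<exists>c>0. \<forall>\<^sub>F n in sequentially. f (hseq n) \<le> - c * hseq n"
proof -
  note h = hseq(1,2)
  have [measurable]: "Y \<in> borel_measurable M" using Y by simp
  have int: "integrable M (\<lambda>\<omega>. exp (- (r * Y \<omega>)))" if "0 \<le> r" for r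
    using f[OF that] not_integrable_integral_eq[of M "\<lambda>\<omega>. exp (- (r * Y \<omega>))"] by force
  \<comment> \<open>For 0 < h <= 1 the difference quotient lies between - Y and exp(- Y) - 1, the
    upper bound by convexity of exp. The transform at 1 is nonzero, so exp(- Y) is
    integrable.\<close>
  have lim: "(\<lambda>n. \<integral>\<omega>. (exp (- (hseq n * Y \<omega>)) - 1) / hseq n \<partial>M) \<longlonglongrightarrow> (\<integral>\<omega>. - Y \<omega> \<partial>M)"
  proof (rule integral_dominated_convergence[where w="\<lambda>\<omega>. \<bar>Y \<omega>\<bar> + exp (- (1 * Y \<omega>)) + 1"])
    show "integrable M (\<lambda>\<omega>. \<bar>Y \<omega>\<bar> + exp (- (1 * Y \<omega>)) + 1)" using Y int[of 1] by auto
    show "AE \<omega> in M. (\<lambda>n. (exp (- (hseq n * Y \<omega>)) - 1) / hseq n) \<longlonglongrightarrow> - Y \<omega>"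
    proof (rule AE_I2)
      fix \<omega>
      have "((\<lambda>r. exp (- (r * Y \<omega>))) has_real_derivative - Y \<omega>) (at 0)"
        by (auto intro!: derivative_eq_intros)
      then have "((\<lambda>r. (exp (- (r * Y \<omega>)) - 1) / r) \<longlongrightarrow> - Y \<omega>) (at 0)"
        by (simp add: DERIV_def)
      moreover have "filterlim hseq (at 0) sequentially"
        unfolding filterlim_at using hseq_lim h by (auto intro!: always_eventually simp: less_imp_neq[THEN not_sym])
      ultimately show "(\<lambda>n. (exp (- (hseq n * Y \<omega>)) - 1) / hseq n) \<longlonglongrightarrow> - Y \<omega>"
        by (rule filterlim_compose)
    qed
    show "AE \<omega> in M. norm ((exp (- (hseq n * Y \<omega>)) - 1) / hseq n) \<le> \<bar>Y \<omega>\<bar> + exp (- (1 * Y \<omega>)) + 1" for n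
    proof (rule AE_I2)
      fix \<omega>
      have "- (hseq n * Y \<omega>) \<le> exp (- (hseq n * Y \<omega>)) - 1" using exp_ge_add_one_self[of "- (hseq n * Y \<omega>)"] by linarith
      then have low: "- Y \<omega> \<le> (exp (- (hseq n * Y \<omega>)) - 1) / hseq n"
        using h[of n] by (simp add: pos_le_divide_eq mult.commute)
      have "exp (- (hseq n * Y \<omega>)) \<le> (1 - hseq n) * exp 0 + hseq n * exp (- Y \<omega>)"
        using convex_onD[OF exp_convex, of "hseq n" 0 "- Y \<omega>"] h[of n] by simp
      then have "exp (- (hseq n * Y \<omega>)) - 1 \<le> (exp (- Y \<omega>) - 1) * hseq n" by (simp add: algebra_simps)
      then have "(exp (- (hseq n * Y \<omega>)) - 1) / hseq n \<le> exp (- Y \<omega>) - 1"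
        using h[of n] by (simp add: pos_divide_le_eq)
      then show "norm ((exp (- (hseq n * Y \<omega>)) - 1) / hseq n) \<le> \<bar>Y \<omega>\<bar> + exp (- (1 * Y \<omega>)) + 1"
        using low exp_gt_zero[of "- Y \<omega>"] by (simp only: real_norm_def mult_1)
    qed
  qed (use int in auto)
  \<comment> \<open>Half of the drift is given up to obtain a strict inequality from the limit.
    Another half is lost on taking logarithms, where exp(c h / 2) <= 1 + c h for c h <= 1; this is
    why h < 1 / c is required and \<open>c/2\<close> is the final witness.\<close>
  define c where "c = - (\<integral>\<omega>. Y \<omega> \<partial>M) / 2"
  have c: "0 < c" using Y by (simp add: c_def)
  have "\<forall>\<^sub>F n in sequentially. c < (\<integral>\<omega>. (exp (- (hseq n * Y \<omega>)) - 1) / hseq n \<partial>M)"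
    using lim c by (intro order_tendstoD(1)[OF lim]) (simp add: c_def)
  moreover have "\<forall>\<^sub>F n in sequentially. hseq n < 1 / c"
    using hseq_lim c by (intro order_tendstoD(2)) auto
  ultimately have "\<forall>\<^sub>F n in sequentially. f (hseq n) \<le> - (c / 2) * hseq n"
  proof eventually_elim
    case (elim n)
    have "(\<integral>\<omega>. (exp (- (hseq n * Y \<omega>)) - 1) / hseq n \<partial>M) = (exp (- f (hseq n)) - 1) / hseq n"
      using int[of "hseq n"] f[of "hseq n"] h[of n] by (simp add: prob_space)
    then have e: "1 + c * hseq n < exp (- f (hseq n))"
      using elim(1) h[of n] by (simp add: pos_less_divide_eq)
    have ch: "0 \<le> c * hseq n" "c * hseq n \<le> 1" using elim(2) c h[of n] by (auto simp: field_simps)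
    then have "exp (c * hseq n / 2) \<le> 1 + c * hseq n"
      using exp_bound_lemma[of "c * hseq n / 2"] by simp
    then have "exp (c * hseq n / 2) < exp (- f (hseq n))" using e by linarith
    then show ?case by simp
  qed
  then show ?thesis using c by (intro exI[of _ "c/2"]) auto
qed

section \<open>A single visit\<close>

lemma vec_le_def: "u \<le> v \<longleftrightarrow> (\<forall>k. u $ k \<le> v $ k)" for u v :: "real ^ 'n::finite"
  by (simp add: Finite_Cartesian_Product.less_eq_vec_def)

lemma inner_nonneg_vec: "0 \<le> u \<Longrightarrow> 0 \<le> v \<Longrightarrow> 0 \<le> inner u (v :: real ^ 'n::finite)"
  unfolding inner_vec_def by (intro sum_nonneg) (auto simp: vec_le_def)

lemma inner_vec_upd: "inner u (vec_upd v j a) = inner (vec_upd u j 0) v + (u $ j) * a"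
  for u v :: "real ^ 'n::finite"
proof -
  have "inner u (vec_upd v j a) = (\<Sum>k\<in>UNIV. u $ k * (if k = j then a else v $ k))"
    by (simp add: inner_vec_def vec_upd_def)
  also have "\<dots> = (\<Sum>k\<in>UNIV. (if k = j then 0 else u $ k) * v $ k + (if k = j then u $ j * a else 0))"
    by (intro sum.cong) auto
  finally show ?thesis by (simp add: sum.distrib inner_vec_def vec_upd_def)
qed

lemma vec_upd_nonneg: "0 \<le> u \<Longrightarrow> 0 \<le> a \<Longrightarrow> 0 \<le> vec_upd u j a"
  by (auto simp: vec_le_def vec_upd_def)

lemma axis_nonneg: "0 \<le> a \<Longrightarrow> 0 \<le> a *\<^sub>R axis j (1::real)"
  by (auto simp: vec_le_def axis_def)

lemma tendsto_vec_upd: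
  fixes j :: "'n::finite"
  assumes "(f \<longlongrightarrow> v) F" "(g \<longlongrightarrow> a) F"
  shows "((\<lambda>t. vec_upd (f t) j (g t)) \<longlongrightarrow> vec_upd v j a) F"
  by (rule vec_tendstoI) (use assms in \<open>auto simp: vec_upd_def intro!: tendsto_intros\<close>)

text \<open>Only the assumptions that concern the template space, so that the analysis of a single
  visit is independent of how copies are arranged into cycles.\<close>

locale polling_template = polling q W A S \<tau>
  for q :: "nat \<Rightarrow> 'n::finite"
    and W :: "real \<Rightarrow> 'a \<Rightarrow> real ^ 'n"
    and A :: "nat \<Rightarrow> real \<Rightarrow> 'a \<Rightarrow> real"
    and S :: "nat \<Rightarrow> 'a \<Rightarrow> real"
    and \<tau> :: "nat \<Rightarrow> real \<Rightarrow> 'a \<Rightarrow> ennreal" +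
  fixes M :: "'a measure" and \<phi> :: "real ^ 'n \<Rightarrow> real" and \<phi>A :: "nat \<Rightarrow> real ^ 'n \<Rightarrow> real"
    and \<F> :: "nat \<Rightarrow> ennreal \<Rightarrow> 'a measure" and \<eta> :: "nat \<Rightarrow> real ^ 'n \<Rightarrow> real"
    and N :: nat
  assumes N: "N = CARD('n)" and q: "bij_betw q {1..N} UNIV"
    and prob_M: "prob_space M"
    and W: "levy_subordinator M W" "AE \<omega> in M. cadlag (\<lambda>t. W t \<omega>)"
    and \<phi>: "laplace_exponent M W \<phi>"
    and S: "\<forall>i\<in>{1..N}. S i \<in> borel_measurable M \<and> (AE \<omega> in M. 0 < S i \<omega>)"
    and A: "\<forall>i\<in>{1..N}. spectrally_positive_levy M (A i) \<and> (\<integral>\<omega>. A i 1 \<omega> \<partial>M) < 0"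
    and \<phi>A: "\<forall>i\<in>{1..N}. laplace_exponent M (polling.net_input q W A i) (\<phi>A i)"
    and \<F>: "\<forall>i\<in>{1..N}. augmented_right_continuous_filtration M (\<F> i) \<and>
           levy_process_wrt M (\<F> i) (polling.net_input q W A i)"
    and \<tau>_measurable: "\<forall>i\<in>{1..N}. (\<lambda>(x, \<omega>). \<tau> i x \<omega>)
           \<in> borel_measurable (restrict_space borel {0..} \<Otimes>\<^sub>M M)"
    and stopping: "\<forall>i\<in>{1..N}. \<forall>x\<ge>0. stopping_time (\<F> i) (\<tau> i x)"
    and hitting: "\<forall>i\<in>{1..N}. \<forall>x\<ge>0. AE \<omega> in M. \<tau> i x \<omega> \<le> hitting_time (A i) x \<omega>"
    and branching: "\<forall>i\<in>{1..N}. levy_subordinator M (polling.replacement q W A \<tau> i) \<and>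
           laplace_exponent M (polling.replacement q W A \<tau> i) (\<eta> i)"
    and ES: "\<forall>i\<in>{1..N}. integrable M (S i)"
begin

sublocale prob_space M by (rule prob_M)

definition regular :: "'a \<Rightarrow> bool" where
  "regular \<omega> \<longleftrightarrow> W 0 \<omega> = 0 \<and> cadlag (\<lambda>t. W t \<omega>) \<and> (\<forall>s t. 0 \<le> s \<longrightarrow> s \<le> t \<longrightarrow> W s \<omega> \<le> W t \<omega>) \<and>
    (\<forall>i\<in>{1..N}. 0 < S i \<omega> \<and> A i 0 \<omega> = 0 \<and> cadlag (\<lambda>t. A i t \<omega>) \<and> no_negative_jumps (\<lambda>t. A i t \<omega>) \<and>
      replacement i 0 \<omega> = 0 \<and>
      (\<forall>s t. 0 \<le> s \<longrightarrow> s \<le> t \<longrightarrow> replacement i s \<omega> \<le> replacement i t \<omega>))"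

text \<open>The event \<open>regular\<close> involves uncountably many times and need not be
  measurable; \<open>\<Omega>\<close> is some measurable event of full measure inside it.\<close>

definition \<Omega> :: "'a set" where
  "\<Omega> = (SOME \<Omega>. \<Omega> \<in> sets M \<and> (AE \<omega> in M. \<omega> \<in> \<Omega>) \<and> (\<forall>\<omega>\<in>\<Omega>. regular \<omega>))"

lemma AE_regular: "AE \<omega> in M. regular \<omega>"
proof -
  have "AE \<omega> in M. \<forall>i\<in>{1..N}. 0 < S i \<omega> \<and> A i 0 \<omega> = 0 \<and> cadlag (\<lambda>t. A i t \<omega>) \<and>
      no_negative_jumps (\<lambda>t. A i t \<omega>) \<and> replacement i 0 \<omega> = 0 \<and>
      (\<forall>s t. 0 \<le> s \<longrightarrow> s \<le> t \<longrightarrow> replacement i s \<omega> \<le> replacement i t \<omega>)"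
    using S A branching
    by (intro AE_finite_allI)
       (auto simp: spectrally_positive_levy_def levy_process_def levy_subordinator_def)
  moreover have "AE \<omega> in M. W 0 \<omega> = 0" "AE \<omega> in M. \<forall>s t. 0 \<le> s \<longrightarrow> s \<le> t \<longrightarrow> W s \<omega> \<le> W t \<omega>"
    using W by (auto simp: levy_subordinator_def levy_process_def)
  ultimately show ?thesis using W(2) unfolding regular_def by eventually_elim blast
qed

lemma \<Omega>: "\<Omega> \<in> sets M" "AE \<omega> in M. \<omega> \<in> \<Omega>" "\<And>\<omega>. \<omega> \<in> \<Omega> \<Longrightarrow> regular \<omega>"
proof -
  obtain Z where Z: "{\<omega> \<in> space M. \<not> regular \<omega>} \<subseteq> Z" "emeasure M Z = 0" "Z \<in> sets M"
    using AE_E[OF AE_regular] by blast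
  have "AE \<omega> in M. \<omega> \<notin> Z" using Z by (intro AE_not_in) auto
  then have "AE \<omega> in M. \<omega> \<in> space M - Z" using AE_space by eventually_elim auto
  then have "\<exists>\<Omega>. \<Omega> \<in> sets M \<and> (AE \<omega> in M. \<omega> \<in> \<Omega>) \<and> (\<forall>\<omega>\<in>\<Omega>. regular \<omega>)"
    using Z by (intro exI[of _ "space M - Z"]) auto
  from someI_ex[OF this] show "\<Omega> \<in> sets M" "AE \<omega> in M. \<omega> \<in> \<Omega>" "\<And>\<omega>. \<omega> \<in> \<Omega> \<Longrightarrow> regular \<omega>"
    unfolding \<Omega>_def by auto
qed

declare \<Omega>(1) [measurable]

text \<open>Modifications that vanish off a regular event of full measure and at negative arguments; this
  makes them jointly measurable, and all workloads nonnegative, without exception.\<close>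

definition W' :: "real \<Rightarrow> 'a \<Rightarrow> real ^ 'n" where
  "W' t \<omega> = (if 0 \<le> t \<and> \<omega> \<in> \<Omega> then W t \<omega> else 0)"
definition A' :: "nat \<Rightarrow> real \<Rightarrow> 'a \<Rightarrow> real" where
  "A' i t \<omega> = (if 0 \<le> t \<and> \<omega> \<in> \<Omega> then A i t \<omega> else 0)"
definition S' :: "nat \<Rightarrow> 'a \<Rightarrow> real" where
  "S' i \<omega> = (if \<omega> \<in> \<Omega> then S i \<omega> else 0)"
definition \<tau>' :: "nat \<Rightarrow> real \<Rightarrow> 'a \<Rightarrow> ennreal" where
  "\<tau>' i x \<omega> = (if 0 \<le> x \<and> \<omega> \<in> \<Omega> then \<tau> i x \<omega> else 0)"
definition X :: "nat \<Rightarrow> real \<Rightarrow> 'a \<Rightarrow> real ^ 'n" where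
  "X i = polling.net_input q W' A' i"
definition R :: "nat \<Rightarrow> real \<Rightarrow> 'a \<Rightarrow> real ^ 'n" where
  "R i = polling.replacement q W' A' \<tau>' i"
definition T :: "nat \<Rightarrow> real \<Rightarrow> 'a \<Rightarrow> real" where
  "T i x \<omega> = enn2real (\<tau>' i x \<omega>)"

section \<open>Nonnegativity and joint measurability of the modified processes\<close>

lemma X_eq: "X i t \<omega> = (if 0 \<le> t \<and> \<omega> \<in> \<Omega> then net_input i t \<omega> else 0)"
  by (auto simp: X_def polling.net_input_def W'_def A'_def vec_upd_def Finite_Cartesian_Product.vec_eq_iff)

lemma R_eq: "R i x \<omega> = x *\<^sub>R axis (q i) 1 + X i (T i x \<omega>) \<omega>"
  by (simp add: R_def polling.replacement_def X_def T_def)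

lemma R_eq_replacement: "0 \<le> x \<Longrightarrow> \<omega> \<in> \<Omega> \<Longrightarrow> R i x \<omega> = replacement i x \<omega>"
  by (simp add: R_eq X_eq replacement_def T_def \<tau>'_def)

lemma T_nonneg: "0 \<le> T i x \<omega>" by (simp add: T_def)

lemma S'_nonneg: "i \<in> {1..N} \<Longrightarrow> 0 \<le> S' i \<omega>"
  using \<Omega>(3) by (auto simp: S'_def regular_def less_imp_le)

lemma W'_nonneg: "0 \<le> W' t \<omega>"
  using \<Omega>(3)[of \<omega>] by (force simp: W'_def regular_def)

lemma R_nonneg: "i \<in> {1..N} \<Longrightarrow> 0 \<le> x \<Longrightarrow> 0 \<le> R i x \<omega>"
proof (cases "\<omega> \<in> \<Omega>")
  case True
  assume i: "i \<in> {1..N}" and x: "0 \<le> x"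
  then have "replacement i 0 \<omega> \<le> replacement i x \<omega>" "replacement i 0 \<omega> = 0"
    using \<Omega>(3)[OF True] unfolding regular_def by (metis order_refl)+
  then show ?thesis using True x by (simp add: R_eq_replacement)
next
  case False
  assume "0 \<le> x"
  then show ?thesis using False by (simp add: R_eq X_eq axis_nonneg)
qed

lemma net_input_right_continuous:
  assumes "i \<in> {1..N}" "0 \<le> t" "\<omega> \<in> \<Omega>"
  shows "((\<lambda>s. net_input i s \<omega>) \<longlongrightarrow> net_input i t \<omega>) (at_right t)"
  unfolding net_input_def using assms \<Omega>(3)[OF assms(3)]
  by (intro tendsto_vec_upd) (auto simp: regular_def cadlag_def)

lemma joint_W' [measurable]: "(\<lambda>(t, \<omega>). W' t \<omega>) \<in> borel_measurable (borel \<Otimes>\<^sub>M M)"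
  unfolding W'_def
  by (rule joint_measurable_right_continuous[OF \<Omega>(1)])
     (use W \<Omega>(3) in \<open>auto simp: levy_subordinator_def levy_process_def regular_def cadlag_def\<close>)

lemma joint_X: "i \<in> {1..N} \<Longrightarrow> (\<lambda>(t, \<omega>). X i t \<omega>) \<in> borel_measurable (borel \<Otimes>\<^sub>M M)"
  unfolding X_eq
  by (rule joint_measurable_right_continuous[OF \<Omega>(1)])
     (use \<F> net_input_right_continuous in \<open>auto simp: levy_process_wrt_def levy_process_def\<close>)

lemma joint_\<tau>': "i \<in> {1..N} \<Longrightarrow> (\<lambda>(x, \<omega>). \<tau>' i x \<omega>) \<in> borel_measurable (borel \<Otimes>\<^sub>M M)"
proof -
  assume i: "i \<in> {1..N}"
  \<comment> \<open>Measurability of \<open>\<tau>\<close> is given for nonnegative workloads only;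
    clipping at 0 extends it, and the value for negative workloads is overridden by 0 in
    \<open>\<tau>'\<close>.\<close>
  have "(\<lambda>p::real \<times> 'a. (max 0 (fst p), snd p)) \<in> (borel \<Otimes>\<^sub>M M) \<rightarrow>\<^sub>M (restrict_space borel {0..} \<Otimes>\<^sub>M M)"
    by (intro measurable_Pair measurable_restrict_space2) auto
  from measurable_compose[OF this \<tau>_measurable[rule_format, OF i]]
  have [measurable]: "(\<lambda>p. \<tau> i (max 0 (fst p)) (snd p)) \<in> borel_measurable (borel \<Otimes>\<^sub>M M)" by simp
  have "(\<lambda>p. if 0 \<le> fst p \<and> snd p \<in> \<Omega> then \<tau> i (max 0 (fst p)) (snd p) else 0) \<in> borel_measurable (borel \<Otimes>\<^sub>M M)"
    by measurable
  also have "(\<lambda>p. if 0 \<le> fst p \<and> snd p \<in> \<Omega> then \<tau> i (max 0 (fst p)) (snd p) else 0) = (\<lambda>(x, \<omega>). \<tau>' i x \<omega>)"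
    by (auto simp: \<tau>'_def fun_eq_iff max_def)
  finally show ?thesis .
qed

lemma measurable_S' [measurable]: "i \<in> {1..N} \<Longrightarrow> S' i \<in> borel_measurable M"
proof -
  assume "i \<in> {1..N}"
  then have [measurable]: "S i \<in> borel_measurable M" using S by auto
  show ?thesis unfolding S'_def by measurable
qed

lemma joint_T: "i \<in> {1..N} \<Longrightarrow> (\<lambda>(x, \<omega>). T i x \<omega>) \<in> borel_measurable (borel \<Otimes>\<^sub>M M)"
proof -
  assume "i \<in> {1..N}"
  from joint_\<tau>'[OF this] have [measurable]: "(\<lambda>p. \<tau>' i (fst p) (snd p)) \<in> borel_measurable (borel \<Otimes>\<^sub>M M)"
    by (simp add: case_prod_beta')
  show ?thesis unfolding T_def case_prod_beta' by measurable
qed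

lemma joint_R: "i \<in> {1..N} \<Longrightarrow> (\<lambda>(x, \<omega>). R i x \<omega>) \<in> borel_measurable (borel \<Otimes>\<^sub>M M)"
proof -
  assume i: "i \<in> {1..N}"
  have "(\<lambda>p. (T i (fst p) (snd p), snd p)) \<in> (borel \<Otimes>\<^sub>M M) \<rightarrow>\<^sub>M (borel \<Otimes>\<^sub>M M)"
    using joint_T[OF i] by (intro measurable_Pair) (auto simp: case_prod_beta')
  from measurable_compose[OF this joint_X[OF i]]
  have [measurable]: "(\<lambda>p. X i (T i (fst p) (snd p)) (snd p)) \<in> borel_measurable (borel \<Otimes>\<^sub>M M)" by simp
  show ?thesis unfolding R_eq case_prod_beta' by measurable
qed

lemma measurable_\<tau>' [measurable]: "i \<in> {1..N} \<Longrightarrow> \<tau>' i x \<in> borel_measurable M"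
  using measurable_Pair2[OF joint_\<tau>', of i x] by simp

lemma measurable_T [measurable]: "i \<in> {1..N} \<Longrightarrow> T i x \<in> borel_measurable M"
  unfolding T_def by measurable

lemma exp_levy_X:
  assumes i: "i \<in> {1..N}" and u: "0 \<le> u"
  shows "exp_levy M (\<lambda>t. \<F> i (ennreal t)) (\<lambda>t \<omega>. inner u (X i t \<omega>)) (\<phi>A i u)"
proof -
  have "exp_levy M (\<lambda>t. \<F> i (ennreal t)) (\<lambda>t \<omega>. if 0 \<le> t \<and> \<omega> \<in> \<Omega> then inner u (net_input i t \<omega>) else 0) (\<phi>A i u)"
  proof (rule exp_levyI[where u = u and X = "net_input i" and \<psi> = "\<phi>A i u" and F = "\<F> i", OF _ _ \<Omega>(1,2)])
    show "net_input i 0 \<omega> = 0" if "\<omega> \<in> \<Omega>" for \<omega>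
      using \<Omega>(3)[OF that] i by (auto simp: net_input_def regular_def vec_upd_def Finite_Cartesian_Product.vec_eq_iff)
    show "lst M (net_input i t) u = exp (- (t * \<phi>A i u))" if "0 \<le> t" for t
      using \<phi>A i u that by (auto simp: laplace_exponent_def)
  qed (use \<F> i net_input_right_continuous in auto)
  moreover have "(\<lambda>t \<omega>. if 0 \<le> t \<and> \<omega> \<in> \<Omega> then inner u (net_input i t \<omega>) else 0) = (\<lambda>t \<omega>. inner u (X i t \<omega>))"
    by (auto simp: X_eq fun_eq_iff)
  ultimately show ?thesis by simp
qed

text \<open>Only coordinate \<open>q i\<close> can become negative, and it stays above - x until - x
  is hit; the other coordinates are nondecreasing inputs. The exceptional null set depends on x
  alone, so u and t may be chosen afterwards.\<close>

lemma X_lower_bound: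
  assumes i: "i \<in> {1..N}" and x: "0 \<le> x"
  shows "AE \<omega> in M. \<forall>u t. 0 \<le> u \<longrightarrow> 0 \<le> t \<longrightarrow> ennreal t \<le> \<tau>' i x \<omega> \<longrightarrow> - (u $ q i * x) \<le> inner u (X i t \<omega>)"
  using hitting[rule_format, OF i x] \<Omega>(2)
proof eventually_elim
  case (elim \<omega>)
  show ?case
  proof (intro allI impI)
    fix u :: "real ^ 'n" and t :: real
    assume u: "0 \<le> u" and t: "0 \<le> t" "ennreal t \<le> \<tau>' i x \<omega>"
    have r: "regular \<omega>" using \<Omega>(3) elim by auto
    have "- x \<le> A i t \<omega>"
    proof (rule above_before_hitting_time[where A = "A i" and \<omega> = \<omega> and t = t])
      show "ennreal t \<le> hitting_time (A i) x \<omega>" using t(2) elim x by (simp add: \<tau>'_def)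
    qed (use r i x t in \<open>auto simp: regular_def\<close>)
    then have "u $ q i * (- x) \<le> u $ q i * A i t \<omega>"
      using u by (intro mult_left_mono) (auto simp: vec_le_def)
    moreover have "0 \<le> inner (vec_upd u (q i) 0) (W t \<omega>)"
      using u W'_nonneg[of t \<omega>] t elim by (intro inner_nonneg_vec vec_upd_nonneg) (auto simp: W'_def)
    ultimately show "- (u $ q i * x) \<le> inner u (X i t \<omega>)"
      using elim t by (simp add: X_eq net_input_def inner_vec_upd)
  qed
qed

text \<open>Truncation gives a bounded stopping time while the visit time may still be infinite;
  finiteness is derived later in \<open>visit_time\<close> from bounds that are uniform in
  \<open>K\<close>.\<close>

definition stop :: "nat \<Rightarrow> real \<Rightarrow> nat \<Rightarrow> 'a \<Rightarrow> real" where
  "stop i x K \<omega> = enn2real (min (\<tau>' i x \<omega>) (of_nat K))"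

lemma ennreal_stop: "ennreal (stop i x K \<omega>) = min (\<tau>' i x \<omega>) (of_nat K)"
  unfolding stop_def by (rule ennreal_enn2real) (simp add: min_less_iff_disj ennreal_of_nat_eq_real_of_nat)

lemma stop_bounds: "0 \<le> stop i x K \<omega>" "stop i x K \<omega> \<le> real K"
proof -
  show "0 \<le> stop i x K \<omega>" by (simp add: stop_def)
  have "ennreal (stop i x K \<omega>) \<le> ennreal (real K)"
    unfolding ennreal_stop by (simp add: ennreal_of_nat_eq_real_of_nat)
  then show "stop i x K \<omega> \<le> real K" by simp
qed

definition visit_transform :: "nat \<Rightarrow> real ^ 'n \<Rightarrow> ('a \<Rightarrow> real) \<Rightarrow> ennreal" where
  "visit_transform i u \<sigma> = (\<integral>\<^sup>+\<omega>. \<integral>\<^sup>+t. ennreal (exp (- inner u (X i t \<omega>))) * indicator {0<..\<sigma> \<omega>} t \<partial>lborel \<partial>M)"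

lemma measurable_stop [measurable]: "i \<in> {1..N} \<Longrightarrow> stop i x K \<in> borel_measurable M"
  unfolding stop_def by measurable

lemma measurable_X_at: "i \<in> {1..N} \<Longrightarrow> \<sigma> \<in> borel_measurable M \<Longrightarrow> (\<lambda>\<omega>. X i (\<sigma> \<omega>) \<omega>) \<in> borel_measurable M"
proof -
  assume i: "i \<in> {1..N}" and [measurable]: "\<sigma> \<in> borel_measurable M"
  have "(\<lambda>\<omega>. (\<sigma> \<omega>, \<omega>)) \<in> M \<rightarrow>\<^sub>M (borel \<Otimes>\<^sub>M M)" by measurable
  from measurable_compose[OF this joint_X[OF i]] show ?thesis by simp
qed

lemma integrable_exp_X:
  assumes i: "i \<in> {1..N}" and x: "0 \<le> x" and u: "0 \<le> u" and [measurable]: "\<sigma> \<in> borel_measurable M"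
    and \<sigma>: "AE \<omega> in M. 0 \<le> \<sigma> \<omega> \<and> ennreal (\<sigma> \<omega>) \<le> \<tau>' i x \<omega>"
  shows "AE \<omega> in M. exp (- inner u (X i (\<sigma> \<omega>) \<omega>)) \<le> exp (u $ q i * x)"
    and "integrable M (\<lambda>\<omega>. exp (- inner u (X i (\<sigma> \<omega>) \<omega>)))"
proof -
  have [measurable]: "(\<lambda>\<omega>. X i (\<sigma> \<omega>) \<omega>) \<in> borel_measurable M" using measurable_X_at[OF i] by simp
  show *: "AE \<omega> in M. exp (- inner u (X i (\<sigma> \<omega>) \<omega>)) \<le> exp (u $ q i * x)"
    using X_lower_bound[OF i x] \<sigma> by eventually_elim (use u in force)
  show "integrable M (\<lambda>\<omega>. exp (- inner u (X i (\<sigma> \<omega>) \<omega>)))"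
    by (rule integrable_const_bound[where B="exp (u $ q i * x)"]) (use * in auto)
qed

lemma visit_stopped:
  assumes i: "i \<in> {1..N}" and x: "0 \<le> x" and u: "0 \<le> u"
  shows "visit_transform i u (stop i x K) < \<infinity>"
    and "(\<integral>\<omega>. exp (- inner u (X i (stop i x K \<omega>) \<omega>)) \<partial>M) = 1 - \<phi>A i u * enn2real (visit_transform i u (stop i x K))"
proof -
  have F: "augmented_right_continuous_filtration M (\<F> i)" using \<F> i by auto
  have sub: "subalgebra M (\<F> i t)" for t using F by (simp add: augmented_right_continuous_filtration_def)
  \<comment> \<open>The doubled process is again of the required kind, since 2u is an admissible
    argument of the exponent.\<close>
  have 2: "exp_levy M (\<lambda>t. \<F> i (ennreal t)) (\<lambda>t \<omega>. 2 * inner u (X i t \<omega>)) (\<phi>A i (2 *\<^sub>R u))"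
  proof -
    have "0 \<le> 2 *\<^sub>R u" using u by (auto simp: vec_le_def)
    from exp_levy_X[OF i this] show ?thesis by simp
  qed
  have ev: "{\<omega> \<in> space M. t < stop i x K \<omega>} \<in> sets (\<F> i (ennreal t))" if t: "0 \<le> t" for t
  proof -
    \<comment> \<open>The augmented filtration contains all null sets, hence
      \<open>\<Omega>\<close>; so switching from \<open>\<tau>\<close> to \<open>\<tau>'\<close>
      does not destroy the stopping time property.\<close>
    have "space M - \<Omega> \<in> null_sets M"
      using \<Omega> AE_iff_null[of M "\<lambda>\<omega>. \<omega> \<in> \<Omega>"] sets.sets_into_space[OF \<Omega>(1)]
      by (simp add: set_diff_eq)
    then have "space M - \<Omega> \<in> sets (\<F> i (ennreal t))"
      using F by (auto simp: augmented_right_continuous_filtration_def)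
    then have "space (\<F> i (ennreal t)) - (space M - \<Omega>) \<in> sets (\<F> i (ennreal t))" by blast
    moreover have sp: "space (\<F> i (ennreal t)) = space M" using sub by (simp add: subalgebra_def)
    ultimately have 1: "\<Omega> \<in> sets (\<F> i (ennreal t))"
      using sets.sets_into_space[OF \<Omega>(1)] by (simp add: double_diff)
    have "Measurable.pred (\<F> i (ennreal t)) (\<lambda>\<omega>. ennreal t < \<tau> i x \<omega>)"
      using stopping i x by (intro stopping_timeD2) auto
    then have 2: "{\<omega> \<in> space M. ennreal t < \<tau> i x \<omega>} \<in> sets (\<F> i (ennreal t))"
      by (simp add: pred_def sp)
    have "{\<omega> \<in> space M. t < stop i x K \<omega>} = (if t < real K then \<Omega> \<inter> {\<omega> \<in> space M. ennreal t < \<tau> i x \<omega>} else {})"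
    proof -
      have "t < stop i x K \<omega> \<longleftrightarrow> ennreal t < min (\<tau>' i x \<omega>) (of_nat K)" for \<omega>
        unfolding ennreal_stop[symmetric] using t by (simp add: ennreal_less_iff)
      moreover have "ennreal t < of_nat K \<longleftrightarrow> t < real K"
        using t by (simp add: ennreal_of_nat_eq_real_of_nat ennreal_less_iff)
      ultimately show ?thesis using x sets.sets_into_space[OF \<Omega>(1)] by (auto simp: \<tau>'_def)
    qed
    then show ?thesis using 1 2 by auto
  qed
  have int: "integrable M (\<lambda>\<omega>. exp (- inner u (X i (stop i x K \<omega>) \<omega>)))"
    by (rule integrable_exp_X[OF i x u]) (use i in \<open>auto simp: stop_bounds ennreal_stop\<close>)
  note os = optional_stopping_bounded[OF exp_levy_X[OF i u] 2 measurable_stop[OF i, of x K] _ ev int, of K]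
  show "visit_transform i u (stop i x K) < \<infinity>"
    unfolding visit_transform_def by (rule os) (auto simp: stop_bounds)
  show "(\<integral>\<omega>. exp (- inner u (X i (stop i x K \<omega>) \<omega>)) \<partial>M) = 1 - \<phi>A i u * enn2real (visit_transform i u (stop i x K))"
    unfolding visit_transform_def by (rule os) (auto simp: stop_bounds)
qed

section \<open>Mean visit time and the transform of a visit\<close>

lemma laplace_exponent_1: "laplace_exponent M Y \<psi> \<Longrightarrow> 0 \<le> u \<Longrightarrow> lst M (Y 1) u = exp (- \<psi> u)"
  unfolding laplace_exponent_def by force

lemma exponent_drift:
  assumes i: "i \<in> {1..N}"
  shows "\<exists>c>0. \<forall>\<^sub>F n in sequentially. \<phi>A i (hseq n *\<^sub>R axis (q i) 1) \<le> - c * hseq n"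
proof (rule exponent_le_drift)
  show "(\<integral>\<omega>. A i 1 \<omega> \<partial>M) < 0" using A i by auto
  \<comment> \<open>A strictly negative Bochner integral is nonzero, and so certifies
    integrability.\<close>
  then show "integrable M (A i 1)" using not_integrable_integral_eq by force
  fix h :: real assume h: "0 \<le> h"
  have "lst M (net_input i 1) (h *\<^sub>R axis (q i) 1) = exp (- \<phi>A i (h *\<^sub>R axis (q i) 1))"
    using \<phi>A i h by (intro laplace_exponent_1 axis_nonneg) auto
  then show "(\<integral>\<omega>. exp (- (h * A i 1 \<omega>)) \<partial>M) = exp (- \<phi>A i (h *\<^sub>R axis (q i) 1))"
    by (simp add: lst_def inner_axis' net_input_def vec_upd_def)
qed

lemma joint_X_lborel: "i \<in> {1..N} \<Longrightarrow> (\<lambda>(\<omega>, t). X i t \<omega>) \<in> borel_measurable (M \<Otimes>\<^sub>M lborel)"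
proof -
  assume "i \<in> {1..N}"
  then have "(\<lambda>(t, \<omega>). X i t \<omega>) \<in> borel_measurable (lborel \<Otimes>\<^sub>M M)"
    using joint_X by (simp cong: measurable_cong_sets sets_pair_measure_cong)
  then show ?thesis by (subst measurable_pair_swap_iff) (simp add: case_prod_beta')
qed

lemma visit_transform_pair:
  assumes i: "i \<in> {1..N}" and [measurable]: "\<sigma> \<in> borel_measurable M"
  shows "visit_transform i u \<sigma> = (\<integral>\<^sup>+p. ennreal (exp (- inner u (X i (snd p) (fst p)))) * indicator {0<..\<sigma> (fst p)} (snd p) \<partial>(M \<Otimes>\<^sub>M lborel))"
    and "(\<lambda>p. ennreal (exp (- inner u (X i (snd p) (fst p)))) * indicator {0<..\<sigma> (fst p)} (snd p)) \<in> borel_measurable (M \<Otimes>\<^sub>M lborel)"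
proof -
  have [measurable]: "(\<lambda>p. X i (snd p) (fst p)) \<in> borel_measurable (M \<Otimes>\<^sub>M lborel)"
    using joint_X_lborel[OF i] by (simp add: case_prod_beta')
  note [measurable] = indicator_measurable_lborel[of "\<lambda>_. 0", OF borel_measurable_const assms(2)]
  show *: "(\<lambda>p. ennreal (exp (- inner u (X i (snd p) (fst p)))) * indicator {0<..\<sigma> (fst p)} (snd p)) \<in> borel_measurable (M \<Otimes>\<^sub>M lborel)"
    by measurable
  show "visit_transform i u \<sigma> = (\<integral>\<^sup>+p. ennreal (exp (- inner u (X i (snd p) (fst p)))) * indicator {0<..\<sigma> (fst p)} (snd p) \<partial>(M \<Otimes>\<^sub>M lborel))"
    unfolding visit_transform_def using lborel.nn_integral_fst[OF *] by simp
qed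

text \<open>As h tends to 0 the integrand exp(- h X) tends to 1 pointwise; Fatou's lemma on the
  product of the sample space and the time axis gives the bound without any domination.\<close>

lemma time_le_liminf_transform:
  assumes i: "i \<in> {1..N}" and [measurable]: "\<sigma> \<in> borel_measurable M" and \<sigma>: "\<And>\<omega>. 0 \<le> \<sigma> \<omega>"
  shows "(\<integral>\<^sup>+\<omega>. ennreal (\<sigma> \<omega>) \<partial>M) \<le> liminf (\<lambda>n. visit_transform i (hseq n *\<^sub>R axis (q i) 1) \<sigma>)"
proof -
  let ?f = "\<lambda>n p. ennreal (exp (- inner (hseq n *\<^sub>R axis (q i) 1) (X i (snd p) (fst p)))) * indicator {0<..\<sigma> (fst p)} (snd p)"
  have pw: "(\<lambda>n. ?f n p) \<longlonglongrightarrow> indicator {0<..\<sigma> (fst p)} (snd p)" for p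
  proof -
    have "(\<lambda>n. exp (- (hseq n * X i (snd p) (fst p) $ q i))) \<longlonglongrightarrow> exp (- (0 * X i (snd p) (fst p) $ q i))"
      by (intro tendsto_intros hseq_lim)
    then have "(\<lambda>n. ennreal (exp (- inner (hseq n *\<^sub>R axis (q i) 1) (X i (snd p) (fst p))))) \<longlonglongrightarrow> ennreal 1"
      by (intro tendsto_ennrealI) (simp add: inner_axis')
    then show ?thesis by (auto simp: indicator_def)
  qed
  have "(\<integral>\<^sup>+\<omega>. ennreal (\<sigma> \<omega>) \<partial>M) = (\<integral>\<^sup>+\<omega>. \<integral>\<^sup>+t. indicator {0<..\<sigma> \<omega>} t \<partial>lborel \<partial>M)"
    by (intro nn_integral_cong) (simp add: \<sigma>)
  also have "\<dots> = (\<integral>\<^sup>+p. indicator {0<..\<sigma> (fst p)} (snd p) \<partial>(M \<Otimes>\<^sub>M lborel))"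
    using lborel.nn_integral_fst[OF indicator_measurable_lborel[of "\<lambda>_. 0", OF borel_measurable_const assms(2)]] by simp
  also have "\<dots> = (\<integral>\<^sup>+p. liminf (\<lambda>n. ?f n p) \<partial>(M \<Otimes>\<^sub>M lborel))"
    by (intro nn_integral_cong lim_imp_Liminf[symmetric] pw) auto
  also have "\<dots> \<le> liminf (\<lambda>n. integral\<^sup>N (M \<Otimes>\<^sub>M lborel) (?f n))"
    by (intro nn_integral_liminf visit_transform_pair(2)[OF i assms(2)])
  also have "\<dots> = liminf (\<lambda>n. visit_transform i (hseq n *\<^sub>R axis (q i) 1) \<sigma>)"
    by (subst visit_transform_pair(1)[OF i assms(2)]) simp
  finally show ?thesis .
qed

text \<open>Letting \<open>u = h e\<^sub>i\<close> with \<open>h\<close> small, the transform of the visit is controlled by the drift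
  of \<open>A\<^sub>i\<close>; this bounds the mean visit time.\<close>

lemma mean_visit_time:
  assumes i: "i \<in> {1..N}" and x: "0 \<le> x"
  shows "(\<integral>\<^sup>+\<omega>. \<tau>' i x \<omega> \<partial>M) < \<infinity>"
proof -
  obtain c where c: "0 < c" and drift: "\<forall>\<^sub>F n in sequentially. \<phi>A i (hseq n *\<^sub>R axis (q i) 1) \<le> - c * hseq n"
    using exponent_drift[OF i] by auto
  note h = hseq
  \<comment> \<open>The right-hand side does not depend on \<open>K\<close>: optional stopping and
    the drift give c h v <= exp(h x) - 1 for the truncated transform v.\<close>
  have bound: "(\<integral>\<^sup>+\<omega>. ennreal (stop i x K \<omega>) \<partial>M) \<le> ennreal (x * exp x / c)" for K
  proof -
    have V: "\<forall>\<^sub>F n in sequentially. visit_transform i (hseq n *\<^sub>R axis (q i) 1) (stop i x K) \<le> ennreal (x * exp x / c)"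
      using drift
    proof eventually_elim
      case (elim n)
      define u where "u = hseq n *\<^sub>R axis (q i) (1::real)"
      have u: "0 \<le> u" using h[of n] by (simp add: u_def axis_nonneg)
      have ui: "u $ q i = hseq n" by (simp add: u_def)
      define v where "v = enn2real (visit_transform i u (stop i x K))"
      have v0: "0 \<le> v" by (simp add: v_def)
      have int: "AE \<omega> in M. exp (- inner u (X i (stop i x K \<omega>) \<omega>)) \<le> exp (u $ q i * x)"
        "integrable M (\<lambda>\<omega>. exp (- inner u (X i (stop i x K \<omega>) \<omega>)))"
        by (rule integrable_exp_X[OF i x u]; use i in \<open>auto simp: stop_bounds ennreal_stop\<close>)+
      then have "(\<integral>\<omega>. exp (- inner u (X i (stop i x K \<omega>) \<omega>)) \<partial>M) \<le> (\<integral>\<omega>. exp (u $ q i * x) \<partial>M)"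
        by (intro integral_mono_AE) auto
      then have "1 - \<phi>A i u * v \<le> exp (hseq n * x)"
        using visit_stopped(2)[OF i x u, of K] by (simp add: v_def ui prob_space)
      moreover have "c * hseq n * v \<le> - \<phi>A i u * v" using elim v0 by (intro mult_right_mono) (auto simp: u_def)
      ultimately have "c * hseq n * v \<le> exp (hseq n * x) - 1" by simp
      \<comment> \<open>exp z - 1 <= z exp z puts a factor \<open>hseq n\<close> on this side too,
        so it cancels and the bound on v is independent of n.\<close>
      also have "\<dots> \<le> hseq n * x * exp (hseq n * x)"
        using exp_ge_add_one_self[of "- (hseq n * x)"] mult_right_mono[of "1 - hseq n * x" "exp (- (hseq n * x))" "exp (hseq n * x)"]
        by (simp add: exp_add[symmetric] algebra_simps)
      also have "\<dots> \<le> hseq n * x * exp x"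
        using h[of n] x by (intro mult_left_mono) (auto simp: mult_left_le_one_le)
      finally have "hseq n * (c * v) \<le> hseq n * (x * exp x)" by (simp add: algebra_simps)
      then have "c * v \<le> x * exp x" using h[of n] by simp
      then have "v \<le> x * exp x / c" using c by (simp add: field_simps)
      then have "ennreal v \<le> ennreal (x * exp x / c)" by (rule ennreal_leI)
      then show ?case using visit_stopped(1)[OF i x u, of K] by (simp add: v_def u_def)
    qed
    have "(\<integral>\<^sup>+\<omega>. ennreal (stop i x K \<omega>) \<partial>M) \<le> liminf (\<lambda>n. visit_transform i (hseq n *\<^sub>R axis (q i) 1) (stop i x K))"
      using i by (intro time_le_liminf_transform) (auto simp: stop_bounds)
    also have "\<dots> \<le> liminf (\<lambda>n. ennreal (x * exp x / c))"
      using V by (rule Liminf_mono)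
    also have "\<dots> = ennreal (x * exp x / c)" by (simp add: Liminf_const)
    finally show ?thesis .
  qed
  have "(\<integral>\<^sup>+\<omega>. \<tau>' i x \<omega> \<partial>M) = (\<integral>\<^sup>+\<omega>. liminf (\<lambda>K. ennreal (stop i x K \<omega>)) \<partial>M)"
  proof (intro nn_integral_cong lim_imp_Liminf[symmetric])
    fix \<omega>
    have "(\<lambda>K. min (\<tau>' i x \<omega>) (of_nat K)) \<longlonglongrightarrow> min (\<tau>' i x \<omega>) \<top>"
      by (intro tendsto_min tendsto_const of_nat_tendsto_top_ennreal)
    then show "(\<lambda>K. ennreal (stop i x K \<omega>)) \<longlonglongrightarrow> \<tau>' i x \<omega>" by (simp add: ennreal_stop)
  qed auto
  also have "\<dots> \<le> liminf (\<lambda>K. \<integral>\<^sup>+\<omega>. ennreal (stop i x K \<omega>) \<partial>M)"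
    using i by (intro nn_integral_liminf) measurable
  also have "\<dots> \<le> liminf (\<lambda>K::nat. ennreal (x * exp x / c))"
    using bound by (intro Liminf_mono always_eventually) auto
  also have "\<dots> = ennreal (x * exp x / c)" by (simp add: Liminf_const)
  finally show ?thesis by (simp add: order_le_less_trans)
qed

text \<open>A finite mean makes the visit time almost surely finite, so that passing to a real
  number by \<open>enn2real\<close> loses nothing.\<close>

lemma visit_time:
  assumes i: "i \<in> {1..N}" and x: "0 \<le> x"
  shows "AE \<omega> in M. ennreal (T i x \<omega>) = \<tau>' i x \<omega>" and "integrable M (T i x)"
proof -
  have "AE \<omega> in M. \<tau>' i x \<omega> \<noteq> \<infinity>"
    using mean_visit_time[OF i x] i by (intro nn_integral_noteq_infinite) auto
  then show *: "AE \<omega> in M. ennreal (T i x \<omega>) = \<tau>' i x \<omega>"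
    by eventually_elim (simp add: T_def top.not_eq_extremum)
  have "(\<integral>\<^sup>+\<omega>. ennreal (T i x \<omega>) \<partial>M) = (\<integral>\<^sup>+\<omega>. \<tau>' i x \<omega> \<partial>M)"
    using * by (intro nn_integral_cong_AE)
  then show "integrable M (T i x)"
    using mean_visit_time[OF i x] i by (intro integrableI_nonneg) (auto simp: T_nonneg)
qed

definition V :: "nat \<Rightarrow> real ^ 'n \<Rightarrow> real \<Rightarrow> ennreal" where
  "V i u x = visit_transform i u (T i x)"

lemma visit_transform_le:
  assumes i: "i \<in> {1..N}" and x: "0 \<le> x" and u: "0 \<le> u"
  shows "AE \<omega> in M. (\<integral>\<^sup>+t. ennreal (exp (- inner u (X i t \<omega>))) * indicator {0<..T i x \<omega>} t \<partial>lborel)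
      \<le> ennreal (exp (u $ q i * x)) * ennreal (T i x \<omega>)"
  using X_lower_bound[OF i x] visit_time(1)[OF i x]
proof eventually_elim
  case (elim \<omega>)
  have "(\<integral>\<^sup>+t. ennreal (exp (- inner u (X i t \<omega>))) * indicator {0<..T i x \<omega>} t \<partial>lborel)
    \<le> (\<integral>\<^sup>+t. ennreal (exp (u $ q i * x)) * indicator {0<..T i x \<omega>} t \<partial>lborel)"
  proof (intro nn_integral_mono)
    fix t
    show "ennreal (exp (- inner u (X i t \<omega>))) * indicator {0<..T i x \<omega>} t
      \<le> ennreal (exp (u $ q i * x)) * indicator {0<..T i x \<omega>} t"
    proof (cases "t \<in> {0<..T i x \<omega>}")
      case True
      then have "ennreal t \<le> \<tau>' i x \<omega>" using elim(2) by (metis ennreal_leI greaterThanAtMost_iff)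
      then have "- (u $ q i * x) \<le> inner u (X i t \<omega>)" using elim(1) u True by auto
      then show ?thesis using True by (simp add: ennreal_leI)
    qed simp
  qed
  also have "\<dots> = ennreal (exp (u $ q i * x)) * ennreal (T i x \<omega>)"
    by (subst nn_integral_cmult) (auto simp: T_nonneg)
  finally show ?case .
qed

lemma V_le:
  assumes i: "i \<in> {1..N}" and x: "0 \<le> x" and u: "0 \<le> u"
  shows "V i u x \<le> ennreal (exp (u $ q i * x) * (\<integral>\<omega>. T i x \<omega> \<partial>M))"
proof -
  have "V i u x \<le> (\<integral>\<^sup>+\<omega>. ennreal (exp (u $ q i * x)) * ennreal (T i x \<omega>) \<partial>M)"
    unfolding V_def visit_transform_def by (intro nn_integral_mono_AE visit_transform_le assms)
  also have "\<dots> = ennreal (exp (u $ q i * x)) * ennreal (\<integral>\<omega>. T i x \<omega> \<partial>M)"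
    using i visit_time(2)[OF i x] by (subst nn_integral_cmult) (auto simp: nn_integral_eq_integral T_nonneg)
  finally show ?thesis by (simp add: ennreal_mult')
qed

text \<open>Once the visit time is finite, the truncated time agrees with it for all large K. Both
  sides of \<open>visit_stopped\<close> then converge by dominated convergence, with exp(u_i x) and
  exp(u_i x) times the visit time as dominating functions.\<close>

lemma V_identity:
  assumes i: "i \<in> {1..N}" and x: "0 \<le> x" and u: "0 \<le> u"
  shows "V i u x < \<infinity>"
    and "(\<integral>\<omega>. exp (- inner u (X i (T i x \<omega>) \<omega>)) \<partial>M) = 1 - \<phi>A i u * enn2real (V i u x)"
proof -
  show fin: "V i u x < \<infinity>" using V_le[OF assms] by (simp add: order_le_less_trans)
  have ev: "AE \<omega> in M. \<forall>\<^sub>F K in sequentially. stop i x K \<omega> = T i x \<omega>"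
    using visit_time(1)[OF i x]
  proof eventually_elim
    case (elim \<omega>)
    obtain K0 :: nat where K0: "T i x \<omega> \<le> real K0" using real_arch_simple by blast
    show ?case
    proof (intro eventually_sequentiallyI[of K0])
      fix K assume "K0 \<le> K"
      then have "ennreal (T i x \<omega>) \<le> ennreal (real K)" using K0 by (intro ennreal_leI) auto
      then have "min (\<tau>' i x \<omega>) (of_nat K) = ennreal (T i x \<omega>)"
        using elim by (simp add: ennreal_of_nat_eq_real_of_nat min_def)
      then show "stop i x K \<omega> = T i x \<omega>" by (simp add: stop_def T_nonneg)
    qed
  qed
  have [measurable]: "T i x \<in> borel_measurable M" "stop i x K \<in> borel_measurable M" for K using i by auto
  have "(\<lambda>K. \<integral>\<omega>. exp (- inner u (X i (stop i x K \<omega>) \<omega>)) \<partial>M) \<longlonglongrightarrow> (\<integral>\<omega>. exp (- inner u (X i (T i x \<omega>) \<omega>)) \<partial>M)"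
  proof (rule integral_dominated_convergence[where w="\<lambda>_. exp (u $ q i * x)"])
    have [measurable]: "(\<lambda>\<omega>. X i (T i x \<omega>) \<omega>) \<in> borel_measurable M" "(\<lambda>\<omega>. X i (stop i x K \<omega>) \<omega>) \<in> borel_measurable M" for K
      using measurable_X_at[OF i] by auto
    show "(\<lambda>\<omega>. exp (- inner u (X i (T i x \<omega>) \<omega>))) \<in> borel_measurable M"
      "(\<lambda>\<omega>. exp (- inner u (X i (stop i x K \<omega>) \<omega>))) \<in> borel_measurable M" for K by measurable
    show "AE \<omega> in M. (\<lambda>K. exp (- inner u (X i (stop i x K \<omega>) \<omega>))) \<longlonglongrightarrow> exp (- inner u (X i (T i x \<omega>) \<omega>))"
      using ev by eventually_elim (auto intro!: tendsto_eventually elim!: eventually_mono)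
    show "AE \<omega> in M. norm (exp (- inner u (X i (stop i x K \<omega>) \<omega>))) \<le> exp (u $ q i * x)" for K
      using integrable_exp_X(1)[OF i x u, of "stop i x K"] by (simp add: stop_bounds ennreal_stop)
  qed auto
  moreover have "(\<lambda>K. \<integral>\<omega>. exp (- inner u (X i (stop i x K \<omega>) \<omega>)) \<partial>M) \<longlonglongrightarrow> 1 - \<phi>A i u * enn2real (V i u x)"
  proof -
    have "(\<lambda>K. visit_transform i u (stop i x K)) \<longlonglongrightarrow> V i u x"
      unfolding V_def visit_transform_def
    proof (rule nn_integral_dominated_convergence[where w="\<lambda>\<omega>. ennreal (exp (u $ q i * x)) * ennreal (T i x \<omega>)"])
      show "(\<lambda>\<omega>. \<integral>\<^sup>+t. ennreal (exp (- inner u (X i t \<omega>))) * indicator {0<..stop i x K \<omega>} t \<partial>lborel) \<in> borel_measurable M" for K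
        using lborel.borel_measurable_nn_integral_fst[OF visit_transform_pair(2)[OF i measurable_stop[OF i]]] by simp
      show "(\<lambda>\<omega>. \<integral>\<^sup>+t. ennreal (exp (- inner u (X i t \<omega>))) * indicator {0<..T i x \<omega>} t \<partial>lborel) \<in> borel_measurable M"
        using lborel.borel_measurable_nn_integral_fst[OF visit_transform_pair(2)[OF i measurable_T[OF i]]] by simp
      show "AE \<omega> in M. (\<integral>\<^sup>+t. ennreal (exp (- inner u (X i t \<omega>))) * indicator {0<..stop i x K \<omega>} t \<partial>lborel)
          \<le> ennreal (exp (u $ q i * x)) * ennreal (T i x \<omega>)" for K
        using visit_transform_le[OF assms] visit_time(1)[OF i x]
      proof eventually_elim
        case (elim \<omega>)
        have "ennreal (stop i x K \<omega>) \<le> ennreal (T i x \<omega>)" unfolding ennreal_stop elim(2) by simp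
        then have "stop i x K \<omega> \<le> T i x \<omega>" by (simp add: T_nonneg)
        then have "(\<integral>\<^sup>+t. ennreal (exp (- inner u (X i t \<omega>))) * indicator {0<..stop i x K \<omega>} t \<partial>lborel)
          \<le> (\<integral>\<^sup>+t. ennreal (exp (- inner u (X i t \<omega>))) * indicator {0<..T i x \<omega>} t \<partial>lborel)"
          by (intro nn_integral_mono mult_left_mono) (auto simp: indicator_def)
        then show ?case using elim(1) by (rule order_trans)
      qed
      show "(\<integral>\<^sup>+\<omega>. ennreal (exp (u $ q i * x)) * ennreal (T i x \<omega>) \<partial>M) < \<infinity>"
        using i visit_time(2)[OF i x]
        by (subst nn_integral_cmult) (auto simp: nn_integral_eq_integral T_nonneg ennreal_mult_less_top)
      show "AE \<omega> in M. (\<lambda>K. \<integral>\<^sup>+t. ennreal (exp (- inner u (X i t \<omega>))) * indicator {0<..stop i x K \<omega>} t \<partial>lborel)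
          \<longlonglongrightarrow> (\<integral>\<^sup>+t. ennreal (exp (- inner u (X i t \<omega>))) * indicator {0<..T i x \<omega>} t \<partial>lborel)"
        using ev by eventually_elim (auto intro!: tendsto_eventually elim!: eventually_mono)
    qed auto
    then show ?thesis
      unfolding visit_stopped(2)[OF assms] using fin by (intro tendsto_intros tendsto_enn2real) auto
  qed
  ultimately show "(\<integral>\<omega>. exp (- inner u (X i (T i x \<omega>) \<omega>)) \<partial>M) = 1 - \<phi>A i u * enn2real (V i u x)"
    by (rule LIMSEQ_unique)
qed

lemma transform_R:
  assumes i: "i \<in> {1..N}" and x: "0 \<le> x" and u: "0 \<le> u"
  shows "(\<integral>\<omega>. exp (- inner u (R i x \<omega>)) \<partial>M) = exp (- (x * \<eta> i u))"
proof -
  have [measurable]: "replacement i x \<in> borel_measurable M"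
    using branching i x by (auto simp: levy_subordinator_def levy_process_def)
  have [measurable]: "R i x \<in> borel_measurable M"
    using measurable_Pair2[OF joint_R[OF i], of x] by simp
  have "(\<integral>\<omega>. exp (- inner u (R i x \<omega>)) \<partial>M) = lst M (replacement i x) u"
    unfolding lst_def
  proof (intro integral_cong_AE)
    show "AE \<omega> in M. exp (- inner u (R i x \<omega>)) = exp (- inner u (replacement i x \<omega>))"
      using \<Omega>(2) by eventually_elim (simp add: R_eq_replacement x)
  qed measurable
  then show ?thesis using branching i x u by (auto simp: laplace_exponent_def)
qed

text \<open>The transform of the workload at the end of a visit is known in two ways, from optional
  stopping and from the branching property; comparing them gives the transform integrated over the
  visit. The exponent is kept as a factor, since it may vanish or be negative.\<close>

lemma V_eq:
  assumes i: "i \<in> {1..N}" and x: "0 \<le> x" and u: "0 \<le> u"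
  shows "\<phi>A i u * enn2real (V i u x) = 1 - exp (u $ q i * x - x * \<eta> i u)"
proof -
  have "exp (- inner u (R i x \<omega>)) = exp (- (u $ q i * x)) * exp (- inner u (X i (T i x \<omega>) \<omega>))" for \<omega>
    by (simp add: R_eq inner_add_right inner_axis exp_add[symmetric] mult.commute)
  then have "exp (- (x * \<eta> i u)) = exp (- (u $ q i * x)) * (1 - \<phi>A i u * enn2real (V i u x))"
    using transform_R[OF assms] V_identity(2)[OF assms] by simp
  then have "exp (u $ q i * x) * exp (- (x * \<eta> i u)) = 1 - \<phi>A i u * enn2real (V i u x)"
    by (simp add: mult.assoc[symmetric] exp_add[symmetric])
  then show ?thesis by (simp add: exp_add[symmetric] exp_diff exp_minus divide_inverse)
qed

end

section \<open>Laplace exponents of subordinators\<close>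

abbreviation (input) total :: "real ^ 'n::finite \<Rightarrow> real" where
  "total u \<equiv> (\<Sum>k\<in>UNIV. u $ k)"

lemma lst_bounds:
  fixes X :: "'a \<Rightarrow> real ^ 'n::finite"
  assumes "prob_space P" and [measurable]: "X \<in> borel_measurable P" and X: "AE \<omega> in P. 0 \<le> X \<omega>" and u: "0 \<le> u"
  shows lst_int: "integrable P (\<lambda>\<omega>. exp (- inner u (X \<omega>)))"
    and lst_pos: "0 < lst P X u" and lst_le_1: "lst P X u \<le> 1"
proof -
  interpret prob_space P by fact
  have *: "AE \<omega> in P. exp (- inner u (X \<omega>)) \<le> 1"
    using X by eventually_elim (simp add: inner_nonneg_vec u)
  show i: "integrable P (\<lambda>\<omega>. exp (- inner u (X \<omega>)))"
    by (rule integrable_const_bound[where B=1]) (use * in auto)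
  have "lst P X u \<le> (\<integral>\<omega>. 1 \<partial>P)" unfolding lst_def using i * by (intro integral_mono_AE) auto
  then show "lst P X u \<le> 1" by (simp add: prob_space)
  have "0 \<le> lst P X u" unfolding lst_def by (intro integral_nonneg_AE) auto
  moreover have "lst P X u \<noteq> 0"
  proof
    assume "lst P X u = 0"
    then have "AE \<omega> in P. exp (- inner u (X \<omega>)) = 0"
      unfolding lst_def using integral_nonneg_eq_0_iff_AE[OF i] by auto
    then have "AE \<omega> in P. False" by eventually_elim auto
    then show False by auto
  qed
  ultimately show "0 < lst P X u" by simp
qed

lemma inner_le_total:
  fixes u :: "real ^ 'n::finite"
  assumes "0 \<le> u"
  shows "inner u x \<le> total u * norm x"
proof -
  have "inner u x \<le> (\<Sum>k\<in>UNIV. u $ k * norm x)"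
    unfolding inner_vec_def
  proof (intro sum_mono)
    fix k
    have "x $ k \<le> norm x" using component_le_norm_cart[of x k] by linarith
    then show "inner (u $ k) (x $ k) \<le> u $ k * norm x"
      using assms by (auto simp: vec_le_def intro: mult_left_mono)
  qed
  then show ?thesis by (simp add: sum_distrib_right)
qed

lemma one_minus_lst_le:
  fixes X :: "'a \<Rightarrow> real ^ 'n::finite"
  assumes P: "prob_space P" "X \<in> borel_measurable P" "AE \<omega> in P. 0 \<le> X \<omega>" "0 \<le> u"
    and X: "integrable P (\<lambda>\<omega>. norm (X \<omega>))"
  shows "1 - lst P X u \<le> total u * (\<integral>\<omega>. norm (X \<omega>) \<partial>P)"
proof -
  interpret prob_space P by fact
  have "1 - lst P X u = (\<integral>\<omega>. 1 - exp (- inner u (X \<omega>)) \<partial>P)"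
    using lst_int[OF P] by (simp add: lst_def prob_space)
  also have "\<dots> \<le> (\<integral>\<omega>. total u * norm (X \<omega>) \<partial>P)"
  proof (intro integral_mono)
    fix \<omega>
    have "1 - exp (- inner u (X \<omega>)) \<le> inner u (X \<omega>)"
      using exp_ge_add_one_self[of "- inner u (X \<omega>)"] by linarith
    also have "\<dots> \<le> total u * norm (X \<omega>)" using inner_le_total P by blast
    finally show "1 - exp (- inner u (X \<omega>)) \<le> total u * norm (X \<omega>)" .
  qed (use lst_int[OF P] X in auto)
  finally show ?thesis by simp
qed

lemma norm_le_total:
  fixes x :: "real ^ 'n::finite"
  assumes "0 \<le> x"
  shows "norm x \<le> total x"
  using norm_le_l1_cart[of x] assms by (simp add: vec_le_def)

text \<open>Converse to \<open>one_minus_lst_le\<close>: along u = h (1, ..., 1) the quotient (1 -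
  exp(- u X)) / h tends to the sum of the coordinates of X, and Fatou's lemma turns the bound on
  transforms into a finite mean.\<close>

lemma integrable_norm_of_lst:
  fixes X :: "'a \<Rightarrow> real ^ 'n::finite"
  assumes P: "prob_space P" and [measurable]: "X \<in> borel_measurable P" and X: "AE \<omega> in P. 0 \<le> X \<omega>"
    and bound: "\<forall>\<^sub>F n in sequentially. 1 - lst P X (hseq n *\<^sub>R (\<chi> k. 1)) \<le> c * hseq n"
  shows "integrable P (\<lambda>\<omega>. norm (X \<omega>))"
proof -
  interpret prob_space P by fact
  let ?u = "\<lambda>n. hseq n *\<^sub>R (\<chi> k. 1) :: real ^ 'n"
  have u: "0 \<le> ?u n" for n using hseq by (auto simp: vec_le_def)
  have inner_u: "inner (?u n) x = hseq n * total x" for n x by (simp add: inner_vec_def sum_distrib_left)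
  let ?f = "\<lambda>n \<omega>. ennreal ((1 - exp (- (hseq n * total (X \<omega>)))) / hseq n)"
  have "(\<integral>\<^sup>+\<omega>. ennreal (total (X \<omega>)) \<partial>P) = (\<integral>\<^sup>+\<omega>. liminf (\<lambda>n. ?f n \<omega>) \<partial>P)"
  proof (intro nn_integral_cong lim_imp_Liminf[symmetric])
    fix \<omega>
    show "(\<lambda>n. ?f n \<omega>) \<longlonglongrightarrow> ennreal (total (X \<omega>))" by (intro tendsto_ennrealI one_minus_exp_derivative)
  qed auto
  also have "\<dots> \<le> liminf (\<lambda>n. \<integral>\<^sup>+\<omega>. ?f n \<omega> \<partial>P)"
  proof (rule nn_integral_liminf)
    have [measurable]: "(\<lambda>\<omega>. inner (\<chi> k. 1) (X \<omega>)) \<in> borel_measurable P" by measurable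
    have "?f n = (\<lambda>\<omega>. ennreal ((1 - exp (- (hseq n * inner (\<chi> k. 1) (X \<omega>)))) / hseq n))" for n
      by (simp add: inner_vec_def)
    then show "?f n \<in> borel_measurable P" for n by simp
  qed
  also have "\<dots> \<le> liminf (\<lambda>n::nat. ennreal c)"
  proof (intro Liminf_mono)
    show "\<forall>\<^sub>F n in sequentially. (\<integral>\<^sup>+\<omega>. ?f n \<omega> \<partial>P) \<le> ennreal c"
      using bound
    proof eventually_elim
      case (elim n)
      have i: "integrable P (\<lambda>\<omega>. (1 - exp (- (hseq n * total (X \<omega>)))) / hseq n)"
        using lst_int[OF P _ X u[of n]] unfolding inner_u by simp
      have "(\<integral>\<^sup>+\<omega>. ?f n \<omega> \<partial>P) = ennreal (\<integral>\<omega>. (1 - exp (- (hseq n * total (X \<omega>)))) / hseq n \<partial>P)"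
      proof (intro nn_integral_eq_integral i)
        show "AE \<omega> in P. 0 \<le> (1 - exp (- (hseq n * total (X \<omega>)))) / hseq n"
          using X by eventually_elim
            (use hseq in \<open>auto simp: vec_le_def intro!: divide_nonneg_nonneg mult_nonneg_nonneg sum_nonneg\<close>)
      qed
      also have "(\<integral>\<omega>. (1 - exp (- (hseq n * total (X \<omega>)))) / hseq n \<partial>P) = (1 - lst P X (?u n)) / hseq n"
        using lst_int[OF P _ X u[of n]] unfolding inner_u lst_def by (simp add: prob_space)
      also have "\<dots> \<le> c" using elim hseq[of n] by (simp add: field_simps)
      finally show ?case by (simp add: ennreal_leI)
    qed
  qed
  also have "\<dots> = ennreal c" by (simp add: Liminf_const)
  finally have fin: "(\<integral>\<^sup>+\<omega>. ennreal (total (X \<omega>)) \<partial>P) \<le> ennreal c" .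
  show ?thesis
  proof (rule integrableI_nonneg)
    have "(\<integral>\<^sup>+\<omega>. ennreal (norm (X \<omega>)) \<partial>P) \<le> (\<integral>\<^sup>+\<omega>. ennreal (total (X \<omega>)) \<partial>P)"
      using X by (intro nn_integral_mono_AE, eventually_elim) (auto intro!: ennreal_leI norm_le_total)
    then show "(\<integral>\<^sup>+\<omega>. ennreal (norm (X \<omega>)) \<partial>P) < \<infinity>"
      using order_le_less_trans[OF order_trans[OF _ fin] ennreal_less_top] by simp
  qed auto
qed

text \<open>A fragment of the theory of Bernstein functions in several variables, free of
  probability and preserved by the construction of \<open>kappa\<close>. The last clause is what
  remains of concavity along rays starting at 0.\<close>

definition subordinator_exponent :: "(real ^ 'n::finite \<Rightarrow> real) \<Rightarrow> bool" where
  "subordinator_exponent \<eta> \<longleftrightarrow>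
     (\<forall>u\<ge>0. 0 \<le> \<eta> u) \<and> \<eta> 0 = 0 \<and>
     (\<forall>u v. 0 \<le> u \<longrightarrow> u \<le> v \<longrightarrow> \<eta> u \<le> \<eta> v) \<and>
     (\<forall>u\<ge>0. \<forall>v\<ge>0. \<eta> (u + v) \<le> \<eta> u + \<eta> v) \<and>
     (\<forall>u\<ge>0. \<forall>s. 0 \<le> s \<longrightarrow> s \<le> 1 \<longrightarrow> s * \<eta> u \<le> \<eta> (s *\<^sub>R u))"

text \<open>Each property passes from \<open>1 - lst M (Y h)\<close> to its rescaled limit as \<open>h\<close> tends to 0.\<close>

lemma subordinator_exponentI:
  fixes Y :: "real \<Rightarrow> 'a \<Rightarrow> real ^ 'n::finite"
  assumes Y: "levy_subordinator M Y" and \<eta>: "laplace_exponent M Y \<eta>"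
  shows "subordinator_exponent \<eta>"
proof -
  interpret prob_space M using Y by (auto simp: levy_subordinator_def levy_process_def)
  have nn: "AE \<omega> in M. 0 \<le> Y t \<omega>" if "0 \<le> t" for t
  proof -
    have "AE \<omega> in M. \<forall>s t. 0 \<le> s \<longrightarrow> s \<le> t \<longrightarrow> Y s \<omega> \<le> Y t \<omega>" "AE \<omega> in M. Y 0 \<omega> = 0"
      using Y by (auto simp: levy_subordinator_def levy_process_def)
    then show ?thesis by eventually_elim (use that in force)
  qed
  have meas [measurable]: "Y (hseq n) \<in> borel_measurable M" for n
    using Y hseq[of n] by (auto simp: levy_subordinator_def levy_process_def)
  note B = lst_bounds[OF prob_space_axioms meas nn[OF hseq(3)]]
  let ?g = "\<lambda>n u. 1 - lst M (Y (hseq n)) u"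
  have g_eq: "?g n u = (\<integral>\<omega>. 1 - exp (- inner u (Y (hseq n) \<omega>)) \<partial>M)" if "0 \<le> u" for n u
    using B(1)[OF that] by (simp add: lst_def prob_space)
  have g_int: "integrable M (\<lambda>\<omega>. 1 - exp (- inner u (Y (hseq n) \<omega>)))" if "0 \<le> u" for n u
    using B(1)[OF that] by simp
  have lim: "(\<lambda>n. ?g n u / hseq n) \<longlonglongrightarrow> \<eta> u" if u: "0 \<le> u" for u
    using one_minus_exp_derivative[of "\<eta> u"] \<eta> u hseq by (simp add: laplace_exponent_def)
  have nonneg: "0 \<le> \<eta> u" if u: "0 \<le> u" for u
    using lim[OF u] by (rule tendsto_lowerbound) (use B(3)[OF u] hseq in \<open>auto intro!: always_eventually\<close>)
  moreover have "\<eta> 0 = 0"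
  proof -
    have "lst M (Y 1) 0 = exp (- (1 * \<eta> 0))" using \<eta> unfolding laplace_exponent_def by force
    then show ?thesis by (simp add: lst_def prob_space)
  qed
  moreover have "\<eta> u \<le> \<eta> v" if uv: "0 \<le> u" "u \<le> v" for u v
  proof (rule LIMSEQ_le[OF lim lim])
    show u: "0 \<le> u" and v: "0 \<le> v" using uv by auto
    have "?g n u \<le> ?g n v" for n
      unfolding g_eq[OF u] g_eq[OF v]
    proof (intro integral_mono_AE g_int u v)
      show "AE \<omega> in M. 1 - exp (- inner u (Y (hseq n) \<omega>)) \<le> 1 - exp (- inner v (Y (hseq n) \<omega>))"
        using nn[OF hseq(3)[of n]]
      proof eventually_elim
        case (elim \<omega>)
        have "0 \<le> inner (v - u) (Y (hseq n) \<omega>)" using uv elim by (intro inner_nonneg_vec) auto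
        then show ?case by (simp add: inner_diff_left)
      qed
    qed
    then show "\<exists>n0. \<forall>n\<ge>n0. ?g n u / hseq n \<le> ?g n v / hseq n"
      using hseq by (intro exI[of _ 0]) (auto intro: divide_right_mono)
  qed
  moreover have "\<eta> (u + v) \<le> \<eta> u + \<eta> v" if u: "0 \<le> u" and v: "0 \<le> v" for u v
  proof (rule LIMSEQ_le[OF lim tendsto_add[OF lim lim]])
    show "0 \<le> u" "0 \<le> v" "0 \<le> u + v" using u v by auto
    have uv: "0 \<le> u + v" using u v by auto
    have "?g n (u + v) \<le> ?g n u + ?g n v" for n
      unfolding g_eq[OF u] g_eq[OF v] g_eq[OF uv] Bochner_Integration.integral_add[OF g_int[OF u] g_int[OF v], symmetric]
    proof (intro integral_mono_AE g_int uv Bochner_Integration.integrable_add u v)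
      show "AE \<omega> in M. 1 - exp (- inner (u + v) (Y (hseq n) \<omega>))
          \<le> (1 - exp (- inner u (Y (hseq n) \<omega>))) + (1 - exp (- inner v (Y (hseq n) \<omega>)))"
        using nn[OF hseq(3)[of n]]
      proof eventually_elim
        case (elim \<omega>)
        let ?a = "exp (- inner u (Y (hseq n) \<omega>))" and ?b = "exp (- inner v (Y (hseq n) \<omega>))"
        have "?a \<le> 1" "?b \<le> 1" using inner_nonneg_vec[OF u elim] inner_nonneg_vec[OF v elim] by auto
        \<comment> \<open>Subadditivity comes from 1 - a b <= (1 - a) + (1 - b) for a, b at most
          1.\<close>
        then have "0 \<le> (1 - ?a) * (1 - ?b)" by (intro mult_nonneg_nonneg) auto
        then have "1 - ?a * ?b \<le> (1 - ?a) + (1 - ?b)" by (simp add: algebra_simps)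
        then show ?case by (simp add: inner_add_left exp_add[symmetric])
      qed
    qed
    then show "\<exists>n0. \<forall>n\<ge>n0. ?g n (u + v) / hseq n \<le> ?g n u / hseq n + ?g n v / hseq n"
      using hseq by (intro exI[of _ 0]) (auto simp: add_divide_distrib[symmetric] intro: divide_right_mono)
  qed
  moreover have "s * \<eta> u \<le> \<eta> (s *\<^sub>R u)" if u: "0 \<le> u" and s: "0 \<le> s" "s \<le> 1" for u s
  proof (rule LIMSEQ_le[OF tendsto_mult[OF tendsto_const lim] lim])
    show "0 \<le> u" by fact
    show su: "0 \<le> s *\<^sub>R u" using u s by (auto simp: vec_le_def)
    \<comment> \<open>The function 1 - exp(- z) is concave and vanishes at 0.\<close>
    have "s * ?g n u \<le> ?g n (s *\<^sub>R u)" for n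
      unfolding g_eq[OF u] g_eq[OF su] integral_mult_right_zero[symmetric]
    proof (intro integral_mono_AE g_int su integrable_mult_right u)
      show "AE \<omega> in M. s * (1 - exp (- inner u (Y (hseq n) \<omega>))) \<le> 1 - exp (- inner (s *\<^sub>R u) (Y (hseq n) \<omega>))"
      proof (rule AE_I2)
        fix \<omega>
        show "s * (1 - exp (- inner u (Y (hseq n) \<omega>))) \<le> 1 - exp (- inner (s *\<^sub>R u) (Y (hseq n) \<omega>))"
          using convex_onD[OF exp_convex, of s 0 "- inner u (Y (hseq n) \<omega>)"] s by (simp add: algebra_simps)
      qed
    qed
    then show "\<exists>n0. \<forall>n\<ge>n0. s * (?g n u / hseq n) \<le> ?g n (s *\<^sub>R u) / hseq n"
      using hseq by (intro exI[of _ 0]) (auto intro: divide_right_mono)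
  qed
  ultimately show ?thesis unfolding subordinator_exponent_def by blast
qed

lemma subordinator_exponentD:
  assumes "subordinator_exponent \<eta>"
  shows "\<And>u. 0 \<le> u \<Longrightarrow> 0 \<le> \<eta> u" and "\<eta> 0 = 0" and "\<And>u v. 0 \<le> u \<Longrightarrow> u \<le> v \<Longrightarrow> \<eta> u \<le> \<eta> v"
    and "\<And>u v. 0 \<le> u \<Longrightarrow> 0 \<le> v \<Longrightarrow> \<eta> (u + v) \<le> \<eta> u + \<eta> v"
    and "\<And>u s. 0 \<le> u \<Longrightarrow> 0 \<le> s \<Longrightarrow> s \<le> 1 \<Longrightarrow> s * \<eta> u \<le> \<eta> (s *\<^sub>R u)"
  using assms unfolding subordinator_exponent_def by auto

section \<open>From behaviour near 0 on the axes to global linear bounds\<close>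

lemma vec_eq_sum_axis: "u = (\<Sum>k\<in>UNIV. (u $ k) *\<^sub>R axis k (1::real))" for u :: "real ^ 'n::finite"
  by (simp add: Finite_Cartesian_Product.vec_eq_iff axis_def if_distrib cong: if_cong)

lemma subadditive_le_axes:
  fixes f :: "real ^ 'n::finite \<Rightarrow> real"
  assumes z: "f 0 = 0" and sub: "\<And>u v. 0 \<le> u \<Longrightarrow> 0 \<le> v \<Longrightarrow> f (u + v) \<le> f u + f v" and u: "0 \<le> u"
  shows "f u \<le> (\<Sum>k\<in>UNIV. f ((u $ k) *\<^sub>R axis k 1))"
proof -
  have uk: "0 \<le> u $ k" for k using u by (simp add: vec_le_def)
  have "f (\<Sum>k\<in>K. (u $ k) *\<^sub>R axis k 1) \<le> (\<Sum>k\<in>K. f ((u $ k) *\<^sub>R axis k 1))" for K :: "'n set"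
    using finite[of K]
  proof (induction K rule: finite_induct)
    case (insert k K)
    have "f (\<Sum>k\<in>insert k K. (u $ k) *\<^sub>R axis k 1) = f ((u $ k) *\<^sub>R axis k 1 + (\<Sum>k\<in>K. (u $ k) *\<^sub>R axis k 1))"
      using insert by simp
    also have "\<dots> \<le> f ((u $ k) *\<^sub>R axis k 1) + f (\<Sum>k\<in>K. (u $ k) *\<^sub>R axis k 1)"
      by (intro sub sum_nonneg axis_nonneg uk)
    finally show ?case using insert by simp
  qed (simp add: z)
  from this[of UNIV] show ?thesis using vec_eq_sum_axis[of u] by simp
qed

text \<open>Along a ray \<open>f\<close> lies below its tangent at 0.\<close>

lemma star_concave_le:
  fixes f :: "real ^ 'n::finite \<Rightarrow> real"
  assumes star: "\<And>u s. 0 \<le> u \<Longrightarrow> 0 \<le> s \<Longrightarrow> s \<le> 1 \<Longrightarrow> s * f u \<le> f (s *\<^sub>R u)" and z: "f 0 = 0"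
    and lim: "\<exists>\<^sub>F n in sequentially. f (hseq n *\<^sub>R axis k 1) \<le> c * hseq n" and r: "0 \<le> r"
  shows "f (r *\<^sub>R axis k 1) \<le> c * r"
proof (cases "r = 0")
  case False
  then have r: "0 < r" using r by simp
  obtain n where n: "f (hseq n *\<^sub>R axis k 1) \<le> c * hseq n" "hseq n < r"
    using frequently_ex[OF frequently_rev_mp[OF lim eventually_mono[OF eventually_hseq_less[OF r]], of "\<lambda>n. f (hseq n *\<^sub>R axis k 1) \<le> c * hseq n \<and> hseq n < r"]] by auto
  \<comment> \<open>The small point is the shrinking of r e_k by the factor
    \<open>hseq n / r\<close> below 1, so a bound near 0 propagates outwards along the axis.\<close>
  have "hseq n / r * f (r *\<^sub>R axis k 1) \<le> f ((hseq n / r) *\<^sub>R (r *\<^sub>R axis k 1))"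
    using n r hseq[of n] by (intro star axis_nonneg) auto
  also have "(hseq n / r) *\<^sub>R (r *\<^sub>R axis k 1) = hseq n *\<^sub>R (axis k 1 :: real ^ 'n)" using r by simp
  also have "f (hseq n *\<^sub>R axis k 1) \<le> c * hseq n" by (rule n)
  finally have "hseq n * f (r *\<^sub>R axis k 1) \<le> hseq n * (c * r)" using r by (simp add: field_simps)
  then show ?thesis using hseq[of n] by simp
qed (simp add: z)

text \<open>A bound near 0 on each axis is enough: the ray property extends it along the axis, and
  subadditivity combines the axes. The sum of absolute values serves as a common nonnegative
  constant.\<close>

lemma subordinator_exponent_linear_bound:
  fixes \<eta> :: "real ^ 'n::finite \<Rightarrow> real"
  assumes \<eta>: "subordinator_exponent \<eta>"
    and c: "\<And>k. \<exists>c. \<forall>\<^sub>F n in sequentially. \<eta> (hseq n *\<^sub>R axis k 1) \<le> c * hseq n"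
  shows "\<exists>c\<ge>0. \<forall>u\<ge>0. \<eta> u \<le> c * total u"
proof -
  note E = subordinator_exponentD[OF \<eta>]
  obtain c where c: "\<And>k. \<forall>\<^sub>F n in sequentially. \<eta> (hseq n *\<^sub>R axis k 1) \<le> c k * hseq n"
    using c by metis
  have "\<eta> u \<le> (\<Sum>k\<in>UNIV. \<bar>c k\<bar>) * total u" if u: "0 \<le> u" for u
  proof -
    have uk: "0 \<le> u $ k" for k using u by (simp add: vec_le_def)
    have "\<eta> u \<le> (\<Sum>k\<in>UNIV. \<eta> ((u $ k) *\<^sub>R axis k 1))" by (rule subadditive_le_axes[OF E(2,4) u])
    also have "\<dots> \<le> (\<Sum>k\<in>UNIV. c k * u $ k)"
      using c by (intro sum_mono star_concave_le[OF E(5,2)] uk eventually_frequently) auto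
    also have "\<dots> \<le> (\<Sum>k\<in>UNIV. (\<Sum>k\<in>UNIV. \<bar>c k\<bar>) * u $ k)"
    proof (intro sum_mono mult_right_mono uk)
      fix k
      have "c k \<le> \<bar>c k\<bar>" by simp
      also have "\<dots> \<le> (\<Sum>k\<in>UNIV. \<bar>c k\<bar>)" by (rule member_le_sum) auto
      finally show "c k \<le> (\<Sum>k\<in>UNIV. \<bar>c k\<bar>)" .
    qed
    finally show ?thesis by (simp add: sum_distrib_left)
  qed
  then show ?thesis by (intro exI[of _ "\<Sum>k\<in>UNIV. \<bar>c k\<bar>"]) (auto intro: sum_nonneg)
qed

section \<open>The functions \<open>\<kappa>\<close>\<close>

lemma vec_upd_mono: "u \<le> v \<Longrightarrow> a \<le> b \<Longrightarrow> vec_upd u j a \<le> vec_upd v j b"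
  by (auto simp: vec_le_def vec_upd_def)

lemma vec_upd_add: "vec_upd u j a + vec_upd v j b = vec_upd (u + v) j (a + b)"
  by (auto simp: Finite_Cartesian_Product.vec_eq_iff vec_upd_def)

lemma vec_upd_scaleR: "s *\<^sub>R vec_upd u j a = vec_upd (s *\<^sub>R u) j (s * a)"
  by (auto simp: Finite_Cartesian_Product.vec_eq_iff vec_upd_def)

context
  fixes q :: "nat \<Rightarrow> 'n::finite" and \<eta> :: "nat \<Rightarrow> real ^ 'n \<Rightarrow> real"
  assumes \<eta>: "\<And>i. i \<in> {1..CARD('n)} \<Longrightarrow> subordinator_exponent (\<eta> i)"
begin

lemma kappa_rec_nonneg: "0 \<le> u \<Longrightarrow> k \<le> CARD('n) \<Longrightarrow> 0 \<le> kappa_rec q \<eta> u k"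
  by (induction k) (auto simp: Let_def intro!: vec_upd_nonneg subordinator_exponentD(1)[OF \<eta>])

lemma kappa_rec_zero: "k \<le> CARD('n) \<Longrightarrow> kappa_rec q \<eta> 0 k = 0"
proof (induction k)
  case (Suc k)
  have "\<eta> (CARD('n) - k) 0 = 0" using Suc by (intro subordinator_exponentD(2)[OF \<eta>]) auto
  moreover have IH: "kappa_rec q \<eta> 0 k = 0" using Suc by simp
  ultimately show ?case
    unfolding kappa_rec.simps Let_def IH by (simp add: vec_upd_def Finite_Cartesian_Product.vec_eq_iff)
qed simp

text \<open>One step of the recursion replaces a coordinate by the value of an exponent at the
  current vector. The induction hypothesis is only an inequality between vectors, so monotonicity of
  the exponent is used before its subadditivity. The same pattern yields
  \<open>kappa_rec_star\<close>.\<close>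

lemma kappa_rec_subadditive:
  "0 \<le> u \<Longrightarrow> 0 \<le> v \<Longrightarrow> k \<le> CARD('n) \<Longrightarrow> kappa_rec q \<eta> (u + v) k \<le> kappa_rec q \<eta> u k + kappa_rec q \<eta> v k"
proof (induction k)
  case (Suc k)
  define a where "a = kappa_rec q \<eta> u k"
  define b where "b = kappa_rec q \<eta> v k"
  define c where "c = kappa_rec q \<eta> (u + v) k"
  define i where "i = CARD('n) - k"
  have nn: "0 \<le> a" "0 \<le> b" "0 \<le> c" unfolding a_def b_def c_def using Suc.prems by (intro kappa_rec_nonneg; simp)+
  have i: "i \<in> {1..CARD('n)}" using Suc.prems by (auto simp: i_def)
  note E = subordinator_exponentD[OF \<eta>[OF i]]
  have le: "c \<le> a + b" using Suc by (simp add: a_def b_def c_def)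
  have "\<eta> i c \<le> \<eta> i (a + b)" using nn le by (intro E(3))
  also have "\<dots> \<le> \<eta> i a + \<eta> i b" using nn by (intro E(4))
  finally have "vec_upd c (q i) (\<eta> i c) \<le> vec_upd (a + b) (q i) (\<eta> i a + \<eta> i b)"
    using le by (intro vec_upd_mono)
  then show ?case by (simp add: Let_def vec_upd_add a_def b_def c_def i_def)
qed simp

lemma kappa_rec_star:
  "0 \<le> u \<Longrightarrow> 0 \<le> s \<Longrightarrow> s \<le> 1 \<Longrightarrow> k \<le> CARD('n) \<Longrightarrow> s *\<^sub>R kappa_rec q \<eta> u k \<le> kappa_rec q \<eta> (s *\<^sub>R u) k"
proof (induction k)
  case (Suc k)
  define a where "a = kappa_rec q \<eta> u k"
  define c where "c = kappa_rec q \<eta> (s *\<^sub>R u) k"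
  define i where "i = CARD('n) - k"
  have nn: "0 \<le> a" unfolding a_def using Suc.prems by (intro kappa_rec_nonneg) auto
  then have sa: "0 \<le> s *\<^sub>R a" using Suc.prems by (auto simp: vec_le_def)
  have i: "i \<in> {1..CARD('n)}" using Suc.prems by (auto simp: i_def)
  note E = subordinator_exponentD[OF \<eta>[OF i]]
  have le: "s *\<^sub>R a \<le> c" using Suc by (simp add: a_def c_def)
  have "s * \<eta> i a \<le> \<eta> i (s *\<^sub>R a)" using nn Suc.prems by (intro E(5))
  also have "\<dots> \<le> \<eta> i c" using sa le by (intro E(3))
  finally have "vec_upd (s *\<^sub>R a) (q i) (s * \<eta> i a) \<le> vec_upd c (q i) (\<eta> i c)"
    using le by (intro vec_upd_mono)
  then show ?case by (simp add: Let_def vec_upd_scaleR a_def c_def i_def)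
qed simp

lemma kappa_nonneg: "0 \<le> u \<Longrightarrow> 0 \<le> kappa q \<eta> u"
  unfolding kappa_def by (intro kappa_rec_nonneg) auto

lemma kappa_tail_nonneg: "0 \<le> u \<Longrightarrow> 0 \<le> kappa_tail q \<eta> i u"
  using kappa_nonneg[of u] by (auto simp: vec_le_def kappa_tail_def)

text \<open>Each coordinate of \<open>kappa\<close> inherits subadditivity and the ray property,
  hence lies below its linearisation at 0. One-sided derivatives along the axes are all that
  enters.\<close>

lemma kappa_le_jacobian:
  assumes m: "\<And>j. ((\<lambda>h. kappa q \<eta> (h *\<^sub>R axis j 1) $ i) has_real_derivative m j) (at 0 within {0..})"
    and u: "0 \<le> u"
  shows "kappa q \<eta> u $ i \<le> (\<Sum>j\<in>UNIV. m j * u $ j)"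
proof -
  let ?f = "\<lambda>u. kappa q \<eta> u $ i"
  have z: "?f 0 = 0" by (simp add: kappa_def kappa_rec_zero)
  have star: "s * ?f u \<le> ?f (s *\<^sub>R u)" if "0 \<le> u" "0 \<le> s" "s \<le> 1" for u s
    using kappa_rec_star[OF that order_refl] by (simp add: kappa_def vec_le_def)
  have uk: "0 \<le> u $ k" for k using u by (simp add: vec_le_def)
  have "?f u \<le> (\<Sum>k\<in>UNIV. ?f ((u $ k) *\<^sub>R axis k 1))"
    using u z by (intro subadditive_le_axes) (use kappa_rec_subadditive[OF _ _ order_refl] in \<open>auto simp: kappa_def vec_le_def\<close>)
  also have "\<dots> \<le> (\<Sum>k\<in>UNIV. m k * u $ k)"
  proof (intro sum_mono)
    fix k
    \<comment> \<open>The derivative bounds the difference quotients near 0 only up to a slack e,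
      which is removed at the end.\<close>
    have "?f ((u $ k) *\<^sub>R axis k 1) \<le> (m k + e) * u $ k" if e: "0 < e" for e
    proof (rule star_concave_le[OF star z _ uk])
      have "((\<lambda>h. ?f (h *\<^sub>R axis k 1) / h) \<longlongrightarrow> m k) (at_right 0)"
        using m[of k] z by (simp add: has_field_derivative_iff at_within_atLeast)
      from filterlim_compose[OF this hseq_at_right]
      have "\<forall>\<^sub>F n in sequentially. ?f (hseq n *\<^sub>R axis k 1) / hseq n < m k + e"
        using e by (intro order_tendstoD(2)[of _ "m k"]) auto
      then have "\<forall>\<^sub>F n in sequentially. ?f (hseq n *\<^sub>R axis k 1) \<le> (m k + e) * hseq n"
      proof eventually_elim
        case (elim n)
        then show ?case using hseq[of n] by (simp add: pos_divide_less_eq)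
      qed
      then show "\<exists>\<^sub>F n in sequentially. ?f (hseq n *\<^sub>R axis k 1) \<le> (m k + e) * hseq n"
        by (intro eventually_frequently) auto
    qed
    then have le: "?f ((u $ k) *\<^sub>R axis k 1) \<le> m k * u $ k + e * u $ k" if "0 < e" for e
      using that by (simp add: distrib_right)
    show "?f ((u $ k) *\<^sub>R axis k 1) \<le> m k * u $ k"
    proof (rule field_le_epsilon)
      fix e :: real assume e: "0 < e"
      have "e / (1 + u $ k) * u $ k \<le> e" using e uk[of k] by (simp add: field_simps)
      then show "?f ((u $ k) *\<^sub>R axis k 1) \<le> m k * u $ k + e"
        using le[of "e / (1 + u $ k)"] e uk[of k] by (smt (verit) divide_pos_pos)
    qed
  qed
  finally show ?thesis .
qed

end

text \<open>After division by some \<rho> between the spectral radius and 1 the eigenvalues are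
  still inside the unit disc, so the Jordan normal form bounds all powers of the rescaled matrix.
  Undoing the scaling produces the factor \<rho>^k.\<close>

lemma spectral_radius_geometric:
  fixes A :: "complex mat"
  assumes A: "A \<in> carrier_mat n n" and n: "0 < n" and sr: "spectral_radius A < 1"
  shows "\<exists>c \<rho>. 0 \<le> c \<and> 0 < \<rho> \<and> \<rho> < 1 \<and> (\<forall>k i j. i < n \<longrightarrow> j < n \<longrightarrow> norm ((A ^\<^sub>m k) $$ (i, j)) \<le> c * \<rho> ^ k)"
proof -
  have sr0: "0 \<le> spectral_radius A" using spectral_radius_mem_max(1)[OF A n] by auto
  \<comment> \<open>The midpoint between the spectral radius and 1; it is positive because the
    spectral radius is nonnegative.\<close>
  define \<rho> where "\<rho> = (1 + spectral_radius A) / 2"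
  have \<rho>: "0 < \<rho>" "\<rho> < 1" "spectral_radius A < \<rho>" using sr sr0 by (auto simp: \<rho>_def)
  define r where "r = complex_of_real (1 / \<rho>)"
  have r: "r \<noteq> 0" using \<rho> by (simp add: r_def)
  define B where "B = r \<cdot>\<^sub>m A"
  have B: "B \<in> carrier_mat n n" using A by (simp add: B_def)
  have "norm e < 1" if e: "e \<in> spectrum B" for e
  proof -
    obtain v where v: "v \<in> carrier_vec n" "v \<noteq> 0\<^sub>v n" "B *\<^sub>v v = e \<cdot>\<^sub>v v"
      using e B unfolding spectrum_def eigenvalue_def eigenvector_def by auto
    have Bv: "B *\<^sub>v v = r \<cdot>\<^sub>v (A *\<^sub>v v)" using A v(1) by (intro eq_vecI) (auto simp: B_def)
    have "A *\<^sub>v v = (1 / r) \<cdot>\<^sub>v (B *\<^sub>v v)" unfolding Bv using r by (simp add: smult_smult_assoc)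
    also have "\<dots> = (e / r) \<cdot>\<^sub>v v" unfolding v(3) by (simp add: smult_smult_assoc)
    finally have "e / r \<in> spectrum A"
      using v A unfolding spectrum_def eigenvalue_def eigenvector_def by auto
    then have "norm (e / r) \<le> spectral_radius A" by (intro spectral_radius_mem_max(2)[OF A n]) auto
    moreover have "norm (e / r) = norm e * \<rho>" using \<rho> by (simp add: r_def norm_divide norm_mult)
    ultimately have "norm e * \<rho> < 1 * \<rho>" using \<rho> by linarith
    then show ?thesis using \<rho>(1) by (simp only: mult_less_cancel_right_pos)
  qed
  then have "spectral_radius B < 1"
    using spectral_radius_mem_max(1)[OF B n] by auto
  moreover have "\<exists>n_as. jordan_nf B n_as"
    using char_poly_factorized[OF B] jordan_nf_exists[OF B] by blast
  ultimately obtain c where c: "\<And>k. norm_bound (B ^\<^sub>m k) c"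
    using spectral_radius_jnf_norm_bound_less_1[OF B] by auto
  have pow: "B ^\<^sub>m k = r ^ k \<cdot>\<^sub>m (A ^\<^sub>m k)" for k
  proof (induction k)
    case 0
    have "B ^\<^sub>m 0 = 1\<^sub>m n" "A ^\<^sub>m 0 = 1\<^sub>m n" using A B by auto
    then show ?case by (simp only: power_0) (intro eq_matI, auto)
  next
    case (Suc k)
    have Ak: "A ^\<^sub>m k \<in> carrier_mat n n" using A by (rule pow_carrier_mat)
    have "B ^\<^sub>m Suc k = (r ^ k \<cdot>\<^sub>m (A ^\<^sub>m k)) * (r \<cdot>\<^sub>m A)" using Suc by (simp add: B_def)
    also have "\<dots> = r ^ k \<cdot>\<^sub>m (r \<cdot>\<^sub>m (A ^\<^sub>m k * A))"
      using Ak A mult_smult_assoc_mat[OF Ak, of "r \<cdot>\<^sub>m A" n "r ^ k"] mult_smult_distrib[OF Ak A, of r] by simp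
    also have "\<dots> = r ^ Suc k \<cdot>\<^sub>m (A ^\<^sub>m Suc k)" using Ak A by (intro eq_matI) auto
    finally show ?case .
  qed
  have "norm ((A ^\<^sub>m k) $$ (i, j)) \<le> max c 0 * \<rho> ^ k" if ij: "i < n" "j < n" for k i j
  proof -
    have Ak: "A ^\<^sub>m k \<in> carrier_mat n n" using A by (rule pow_carrier_mat)
    have "norm ((B ^\<^sub>m k) $$ (i, j)) \<le> c"
      by (rule c[of k, unfolded norm_bound_def, rule_format])
        (simp_all only: carrier_matD[OF pow_carrier_mat[OF B]] ij)
    moreover have "(B ^\<^sub>m k) $$ (i, j) = r ^ k * (A ^\<^sub>m k) $$ (i, j)"
      unfolding pow by (rule index_smult_mat(1)) (simp_all only: carrier_matD[OF Ak] ij)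
    moreover have "norm (r ^ k) = 1 / \<rho> ^ k" using \<rho> by (simp add: r_def norm_power norm_divide power_one_over)
    ultimately have "norm ((A ^\<^sub>m k) $$ (i, j)) / \<rho> ^ k \<le> c" by (simp add: norm_mult)
    then have "norm ((A ^\<^sub>m k) $$ (i, j)) \<le> c * \<rho> ^ k" using \<rho> by (simp add: pos_divide_le_eq)
    also have "\<dots> \<le> max c 0 * \<rho> ^ k" using \<rho> by (intro mult_right_mono) auto
    finally show ?thesis .
  qed
  then show ?thesis using \<rho> by (intro exI[of _ "max c 0"] exI[of _ \<rho>]) auto
qed

text \<open>Repackages matrix powers as functions \<open>p k i j\<close> with a recursion by finite
  sums, so that the later estimates need no matrix dimensions. Indices start at 0 here and at 1 in
  \<open>m\<close>.\<close>

lemma nonneg_matrix_geometric: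
  fixes m :: "nat \<Rightarrow> nat \<Rightarrow> real"
  assumes n: "0 < n" and sr: "spectral_radius (Matrix.mat n n (\<lambda>(i, j). complex_of_real (m (Suc i) (Suc j)))) < 1"
  shows "\<exists>p c \<rho>. 0 \<le> c \<and> 0 < \<rho> \<and> \<rho> < 1 \<and>
    (\<forall>i<n. \<forall>j<n. p 0 i j = (if i = j then 1 else 0)) \<and>
    (\<forall>k. \<forall>i<n. \<forall>j<n. p (Suc k) i j = (\<Sum>l<n. p k i l * m (Suc l) (Suc j))) \<and>
    (\<forall>k. \<forall>i<n. \<forall>j<n. \<bar>p k i j :: real\<bar> \<le> c * \<rho> ^ k)"
proof -
  define B where "B = Matrix.mat n n (\<lambda>(i, j). m (Suc i) (Suc j))"
  have B: "B \<in> carrier_mat n n" by (simp add: B_def)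
  have AB: "Matrix.mat n n (\<lambda>(i, j). complex_of_real (m (Suc i) (Suc j))) = map_mat complex_of_real B"
    unfolding B_def by (intro eq_matI) auto
  obtain c \<rho> where c: "0 \<le> c" "0 < \<rho>" "\<rho> < 1"
    "\<And>k i j. i < n \<Longrightarrow> j < n \<Longrightarrow> norm ((map_mat complex_of_real B ^\<^sub>m k) $$ (i, j)) \<le> c * \<rho> ^ k"
    using spectral_radius_geometric[of "map_mat complex_of_real B" n] B n sr unfolding AB by auto
  have Bk: "B ^\<^sub>m k \<in> carrier_mat n n" for k using B by (rule pow_carrier_mat)
  have "\<bar>(B ^\<^sub>m k) $$ (i, j)\<bar> \<le> c * \<rho> ^ k" if "i < n" "j < n" for k i j
    using c(4)[OF that, of k] carrier_matD[OF Bk[of k]] that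
    by (simp add: of_real_hom.mat_hom_pow[OF B, symmetric])
  moreover have "(B ^\<^sub>m Suc k) $$ (i, j) = (\<Sum>l<n. (B ^\<^sub>m k) $$ (i, l) * m (Suc l) (Suc j))"
    if "i < n" "j < n" for k i j
  proof -
    have "(B ^\<^sub>m Suc k) $$ (i, j) = scalar_prod (Matrix.row (B ^\<^sub>m k) i) (col B j)" using Bk[of k] B that by simp
    also have "\<dots> = (\<Sum>l<n. (B ^\<^sub>m k) $$ (i, l) * B $$ (l, j))"
      unfolding scalar_prod_def using Bk[of k] B that by (intro sum.cong) auto
    finally show ?thesis using that by (simp add: B_def)
  qed
  moreover have "(B ^\<^sub>m 0) $$ (i, j) = (if i = j then 1 else 0)" if "i < n" "j < n" for i j
    using B that by simp
  ultimately show ?thesis using c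
    by (intro exI[of _ "\<lambda>k i j. (B ^\<^sub>m k) $$ (i, j)"] exI[of _ c] exI[of _ \<rho>]) auto
qed

text \<open>Iterating \<kappa>(u) <= M u to \<kappa>^k(u) <= M^k u requires that multiplication by
  powers of M preserve inequalities, that is, nonnegative entries.\<close>

lemma kappa_iterates_geometric:
  fixes q :: "nat \<Rightarrow> 'n::finite" and \<eta> :: "nat \<Rightarrow> real ^ 'n \<Rightarrow> real"
  assumes \<eta>: "\<And>i. i \<in> {1..CARD('n)} \<Longrightarrow> subordinator_exponent (\<eta> i)"
    and N: "N = CARD('n)" and q: "bij_betw q {1..N} UNIV"
    and m: "\<forall>i\<in>{1..N}. \<forall>j\<in>{1..N}.
           ((\<lambda>h. kappa q \<eta> (h *\<^sub>R axis (q j) 1) $ q i) has_real_derivative m i j) (at 0 within {0..})"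
    and spectral: "spectral_radius
           (Matrix.mat N N (\<lambda>(i, j). complex_of_real (m (Suc i) (Suc j)))) < 1"
  shows "\<exists>c \<rho>. 0 \<le> c \<and> 0 < \<rho> \<and> \<rho> < 1 \<and> (\<forall>u\<ge>0. \<forall>k. 0 \<le> (kappa q \<eta> ^^ k) u \<and> total ((kappa q \<eta> ^^ k) u) \<le> c * \<rho> ^ k * total u)"
proof -
  have N0: "0 < N" by (simp add: N)
  obtain p c \<rho> where c: "0 \<le> c" "0 < \<rho>" "\<rho> < 1"
    and p: "\<forall>i<N. \<forall>j<N. p 0 i j = (if i = j then 1 else 0)"
      "\<forall>k. \<forall>i<N. \<forall>j<N. p (Suc k) i j = (\<Sum>l<N. p k i l * m (Suc l) (Suc j))"
      "\<forall>k. \<forall>i<N. \<forall>j<N. \<bar>p k i j :: real\<bar> \<le> c * \<rho> ^ k"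
    using nonneg_matrix_geometric[OF N0 spectral] by (elim exE conjE) (rule that)
  note p0 = p(1)[rule_format] and pS = p(2)[rule_format] and pb = p(3)[rule_format]
  define Q where "Q i = q (Suc i)" for i
  have Q: "bij_betw Q {..<N} UNIV"
  proof -
    have "bij_betw Suc {..<N} {1..N}"
      by (rule bij_betw_byWitness[where f'="\<lambda>i. i - 1"]) auto
    from bij_betw_trans[OF this q] show ?thesis by (simp add: Q_def[abs_def] o_def)
  qed
  have total_Q: "total u = (\<Sum>i<N. u $ Q i)" for u :: "real ^ 'n"
    using sum.reindex_bij_betw[OF Q, of "\<lambda>k. u $ k"] by simp
  have nn: "0 \<le> (kappa q \<eta> ^^ k) u" if "0 \<le> u" for k u
    using that by (induction k) (auto intro: kappa_nonneg[OF \<eta>])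
  have jac: "kappa q \<eta> u $ Q i \<le> (\<Sum>j<N. m (Suc i) (Suc j) * u $ Q j)" if u: "0 \<le> u" and i: "i < N" for u i
  proof -
    \<comment> \<open>The matrix is indexed by queue numbers and the vectors by coordinates;
      \<open>m'\<close> carries row i over to coordinates through the inverse of the
      numbering.\<close>
    define m' where "m' k = m (Suc i) (Suc (the_inv_into {..<N} Q k))" for k
    have inv: "the_inv_into {..<N} Q (Q j) = j" if "j < N" for j
      using Q that by (intro the_inv_into_f_f) (auto simp: bij_betw_def)
    have "kappa q \<eta> u $ Q i \<le> (\<Sum>k\<in>UNIV. m' k * u $ k)"
    proof (rule kappa_le_jacobian[OF \<eta> _ u])
      fix k
      obtain j where j: "j < N" "k = Q j" using bij_betw_imp_surj_on[OF Q] by (metis UNIV_I imageE lessThan_iff)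
      show "((\<lambda>h. kappa q \<eta> (h *\<^sub>R axis k 1) $ Q i) has_real_derivative m' k) (at 0 within {0..})"
        using m[rule_format, of "Suc i" "Suc j"] i j inv[of j] by (simp add: m'_def Q_def)
    qed
    also have "\<dots> = (\<Sum>j<N. m' (Q j) * u $ Q j)"
      using sum.reindex_bij_betw[OF Q, of "\<lambda>k. m' k * u $ k"] by simp
    also have "\<dots> = (\<Sum>j<N. m (Suc i) (Suc j) * u $ Q j)"
      by (intro sum.cong) (auto simp: m'_def inv)
    finally show ?thesis .
  qed
  \<comment> \<open>Each entry is a limit of difference quotients of a nonnegative function that
    vanishes at 0.\<close>
  have m0: "0 \<le> m (Suc i) (Suc j)" if "i < N" "j < N" for i j
  proof -
    have "((\<lambda>h. kappa q \<eta> (h *\<^sub>R axis (Q j) 1) $ Q i) has_real_derivative m (Suc i) (Suc j)) (at 0 within {0..})"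
      using m[rule_format, of "Suc i" "Suc j"] that by (simp add: Q_def)
    moreover have "kappa q \<eta> 0 = 0" unfolding kappa_def by (rule kappa_rec_zero[OF \<eta> order_refl])
    ultimately have lim: "((\<lambda>h. kappa q \<eta> (h *\<^sub>R axis (Q j) 1) $ Q i / h) \<longlongrightarrow> m (Suc i) (Suc j)) (at_right 0)"
      by (simp add: has_field_derivative_iff at_within_atLeast)
    show ?thesis
    proof (rule tendsto_lowerbound[OF lim])
      have "0 \<le> kappa q \<eta> (h *\<^sub>R axis (Q j) 1) $ Q i / h" if "0 < h" for h
        using kappa_nonneg[OF \<eta> axis_nonneg[of h "Q j"]] that by (simp add: vec_le_def)
      then show "\<forall>\<^sub>F h in at_right 0. 0 \<le> kappa q \<eta> (h *\<^sub>R axis (Q j) 1) $ Q i / h"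
        by (simp add: eventually_at_filter)
    qed simp
  qed
  have p_nn: "0 \<le> p k i j" if "i < N" "j < N" for k i j
    using that
  proof (induction k arbitrary: j)
    case (Suc k) then show ?case by (auto simp: pS intro!: sum_nonneg mult_nonneg_nonneg m0)
  qed (auto simp: p0)
  have it: "(kappa q \<eta> ^^ k) u $ Q i \<le> (\<Sum>j<N. p k i j * u $ Q j)" if u: "0 \<le> u" and i: "i < N" for u i k
    using u
  proof (induction k arbitrary: u)
    case 0
    have "(\<Sum>j<N. p 0 i j * u $ Q j) = (\<Sum>j<N. if i = j then u $ Q j else 0)"
      using i by (intro sum.cong) (auto simp: p0)
    then show ?case using i by simp
  next
    case (Suc k)
    have "(kappa q \<eta> ^^ Suc k) u $ Q i = (kappa q \<eta> ^^ k) (kappa q \<eta> u) $ Q i"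
      by (simp add: funpow_swap1)
    also have "\<dots> \<le> (\<Sum>l<N. p k i l * kappa q \<eta> u $ Q l)"
      by (rule Suc.IH[OF kappa_nonneg[OF \<eta> Suc.prems]])
    also have "\<dots> \<le> (\<Sum>l<N. p k i l * (\<Sum>j<N. m (Suc l) (Suc j) * u $ Q j))"
      using i Suc.prems by (intro sum_mono mult_left_mono jac p_nn) auto
    also have "\<dots> = (\<Sum>j<N. (\<Sum>l<N. p k i l * m (Suc l) (Suc j)) * u $ Q j)"
      unfolding sum_distrib_left sum_distrib_right by (subst sum.swap) (simp add: mult.assoc)
    also have "\<dots> = (\<Sum>j<N. p (Suc k) i j * u $ Q j)" using i by (intro sum.cong) (auto simp: pS)
    finally show ?case .
  qed
  \<comment> \<open>The factor N in the constant comes from summing the entrywise bound over the N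
    rows.\<close>
  have "total ((kappa q \<eta> ^^ k) u) \<le> real N * c * \<rho> ^ k * total u" if u: "0 \<le> u" for u k
  proof -
    have "total ((kappa q \<eta> ^^ k) u) \<le> (\<Sum>i<N. \<Sum>j<N. p k i j * u $ Q j)"
      unfolding total_Q by (intro sum_mono it u) auto
    also have "\<dots> \<le> (\<Sum>i<N. \<Sum>j<N. c * \<rho> ^ k * u $ Q j)"
    proof (intro sum_mono mult_right_mono)
      show "p k i j \<le> c * \<rho> ^ k" if "i \<in> {..<N}" "j \<in> {..<N}" for i j
        using pb[of i j k] that by auto
    qed (use u in \<open>auto simp: vec_le_def\<close>)
    also have "\<dots> = real N * c * \<rho> ^ k * total u"
      by (simp add: total_Q sum_distrib_left[symmetric])
    finally show ?thesis .
  qed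
  then show ?thesis using nn c by (intro exI[of _ "real N * c"] exI[of _ \<rho>]) auto
qed

section \<open>Mean visit times and linear bounds\<close>

lemma exp_second_order: "0 \<le> z \<Longrightarrow> z \<le> 1 \<Longrightarrow> \<bar>exp z - 1 - z\<bar> \<le> z\<^sup>2" for z :: real
  using exp_bound[of z] exp_ge_add_one_self[of z] zero_le_power2[of z] by linarith

text \<open>Turns bounds on 1 - exp(- z), which is what transforms deliver, into bounds on the
  exponent z itself; the price is a factor 2 and smallness of b.\<close>

lemma le_twice_of_one_minus_exp:
  fixes z b :: real
  assumes "0 \<le> z" "1 - exp (- z) \<le> b" "b \<le> 1 / 2"
  shows "z \<le> 2 * b"
proof -
  have "1 / 2 \<le> exp (- z)" using assms by linarith
  then have e: "exp z \<le> 2" by (simp add: exp_minus field_simps)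
  have b: "0 \<le> b" using assms by (smt (verit) exp_le_one_iff)
  have "z \<le> exp z - 1" using exp_ge_add_one_self[of z] by linarith
  also have "\<dots> = (1 - exp (- z)) * exp z" by (simp add: left_diff_distrib exp_add[symmetric])
  also have "\<dots> \<le> b * exp z" using assms by (intro mult_right_mono) auto
  also have "\<dots> \<le> b * 2" using e b by (intro mult_left_mono)
  finally show ?thesis by simp
qed

context polling_template
begin

lemma subordinator_exponent_\<phi>: "subordinator_exponent \<phi>"
  using subordinator_exponentI W \<phi> by blast

lemma subordinator_exponent_\<eta>: "i \<in> {1..N} \<Longrightarrow> subordinator_exponent (\<eta> i)"
  using subordinator_exponentI branching by blast

text \<open>Fatou's lemma bounds the lower limit from below, and \<open>V_le\<close>, whose factor
  exp(h x) tends to 1, bounds the upper limit from above.\<close>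

lemma V_limit:
  assumes i: "i \<in> {1..N}" and x: "0 \<le> x"
  shows "(\<lambda>n. enn2real (V i (hseq n *\<^sub>R axis (q i) 1) x)) \<longlonglongrightarrow> (\<integral>\<omega>. T i x \<omega> \<partial>M)"
proof -
  let ?V = "\<lambda>n. V i (hseq n *\<^sub>R axis (q i) 1) x"
  have ET: "(\<integral>\<^sup>+\<omega>. ennreal (T i x \<omega>) \<partial>M) = ennreal (\<integral>\<omega>. T i x \<omega> \<partial>M)"
    using visit_time(2)[OF i x] by (simp add: nn_integral_eq_integral T_nonneg)
  have "ennreal (\<integral>\<omega>. T i x \<omega> \<partial>M) \<le> liminf ?V"
    unfolding ET[symmetric] V_def using i by (intro time_le_liminf_transform) (auto simp: T_nonneg)
  moreover have "limsup ?V \<le> ennreal (\<integral>\<omega>. T i x \<omega> \<partial>M)"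
  proof -
    have "?V n \<le> ennreal (exp (hseq n * x) * (\<integral>\<omega>. T i x \<omega> \<partial>M))" for n
      using V_le[OF i x axis_nonneg[of "hseq n" "q i"]] hseq[of n] by simp
    then have "limsup ?V \<le> limsup (\<lambda>n. ennreal (exp (hseq n * x) * (\<integral>\<omega>. T i x \<omega> \<partial>M)))"
      by (intro Limsup_mono always_eventually) auto
    also have "\<dots> = ennreal (\<integral>\<omega>. T i x \<omega> \<partial>M)"
    proof (rule lim_imp_Limsup)
      have "(\<lambda>n. exp (hseq n * x) * (\<integral>\<omega>. T i x \<omega> \<partial>M)) \<longlonglongrightarrow> exp (0 * x) * (\<integral>\<omega>. T i x \<omega> \<partial>M)"
        by (intro tendsto_intros hseq_lim)
      then show "(\<lambda>n. ennreal (exp (hseq n * x) * (\<integral>\<omega>. T i x \<omega> \<partial>M))) \<longlonglongrightarrow> ennreal (\<integral>\<omega>. T i x \<omega> \<partial>M)"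
        by (intro tendsto_ennrealI) simp
    qed simp
    finally show ?thesis .
  qed
  ultimately have "?V \<longlonglongrightarrow> ennreal (\<integral>\<omega>. T i x \<omega> \<partial>M)"
    using Liminf_le_Limsup[of sequentially ?V] by (intro Liminf_eq_Limsup) auto
  then show ?thesis
    by (intro tendsto_enn2real) (auto intro: integral_nonneg_AE simp: T_nonneg)
qed

text \<open>Near 0 the exponent of \<open>A i\<close> along e_i is negative while the visit
  transform is nonnegative, so \<open>V_eq\<close> at x = 1 forces 1 - exp(h - \<eta>) <= 0, that is
  \<eta> <= h. No derivative of \<eta> is needed.\<close>

lemma exponents_small:
  assumes i: "i \<in> {1..N}"
  shows "\<exists>c>0. \<forall>\<^sub>F n in sequentially. \<phi>A i (hseq n *\<^sub>R axis (q i) 1) \<le> - c * hseq n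
    \<and> \<eta> i (hseq n *\<^sub>R axis (q i) 1) \<le> hseq n"
proof -
  obtain c where c: "0 < c" and drift: "\<forall>\<^sub>F n in sequentially. \<phi>A i (hseq n *\<^sub>R axis (q i) 1) \<le> - c * hseq n"
    using exponent_drift[OF i] by auto
  have "\<forall>\<^sub>F n in sequentially. \<phi>A i (hseq n *\<^sub>R axis (q i) 1) \<le> - c * hseq n
    \<and> \<eta> i (hseq n *\<^sub>R axis (q i) 1) \<le> hseq n"
    using drift
  proof eventually_elim
    case (elim n)
    have "\<phi>A i (hseq n *\<^sub>R axis (q i) 1) \<le> 0"
      using elim c hseq[of n] by (smt (verit) mult_pos_pos mult_minus_left)
    then have "\<phi>A i (hseq n *\<^sub>R axis (q i) 1) * enn2real (V i (hseq n *\<^sub>R axis (q i) 1) 1) \<le> 0"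
      by (simp add: mult_nonpos_nonneg)
    then have "1 - exp (hseq n - \<eta> i (hseq n *\<^sub>R axis (q i) 1)) \<le> 0"
      using V_eq[OF i zero_le_one axis_nonneg[of "hseq n" "q i"]] hseq[of n] by simp
    then show ?case using elim by simp
  qed
  then show ?thesis using c by blast
qed

text \<open>By \<open>V_eq\<close>, p V(x) = exp(x d) - 1 with p minus the exponent of
  \<open>A i\<close> at h e_i and d = h - \<eta>. This is linear in x up to order d^2; since d <= h
  and p >= c h, the deviation of V(x) from x V(1) is of order h. The claim is the limit h ->
  0.\<close>

lemma mean_T_linear:
  assumes i: "i \<in> {1..N}" and x: "0 \<le> x"
  shows "(\<integral>\<omega>. T i x \<omega> \<partial>M) = x * (\<integral>\<omega>. T i 1 \<omega> \<partial>M)"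
proof -
  let ?u = "\<lambda>n. hseq n *\<^sub>R axis (q i) 1 :: real ^ 'n"
  obtain c where c: "0 < c" and ev: "\<forall>\<^sub>F n in sequentially. \<phi>A i (?u n) \<le> - c * hseq n \<and> \<eta> i (?u n) \<le> hseq n"
    using exponents_small[OF i] by auto
  have u: "0 \<le> ?u n" for n using hseq by (intro axis_nonneg) auto
  let ?v = "\<lambda>x n. enn2real (V i (?u n) x)"
  have "(\<lambda>n. ?v x n - x * ?v 1 n) \<longlonglongrightarrow> 0"
  proof (rule Lim_null_comparison)
    show "(\<lambda>n. (x\<^sup>2 + x) / c * hseq n) \<longlonglongrightarrow> 0"
      using tendsto_mult[OF tendsto_const hseq_lim, of "(x\<^sup>2 + x) / c"] by simp
    \<comment> \<open>Keeps both d and x d at most 1, the range in which the second-order bound for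
      exp holds.\<close>
    have "\<forall>\<^sub>F n in sequentially. hseq n < 1 / (1 + x)" using x by (intro eventually_hseq_less) simp
    with ev show "\<forall>\<^sub>F n in sequentially. norm (?v x n - x * ?v 1 n) \<le> (x\<^sup>2 + x) / c * hseq n"
    proof eventually_elim
      case (elim n)
      define d where "d = hseq n - \<eta> i (?u n)"
      define p where "p = - \<phi>A i (?u n)"
      have d: "0 \<le> d" "d \<le> hseq n"
        using elim subordinator_exponentD(1)[OF subordinator_exponent_\<eta>[OF i] u] by (auto simp: d_def)
      have p: "c * hseq n \<le> p" "0 < p" using elim(1) mult_pos_pos[OF c hseq(1)[of n]] unfolding p_def by linarith+
      have pv: "p * ?v y n = exp (y * d) - 1" if "0 \<le> y" for y
        using V_eq[OF i that u, of n] by (simp add: p_def d_def algebra_simps)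
      have h: "hseq n * (1 + x) \<le> 1" using elim x by (simp add: field_simps)
      have "d * (1 + x) \<le> hseq n * (1 + x)" using d x by (intro mult_right_mono) auto
      then have dx: "d + x * d \<le> 1" using h by (simp add: algebra_simps)
      have xd: "0 \<le> x * d" using x d by simp
      have "\<bar>p * (?v x n - x * ?v 1 n)\<bar> = \<bar>(exp (x * d) - 1 - x * d) - x * (exp d - 1 - d)\<bar>"
      proof -
        have "p * (?v x n - x * ?v 1 n) = p * ?v x n - x * (p * ?v 1 n)" by (simp add: algebra_simps)
        also have "\<dots> = (exp (x * d) - 1 - x * d) - x * (exp d - 1 - d)"
          unfolding pv[OF x] pv[OF zero_le_one] by (simp add: algebra_simps)
        finally show ?thesis by simp
      qed
      also have "\<dots> \<le> \<bar>exp (x * d) - 1 - x * d\<bar> + x * \<bar>exp d - 1 - d\<bar>"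
        using abs_triangle_ineq4[of "exp (x * d) - 1 - x * d" "x * (exp d - 1 - d)"] x by (simp add: abs_mult)
      also have "\<dots> \<le> (x * d)\<^sup>2 + x * d\<^sup>2"
      proof (intro add_mono mult_left_mono exp_second_order)
        show "d \<le> 1" using d hseq(2)[of n] by linarith
        show "x * d \<le> 1" using dx d by linarith
      qed (use x d xd in auto)
      also have "\<dots> = (x\<^sup>2 + x) * d\<^sup>2" by (simp add: power_mult_distrib distrib_right)
      also have "\<dots> \<le> (x\<^sup>2 + x) * (hseq n)\<^sup>2" using d x by (intro mult_left_mono power_mono) auto
      also have "\<dots> = (x\<^sup>2 + x) / c * hseq n * (c * hseq n)" using c by (simp add: power2_eq_square)
      also have "\<dots> \<le> (x\<^sup>2 + x) / c * hseq n * p" using p x c hseq[of n] by (intro mult_left_mono) auto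
      finally have "p * \<bar>?v x n - x * ?v 1 n\<bar> \<le> p * ((x\<^sup>2 + x) / c * hseq n)"
        using p by (simp add: abs_mult mult.commute)
      then show ?case using p by (simp only: real_norm_def mult_le_cancel_left_pos)
    qed
  qed
  moreover have "(\<lambda>n. ?v x n - x * ?v 1 n) \<longlonglongrightarrow> (\<integral>\<omega>. T i x \<omega> \<partial>M) - x * (\<integral>\<omega>. T i 1 \<omega> \<partial>M)"
    by (rule tendsto_diff[OF V_limit[OF i x] tendsto_mult[OF tendsto_const V_limit[OF i zero_le_one]]])
  ultimately have "(\<integral>\<omega>. T i x \<omega> \<partial>M) - x * (\<integral>\<omega>. T i 1 \<omega> \<partial>M) = 0"
    using LIMSEQ_unique by blast
  then show ?thesis by simp
qed

lemma mean_T_nonneg: "0 \<le> (\<integral>\<omega>. T i x \<omega> \<partial>M)"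
  by (intro integral_nonneg_AE) (simp add: T_nonneg)

text \<open>Along an axis other than that of the visited queue, the net input is just the input
  \<open>W\<close>, so the two exponents coincide. Moreover u_i = 0, and therefore the integrated
  visit transform is at most the mean visit time.\<close>

lemma \<eta>_off_diagonal:
  assumes i: "i \<in> {1..N}" and k: "k \<noteq> q i" and h: "0 \<le> h"
  shows "1 - exp (- \<eta> i (h *\<^sub>R axis k 1)) \<le> \<phi> (h *\<^sub>R axis k 1) * (\<integral>\<omega>. T i 1 \<omega> \<partial>M)"
proof -
  let ?u = "h *\<^sub>R axis k 1 :: real ^ 'n"
  have u: "0 \<le> ?u" using h by (rule axis_nonneg)
  have "lst M (net_input i 1) ?u = lst M (W 1) ?u"
    using k by (simp add: lst_def inner_axis' net_input_def vec_upd_def)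
  then have "exp (- \<phi>A i ?u) = exp (- \<phi> ?u)"
    using laplace_exponent_1[OF \<phi>A[rule_format, OF i] u] laplace_exponent_1[OF \<phi> u] by simp
  then have eq: "\<phi>A i ?u = \<phi> ?u" by simp
  have ui: "?u $ q i = 0" using k by (simp add: axis_def)
  have "\<phi> ?u * enn2real (V i ?u 1) = 1 - exp (- \<eta> i ?u)"
    using V_eq[OF i zero_le_one u] unfolding eq ui by simp
  moreover have "enn2real (V i ?u 1) \<le> (\<integral>\<omega>. T i 1 \<omega> \<partial>M)"
    using V_le[OF i zero_le_one u] mean_T_nonneg[of i 1] ui
    by (intro enn2real_leI) auto
  ultimately show ?thesis
    using subordinator_exponentD(1)[OF subordinator_exponent_\<phi> u]
    by (metis mult_left_mono)
qed

section \<open>Linear bounds for the input and branching exponents\<close>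

lemma S_tail: "i \<in> {1..N} \<Longrightarrow> \<exists>\<epsilon>>0. 0 < prob {\<omega> \<in> space M. \<epsilon> < S i \<omega>}"
proof (rule ccontr)
  assume i: "i \<in> {1..N}" and "\<not> (\<exists>\<epsilon>>0. 0 < prob {\<omega> \<in> space M. \<epsilon> < S i \<omega>})"
  then have z: "prob {\<omega> \<in> space M. \<epsilon> < S i \<omega>} = 0" if "0 < \<epsilon>" for \<epsilon>
    using that by (metis less_eq_real_def measure_nonneg)
  have [measurable]: "S i \<in> borel_measurable M" using S i by auto
  have "AE \<omega> in M. \<not> hseq n < S i \<omega>" for n
    using z[OF hseq(1)[of n]] by (intro AE_iff_measurable[THEN iffD2, OF _ refl]) (auto simp: emeasure_eq_measure)
  then have "AE \<omega> in M. \<forall>n. \<not> hseq n < S i \<omega>" by (simp add: AE_all_countable)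
  moreover have "AE \<omega> in M. 0 < S i \<omega>" using S i by auto
  ultimately have "AE \<omega> in M. False"
  proof eventually_elim
    case (elim \<omega>)
    then show ?case using eventually_hseq_less[OF elim(2)] by (auto simp: eventually_sequentially)
  qed
  then show False by simp
qed

lemma lst_S:
  assumes i: "i \<in> {1..N}" and \<theta>: "0 \<le> \<theta>"
  shows "integrable M (\<lambda>\<omega>. exp (- (\<theta> * S i \<omega>)))" "0 < lst M (S i) \<theta>" "lst M (S i) \<theta> \<le> 1"
    "1 - lst M (S i) \<theta> \<le> \<theta> * (\<integral>\<omega>. S i \<omega> \<partial>M)"
proof -
  have [measurable]: "S i \<in> borel_measurable M" using S i by auto
  have pos: "AE \<omega> in M. 0 < S i \<omega>" using S i by auto
  have le: "AE \<omega> in M. exp (- (\<theta> * S i \<omega>)) \<le> 1"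
    using pos by eventually_elim (simp add: \<theta>)
  show int: "integrable M (\<lambda>\<omega>. exp (- (\<theta> * S i \<omega>)))"
    by (rule integrable_const_bound[where B=1]) (use le in auto)
  have "lst M (S i) \<theta> \<le> (\<integral>\<omega>. 1 \<partial>M)" unfolding lst_def using int le by (intro integral_mono_AE) auto
  then show "lst M (S i) \<theta> \<le> 1" by (simp add: prob_space)
  have iS: "integrable M (S i)" using ES i by auto
  have "1 - lst M (S i) \<theta> = (\<integral>\<omega>. 1 - exp (- (\<theta> * S i \<omega>)) \<partial>M)" using int by (simp add: lst_def prob_space)
  also have "\<dots> \<le> (\<integral>\<omega>. \<theta> * S i \<omega> \<partial>M)"
  proof (intro integral_mono)
    fix \<omega> show "1 - exp (- (\<theta> * S i \<omega>)) \<le> \<theta> * S i \<omega>"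
      using exp_ge_add_one_self[of "- (\<theta> * S i \<omega>)"] by linarith
  qed (use int iS in auto)
  finally show "1 - lst M (S i) \<theta> \<le> \<theta> * (\<integral>\<omega>. S i \<omega> \<partial>M)" by simp
  have "0 \<le> lst M (S i) \<theta>" unfolding lst_def by (intro integral_nonneg_AE) auto
  moreover have "lst M (S i) \<theta> \<noteq> 0"
  proof
    assume "lst M (S i) \<theta> = 0"
    then have "AE \<omega> in M. exp (- (\<theta> * S i \<omega>)) = 0"
      unfolding lst_def using integral_nonneg_eq_0_iff_AE[OF int] by auto
    then have "AE \<omega> in M. False" by eventually_elim auto
    then show False by simp
  qed
  ultimately show "0 < lst M (S i) \<theta>" by simp
qed

lemma kappa_tail_N: "kappa_tail q \<eta> N u = u"
  using q by (simp add: kappa_tail_def bij_betw_def Finite_Cartesian_Product.vec_eq_iff)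

text \<open>All factors are at most 1, and the last one is singled out because its argument is u
  itself: no coordinate has been replaced after queue N. This exposes \<phi>(u) to bounds on the
  immigration.\<close>

lemma immigration_lst_bounds:
  assumes u: "0 \<le> u"
  shows "0 < immigration_lst M q S \<phi> \<eta> u" "immigration_lst M q S \<phi> \<eta> u \<le> lst M (S N) (\<phi> u)"
proof -
  have \<theta>: "0 \<le> \<phi> (kappa_tail q \<eta> i u)" for i
    using u subordinator_exponent_\<eta>
    by (intro subordinator_exponentD(1)[OF subordinator_exponent_\<phi>] kappa_tail_nonneg) (auto simp: N)
  let ?f = "\<lambda>i. lst M (S i) (\<phi> (kappa_tail q \<eta> i u))"
  have f: "0 < ?f i" "?f i \<le> 1" if "i \<in> {1..N}" for i
    using lst_S[OF that \<theta>] by auto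
  show "0 < immigration_lst M q S \<phi> \<eta> u"
    unfolding immigration_lst_def N[symmetric] using f by (intro prod_pos) auto
  have "N \<in> {1..N}" by (auto simp: N Suc_le_eq)
  then have "(\<Prod>i=1..N. ?f i) = ?f N * prod ?f ({1..N} - {N})"
    by (subst prod.remove[of _ N]) auto
  also have "\<dots> \<le> ?f N * 1"
    using f \<open>N \<in> {1..N}\<close> by (intro mult_left_mono prod_le_1) (auto intro: less_imp_le)
  finally show "immigration_lst M q S \<phi> \<eta> u \<le> lst M (S N) (\<phi> u)"
    unfolding immigration_lst_def N[symmetric] by (simp add: kappa_tail_N)
qed

text \<open>Switch-over input is part of the immigration, so a finite mean of the latter forces a finite
  mean input rate.\<close>

lemma \<phi>_linear_bound:
  assumes g: "0 \<le> g" "\<And>u. 0 \<le> u \<Longrightarrow> 1 - immigration_lst M q S \<phi> \<eta> u \<le> total u * g"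
  shows "\<exists>c\<ge>0. \<forall>u\<ge>0. \<phi> u \<le> c * total u"
proof (rule subordinator_exponent_linear_bound[OF subordinator_exponent_\<phi>])
  fix k
  have NN: "N \<in> {1..N}" by (auto simp: N Suc_le_eq)
  obtain \<epsilon> where \<epsilon>: "0 < \<epsilon>" "0 < prob {\<omega> \<in> space M. \<epsilon> < S N \<omega>}" using S_tail[OF NN] by auto
  define p where "p = prob {\<omega> \<in> space M. \<epsilon> < S N \<omega>}"
  have p: "0 < p" using \<epsilon> by (simp add: p_def)
  have [measurable]: "S N \<in> borel_measurable M" using S NN by auto
  \<comment> \<open>Only the event that the switch-over time exceeds \<epsilon> is kept; it has
    positive probability p.\<close>
  have tail: "p * (1 - exp (- (\<epsilon> * \<theta>))) \<le> 1 - lst M (S N) \<theta>" if \<theta>: "0 \<le> \<theta>" for \<theta>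
  proof -
    have "p * (1 - exp (- (\<epsilon> * \<theta>))) = (\<integral>\<omega>. indicator {\<omega> \<in> space M. \<epsilon> < S N \<omega>} \<omega> * (1 - exp (- (\<epsilon> * \<theta>))) \<partial>M)"
      by (simp add: p_def)
    also have "\<dots> \<le> (\<integral>\<omega>. 1 - exp (- (\<theta> * S N \<omega>)) \<partial>M)"
    proof (rule integral_mono_AE)
      have "AE \<omega> in M. 0 < S N \<omega>" using S NN by auto
      then show "AE \<omega> in M. indicator {\<omega> \<in> space M. \<epsilon> < S N \<omega>} \<omega> * (1 - exp (- (\<epsilon> * \<theta>))) \<le> 1 - exp (- (\<theta> * S N \<omega>))"
        by eventually_elim (use \<theta> \<epsilon> in \<open>auto simp: indicator_def mult.commute[of \<epsilon>] intro!: mult_left_mono\<close>)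
    qed (use lst_S(1)[OF NN \<theta>] in \<open>auto intro!: integrable_mult_left integrable_real_indicator simp: emeasure_eq_measure\<close>)
    also have "\<dots> = 1 - lst M (S N) \<theta>" using lst_S(1)[OF NN \<theta>] by (simp add: lst_def prob_space)
    finally show ?thesis .
  qed
  have "\<forall>\<^sub>F n in sequentially. \<phi> (hseq n *\<^sub>R axis k 1) \<le> 2 * (g / p) / \<epsilon> * hseq n"
  \<comment> \<open>The threshold ensures h g / p <= 1/2, as
    \<open>le_twice_of_one_minus_exp\<close> demands; g + 1 replaces g to avoid division by
    0.\<close>
  proof (rule eventually_mono[OF eventually_hseq_less[of "p / (2 * (g + 1))"]])
    show "0 < p / (2 * (g + 1))" using p g by simp
    fix n assume n: "hseq n < p / (2 * (g + 1))"
    let ?u = "hseq n *\<^sub>R axis k 1 :: real ^ 'n"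
    have u: "0 \<le> ?u" using hseq[of n] by (intro axis_nonneg) auto
    have \<theta>: "0 \<le> \<phi> ?u" by (rule subordinator_exponentD(1)[OF subordinator_exponent_\<phi> u])
    have tot: "total ?u = hseq n" by (simp add: axis_def if_distrib cong: if_cong)
    have "p * (1 - exp (- (\<epsilon> * \<phi> ?u))) \<le> 1 - lst M (S N) (\<phi> ?u)" by (rule tail[OF \<theta>])
    also have "\<dots> \<le> hseq n * g" using g(2)[OF u] immigration_lst_bounds(2)[OF u] tot by simp
    finally have "1 - exp (- (\<epsilon> * \<phi> ?u)) \<le> hseq n * g / p" using p by (simp add: field_simps)
    moreover have "hseq n * g / p \<le> 1 / 2"
    proof -
      have "hseq n * g \<le> hseq n * (g + 1)" using hseq[of n] by simp
      also have "\<dots> \<le> p / 2" using n g by (simp add: field_simps)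
      finally show ?thesis using p by (simp add: field_simps)
    qed
    ultimately have "\<epsilon> * \<phi> ?u \<le> 2 * (hseq n * g / p)"
      using \<epsilon> \<theta> by (intro le_twice_of_one_minus_exp) auto
    then have "\<phi> ?u \<le> 2 * (hseq n * g / p) / \<epsilon>" using \<epsilon>(1) by (simp only: pos_le_divide_eq mult.commute)
    then show "\<phi> ?u \<le> 2 * (g / p) / \<epsilon> * hseq n" by (simp add: ac_simps)
  qed
  then show "\<exists>c. \<forall>\<^sub>F n in sequentially. \<phi> (hseq n *\<^sub>R axis k 1) \<le> c * hseq n" by blast
qed

text \<open>On the axis of queue i the drift gives the constant 1. On the other axes work only
  arrives through \<open>W\<close>, and the bound on \<phi> is multiplied by the mean visit
  time.\<close>

lemma \<eta>_linear_bound: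
  assumes i: "i \<in> {1..N}" and \<phi>_bound: "\<exists>c\<ge>0. \<forall>u\<ge>0. \<phi> u \<le> c * total u"
  shows "\<exists>c\<ge>0. \<forall>u\<ge>0. \<eta> i u \<le> c * total u"
proof (rule subordinator_exponent_linear_bound[OF subordinator_exponent_\<eta>[OF i]])
  fix k
  show "\<exists>c. \<forall>\<^sub>F n in sequentially. \<eta> i (hseq n *\<^sub>R axis k 1) \<le> c * hseq n"
  proof (cases "k = q i")
    case True
    obtain c where "\<forall>\<^sub>F n in sequentially. \<phi>A i (hseq n *\<^sub>R axis (q i) 1) \<le> - c * hseq n
        \<and> \<eta> i (hseq n *\<^sub>R axis (q i) 1) \<le> hseq n" using exponents_small[OF i] by auto
    then show ?thesis unfolding True by (intro exI[of _ 1]) (auto elim: eventually_mono)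
  next
    case False
    obtain c where c: "0 \<le> c" "\<And>u. 0 \<le> u \<Longrightarrow> \<phi> u \<le> c * total u" using \<phi>_bound by auto
    define t where "t = c * (\<integral>\<omega>. T i 1 \<omega> \<partial>M)"
    have t: "0 \<le> t" using c mean_T_nonneg by (simp add: t_def)
    have "\<forall>\<^sub>F n in sequentially. \<eta> i (hseq n *\<^sub>R axis k 1) \<le> 2 * t * hseq n"
    proof (rule eventually_mono[OF eventually_hseq_less[of "1 / (2 * (t + 1))"]])
      show "0 < 1 / (2 * (t + 1))" using t by simp
      fix n assume n: "hseq n < 1 / (2 * (t + 1))"
      let ?u = "hseq n *\<^sub>R axis k 1 :: real ^ 'n"
      have u: "0 \<le> ?u" using hseq[of n] by (intro axis_nonneg) auto
      have tot: "total ?u = hseq n" by (simp add: axis_def if_distrib cong: if_cong)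
      have "1 - exp (- \<eta> i ?u) \<le> \<phi> ?u * (\<integral>\<omega>. T i 1 \<omega> \<partial>M)"
        using hseq[of n] by (intro \<eta>_off_diagonal[OF i False]) auto
      also have "\<dots> \<le> c * hseq n * (\<integral>\<omega>. T i 1 \<omega> \<partial>M)"
        using c(2)[OF u] tot by (intro mult_right_mono mean_T_nonneg) simp
      finally have "1 - exp (- \<eta> i ?u) \<le> t * hseq n" by (simp add: t_def ac_simps)
      moreover have "t * hseq n \<le> 1 / 2"
      proof -
        have "t * hseq n \<le> (t + 1) * hseq n" using hseq[of n] by simp
        also have "\<dots> \<le> 1 / 2" using n t by (simp add: field_simps)
        finally show ?thesis .
      qed
      ultimately have "\<eta> i ?u \<le> 2 * (t * hseq n)"
        using subordinator_exponentD(1)[OF subordinator_exponent_\<eta>[OF i] u]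
        by (intro le_twice_of_one_minus_exp) auto
      then show "\<eta> i ?u \<le> 2 * t * hseq n" by simp
    qed
    then show ?thesis by blast
  qed
qed

end

section \<open>Independent copies\<close>

text \<open>\<open>Y\<close> has been computed without looking at the copies \<open>\<xi> k\<close>, \<open>k \<in> J\<close>.\<close>

definition fresh :: "'p measure \<Rightarrow> 'a measure \<Rightarrow> ('k \<Rightarrow> 'p \<Rightarrow> 'a) \<Rightarrow> 'k set \<Rightarrow> 'b measure \<Rightarrow> ('p \<Rightarrow> 'b) \<Rightarrow> bool" where
  "fresh P M \<xi> J K Y \<longleftrightarrow> Y \<in> measurable P K \<and>
     distr P (K \<Otimes>\<^sub>M PiM J (\<lambda>_. M)) (\<lambda>\<omega>. (Y \<omega>, \<lambda>k\<in>J. \<xi> k \<omega>)) = distr P K Y \<Otimes>\<^sub>M PiM J (\<lambda>_. M)"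

locale independent_copies = prob_space P for P :: "'p measure" +
  fixes M :: "'a measure" and \<xi> :: "'k \<Rightarrow> 'p \<Rightarrow> 'a" and I :: "'k set"
  assumes prob_M: "prob_space M"
    and copies: "\<And>k. k \<in> I \<Longrightarrow> \<xi> k \<in> measurable P M" "\<And>k. k \<in> I \<Longrightarrow> distr P M (\<xi> k) = M"
    and indep: "indep_vars (\<lambda>_. M) \<xi> I"
begin

lemma measurable_copies: "J \<subseteq> I \<Longrightarrow> (\<lambda>\<omega>. \<lambda>k\<in>J. \<xi> k \<omega>) \<in> measurable P (PiM J (\<lambda>_. M))"
  using copies by (intro measurable_restrict) auto

text \<open>Merges independence of \<open>Y\<close> from the whole family with mutual independence
  inside the family into one product law, the form in which copies can be consumed one at a
  time.\<close>

lemma freshI: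
  assumes I: "I \<noteq> {}" and Y: "indep_rv P K Y (PiM I (\<lambda>_. M)) (\<lambda>\<omega>. \<lambda>k\<in>I. \<xi> k \<omega>)"
  shows "fresh P M \<xi> I K Y"
proof -
  have [measurable]: "Y \<in> measurable P K" "(\<lambda>\<omega>. \<lambda>k\<in>I. \<xi> k \<omega>) \<in> measurable P (PiM I (\<lambda>_. M))"
    using Y by (auto simp: indep_rv_def)
  have "distr P (PiM I (\<lambda>_. M)) (\<lambda>\<omega>. \<lambda>k\<in>I. \<xi> k \<omega>) = PiM I (\<lambda>k. distr P M (\<xi> k))"
    using indep_vars_iff_distr_eq_PiM'[OF I, where M' = "\<lambda>_. M" and X = \<xi>] copies indep by auto
  also have "\<dots> = PiM I (\<lambda>_. M)" by (intro PiM_cong) (auto simp: copies)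
  finally have D: "distr P (PiM I (\<lambda>_. M)) (\<lambda>\<omega>. \<lambda>k\<in>I. \<xi> k \<omega>) = PiM I (\<lambda>_. M)" .
  interpret D: prob_space "distr P K Y" by (rule prob_space_distr) simp
  interpret Q: prob_space "PiM I (\<lambda>_. M)" using prob_M by (intro prob_space_PiM)
  have "distr P K Y \<Otimes>\<^sub>M PiM I (\<lambda>_. M) = distr P (K \<Otimes>\<^sub>M PiM I (\<lambda>_. M)) (\<lambda>\<omega>. (Y \<omega>, \<lambda>k\<in>I. \<xi> k \<omega>))"
  proof (rule pair_measure_eqI[OF D.sigma_finite_measure_axioms Q.sigma_finite_measure_axioms])
    show "sets (distr P K Y \<Otimes>\<^sub>M PiM I (\<lambda>_. M)) = sets (distr P (K \<Otimes>\<^sub>M PiM I (\<lambda>_. M)) (\<lambda>\<omega>. (Y \<omega>, \<lambda>k\<in>I. \<xi> k \<omega>)))"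
      unfolding sets_distr by (intro sets_pair_measure_cong sets_distr refl)
    fix A B assume A: "A \<in> sets (distr P K Y)" and B: "B \<in> sets (PiM I (\<lambda>_. M))"
    have [measurable]: "A \<in> sets K" using A by simp
    note [measurable] = B
    let ?E = "Y -` A \<inter> space P" and ?F = "(\<lambda>\<omega>. \<lambda>k\<in>I. \<xi> k \<omega>) -` B \<inter> space P"
    have "emeasure (distr P K Y) A * emeasure (PiM I (\<lambda>_. M)) B = emeasure P ?E * emeasure P ?F"
      by (subst D[symmetric]) (simp add: emeasure_distr)
    also have "\<dots> = emeasure P (?E \<inter> ?F)"
    proof -
      have "prob (?E \<inter> ?F) = prob ?E * prob ?F"
        using Y A B unfolding indep_rv_def by (intro indep_setD) auto
      then show ?thesis by (simp add: emeasure_eq_measure ennreal_mult')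
    qed
    also have "?E \<inter> ?F = (\<lambda>\<omega>. (Y \<omega>, \<lambda>k\<in>I. \<xi> k \<omega>)) -` (A \<times> B) \<inter> space P" by auto
    also have "emeasure P \<dots> = emeasure (distr P (K \<Otimes>\<^sub>M PiM I (\<lambda>_. M)) (\<lambda>\<omega>. (Y \<omega>, \<lambda>k\<in>I. \<xi> k \<omega>))) (A \<times> B)"
      by (subst emeasure_distr) auto
    finally show "emeasure (distr P K Y) A * emeasure (PiM I (\<lambda>_. M)) B
      = emeasure (distr P (K \<Otimes>\<^sub>M PiM I (\<lambda>_. M)) (\<lambda>\<omega>. (Y \<omega>, \<lambda>k\<in>I. \<xi> k \<omega>))) (A \<times> B)" .
  qed
  then show ?thesis by (simp add: fresh_def)
qed

lemma fresh_compose: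
  assumes Y: "fresh P M \<xi> J K Y" and J: "J \<subseteq> I" and g: "g \<in> measurable K L"
  shows "fresh P M \<xi> J L (\<lambda>\<omega>. g (Y \<omega>))"
proof -
  let ?Q = "PiM J (\<lambda>_. M)"
  have [measurable]: "Y \<in> measurable P K" "(\<lambda>\<omega>. \<lambda>k\<in>J. \<xi> k \<omega>) \<in> measurable P ?Q" "g \<in> measurable K L"
    using Y g measurable_copies[OF J] by (auto simp: fresh_def)
  interpret Q: prob_space ?Q using prob_M by (intro prob_space_PiM)
  have "distr P (L \<Otimes>\<^sub>M ?Q) (\<lambda>\<omega>. (g (Y \<omega>), \<lambda>k\<in>J. \<xi> k \<omega>))
      = distr (distr P (K \<Otimes>\<^sub>M ?Q) (\<lambda>\<omega>. (Y \<omega>, \<lambda>k\<in>J. \<xi> k \<omega>))) (L \<Otimes>\<^sub>M ?Q) (\<lambda>(y, f). (g y, f))"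
    by (subst distr_distr) (auto simp: o_def)
  also have "\<dots> = distr (distr P K Y \<Otimes>\<^sub>M ?Q) (L \<Otimes>\<^sub>M ?Q) (\<lambda>(y, f). (g y, f))"
    using Y by (simp add: fresh_def)
  also have "\<dots> = distr (distr P K Y) L g \<Otimes>\<^sub>M distr ?Q ?Q (\<lambda>f. f)"
    by (rule pair_measure_distr[symmetric]) (auto simp: distr_id2 Q.sigma_finite_measure_axioms)
  also have "\<dots> = distr P L (\<lambda>\<omega>. g (Y \<omega>)) \<Otimes>\<^sub>M ?Q" by (simp add: distr_distr o_def distr_id2)
  finally show ?thesis by (simp add: fresh_def)
qed

lemma fresh_step:
  assumes Y: "fresh P M \<xi> J K Y" and J: "J \<subseteq> I" and j: "j \<in> J"
  shows "fresh P M \<xi> (J - {j}) (K \<Otimes>\<^sub>M M) (\<lambda>\<omega>. (Y \<omega>, \<xi> j \<omega>))"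
    and "distr P (K \<Otimes>\<^sub>M M) (\<lambda>\<omega>. (Y \<omega>, \<xi> j \<omega>)) = distr P K Y \<Otimes>\<^sub>M M"
proof -
  let ?Q = "PiM J (\<lambda>_. M)" and ?Q' = "PiM (J - {j}) (\<lambda>_. M)"
  let ?D = "distr P K Y"
  have [measurable]: "Y \<in> measurable P K" "(\<lambda>\<omega>. \<lambda>k\<in>J. \<xi> k \<omega>) \<in> measurable P ?Q" "\<xi> j \<in> measurable P M"
      "(\<lambda>\<omega>. \<lambda>k\<in>J - {j}. \<xi> k \<omega>) \<in> measurable P ?Q'"
    using Y j J copies measurable_copies[OF J] measurable_copies[of "J - {j}"] by (auto simp: fresh_def)
  have \<xi>m: "\<xi> j \<in> measurable P M" and rm': "(\<lambda>\<omega>. \<lambda>k\<in>J - {j}. \<xi> k \<omega>) \<in> measurable P ?Q'" by measurable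
  have Ym: "Y \<in> measurable P K" and rm: "(\<lambda>\<omega>. \<lambda>k\<in>J. \<xi> k \<omega>) \<in> measurable P ?Q" by measurable
  interpret M: prob_space M by (rule prob_M)
  interpret D: prob_space ?D by (rule prob_space_distr) simp
  interpret Q: prob_space ?Q using prob_M by (intro prob_space_PiM)
  interpret Q': prob_space ?Q' using prob_M by (intro prob_space_PiM)
  interpret MQ: pair_prob_space M ?Q' ..
  interpret DM: pair_prob_space ?D M ..
  interpret DMQ: pair_prob_space ?D "M \<Otimes>\<^sub>M ?Q'" ..
  have ins: "insert j (J - {j}) = J" using j by auto
  have upd [measurable]: "(\<lambda>(x, f). f(j := x)) \<in> measurable (M \<Otimes>\<^sub>M ?Q') ?Q"
    using measurable_add_dim[of j "J - {j}" "\<lambda>_. M"] ins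
    by (subst (asm) measurable_pair_swap_iff) (simp add: case_prod_beta')
  have Q_eq: "distr (M \<Otimes>\<^sub>M ?Q') ?Q (\<lambda>(x, f). f(j := x)) = ?Q"
    using distr_pair_PiM_eq_PiM[of "J - {j}" "\<lambda>_. M" j] prob_M unfolding ins by simp
  have DQ: "distr (?D \<Otimes>\<^sub>M (M \<Otimes>\<^sub>M ?Q')) (K \<Otimes>\<^sub>M ?Q) (\<lambda>(y, p). (y, (\<lambda>(x, f). f(j := x)) p)) = ?D \<Otimes>\<^sub>M ?Q"
  proof -
    have "distr ?D K (\<lambda>y. y) \<Otimes>\<^sub>M distr (M \<Otimes>\<^sub>M ?Q') ?Q (\<lambda>(x, f). f(j := x))
      = distr (?D \<Otimes>\<^sub>M (M \<Otimes>\<^sub>M ?Q')) (K \<Otimes>\<^sub>M ?Q) (\<lambda>(y, p). (y, (\<lambda>(x, f). f(j := x)) p))"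
      by (rule pair_measure_distr) (auto simp: Q_eq Q.sigma_finite_measure_axioms)
    then show ?thesis by (simp add: Q_eq distr_id2)
  qed
  have proj [measurable]: "(\<lambda>(y, f). ((y, f j), restrict f (J - {j}))) \<in> measurable (K \<Otimes>\<^sub>M ?Q) ((K \<Otimes>\<^sub>M M) \<Otimes>\<^sub>M ?Q')"
  proof -
    have "(\<lambda>p. snd p j) \<in> measurable (K \<Otimes>\<^sub>M ?Q) M"
      by (rule measurable_compose[OF measurable_snd measurable_component_singleton[OF j]])
    moreover have "(\<lambda>p. restrict (snd p) (J - {j})) \<in> measurable (K \<Otimes>\<^sub>M ?Q) ?Q'"
      by (rule measurable_compose[OF measurable_snd measurable_restrict_subset]) auto
    ultimately show ?thesis unfolding case_prod_beta' by measurable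
  qed
  have joint: "distr P ((K \<Otimes>\<^sub>M M) \<Otimes>\<^sub>M ?Q') (\<lambda>\<omega>. ((Y \<omega>, \<xi> j \<omega>), \<lambda>k\<in>J - {j}. \<xi> k \<omega>)) = (?D \<Otimes>\<^sub>M M) \<Otimes>\<^sub>M ?Q'"
  proof -
    have "distr P ((K \<Otimes>\<^sub>M M) \<Otimes>\<^sub>M ?Q') (\<lambda>\<omega>. ((Y \<omega>, \<xi> j \<omega>), \<lambda>k\<in>J - {j}. \<xi> k \<omega>))
      = distr (distr P (K \<Otimes>\<^sub>M ?Q) (\<lambda>\<omega>. (Y \<omega>, \<lambda>k\<in>J. \<xi> k \<omega>))) ((K \<Otimes>\<^sub>M M) \<Otimes>\<^sub>M ?Q') (\<lambda>(y, f). ((y, f j), restrict f (J - {j})))"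
    proof -
      have map: "(\<lambda>(y, f). ((y, f j), restrict f (J - {j}))) \<circ> (\<lambda>\<omega>. (Y \<omega>, \<lambda>k\<in>J. \<xi> k \<omega>))
          = (\<lambda>\<omega>. ((Y \<omega>, \<xi> j \<omega>), \<lambda>k\<in>J - {j}. \<xi> k \<omega>))"
      proof (rule ext)
        fix \<omega>
        have "restrict (\<lambda>k\<in>J. \<xi> k \<omega>) (J - {j}) = (\<lambda>k\<in>J - {j}. \<xi> k \<omega>)" by (rule ext) simp
        then show "((\<lambda>(y, f). ((y, f j), restrict f (J - {j}))) \<circ> (\<lambda>\<omega>. (Y \<omega>, \<lambda>k\<in>J. \<xi> k \<omega>))) \<omega>
          = ((Y \<omega>, \<xi> j \<omega>), \<lambda>k\<in>J - {j}. \<xi> k \<omega>)" using j by simp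
      qed
      show ?thesis by (subst distr_distr[OF proj]) (use measurable_Pair[OF Ym rm] in \<open>simp_all only: map\<close>)
    qed
    also have "\<dots> = distr (?D \<Otimes>\<^sub>M ?Q) ((K \<Otimes>\<^sub>M M) \<Otimes>\<^sub>M ?Q') (\<lambda>(y, f). ((y, f j), restrict f (J - {j})))"
      using Y by (simp add: fresh_def)
    also have "\<dots> = distr (?D \<Otimes>\<^sub>M (M \<Otimes>\<^sub>M ?Q')) ((K \<Otimes>\<^sub>M M) \<Otimes>\<^sub>M ?Q') (\<lambda>(y, x, f). ((y, x), restrict (f(j := x)) (J - {j})))"
      unfolding DQ[symmetric]
    proof (subst distr_distr[OF proj])
      show "(\<lambda>(y, p). (y, (\<lambda>(x, f). f(j := x)) p)) \<in> measurable (?D \<Otimes>\<^sub>M (M \<Otimes>\<^sub>M ?Q')) (K \<Otimes>\<^sub>M ?Q)"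
        using measurable_compose[OF measurable_snd upd] by (auto simp: case_prod_beta')
    qed (simp add: o_def case_prod_beta')
    also have "\<dots> = distr (?D \<Otimes>\<^sub>M (M \<Otimes>\<^sub>M ?Q')) ((K \<Otimes>\<^sub>M M) \<Otimes>\<^sub>M ?Q') (\<lambda>(y, x, f). ((y, x), f))"
    proof (intro distr_cong refl)
      fix p assume "p \<in> space (?D \<Otimes>\<^sub>M (M \<Otimes>\<^sub>M ?Q'))"
      then have "snd (snd p) \<in> extensional (J - {j})" by (auto simp: space_pair_measure space_PiM PiE_def)
      then have "restrict ((snd (snd p))(j := x)) (J - {j}) = snd (snd p)" for x
        by (auto simp: extensional_def fun_eq_iff)
      then show "(\<lambda>(y, x, f). ((y, x), restrict (f(j := x)) (J - {j}))) p = (\<lambda>(y, x, f). ((y, x), f)) p"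
        by (simp add: case_prod_beta')
    qed
    \<comment> \<open>Reassociation is checked on sets C x B with C an arbitrary measurable set of
      pairs; slicing at the first component factors off the measure of B.\<close>
    also have "\<dots> = (?D \<Otimes>\<^sub>M M) \<Otimes>\<^sub>M ?Q'"
    proof (rule pair_measure_eqI[OF DM.sigma_finite_measure_axioms Q'.sigma_finite_measure_axioms, symmetric])
      show "sets ((?D \<Otimes>\<^sub>M M) \<Otimes>\<^sub>M ?Q') = sets (distr (?D \<Otimes>\<^sub>M (M \<Otimes>\<^sub>M ?Q')) ((K \<Otimes>\<^sub>M M) \<Otimes>\<^sub>M ?Q') (\<lambda>(y, x, f). ((y, x), f)))"
        unfolding sets_distr by (intro sets_pair_measure_cong sets_distr refl)
      fix C B assume C: "C \<in> sets (?D \<Otimes>\<^sub>M M)" and B [measurable]: "B \<in> sets ?Q'"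
      have C' [measurable]: "C \<in> sets (K \<Otimes>\<^sub>M M)" using C by (simp cong: sets_pair_measure_cong)
      have assoc [measurable]: "(\<lambda>(y, x, f). ((y, x), f)) \<in> measurable (?D \<Otimes>\<^sub>M (M \<Otimes>\<^sub>M ?Q')) ((K \<Otimes>\<^sub>M M) \<Otimes>\<^sub>M ?Q')"
        by measurable
      let ?X = "(\<lambda>(y, x, f). ((y, x), f)) -` (C \<times> B) \<inter> space (?D \<Otimes>\<^sub>M (M \<Otimes>\<^sub>M ?Q'))"
      have X: "?X \<in> sets (?D \<Otimes>\<^sub>M (M \<Otimes>\<^sub>M ?Q'))" by (rule measurable_sets[OF assoc]) auto
      have "emeasure (distr (?D \<Otimes>\<^sub>M (M \<Otimes>\<^sub>M ?Q')) ((K \<Otimes>\<^sub>M M) \<Otimes>\<^sub>M ?Q') (\<lambda>(y, x, f). ((y, x), f))) (C \<times> B)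
        = emeasure (?D \<Otimes>\<^sub>M (M \<Otimes>\<^sub>M ?Q')) ?X"
        by (rule emeasure_distr[OF assoc]) auto
      also have "\<dots> = (\<integral>\<^sup>+y. emeasure (M \<Otimes>\<^sub>M ?Q') (Pair y -` ?X) \<partial>?D)"
        by (rule MQ.P.emeasure_pair_measure_alt[OF X])
      also have "\<dots> = (\<integral>\<^sup>+y. emeasure M (Pair y -` C) * emeasure ?Q' B \<partial>?D)"
      proof (rule nn_integral_cong)
        fix y assume y: "y \<in> space ?D"
        have "Pair y -` ?X = (Pair y -` C) \<times> B"
          using y sets.sets_into_space[OF C] sets.sets_into_space[OF B]
          by (auto simp: space_pair_measure)
        moreover have "Pair y -` C \<in> sets M" by (rule sets_Pair1[OF C])
        ultimately show "emeasure (M \<Otimes>\<^sub>M ?Q') (Pair y -` ?X) = emeasure M (Pair y -` C) * emeasure ?Q' B"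
          by (simp add: Q'.emeasure_pair_measure_Times)
      qed
      also have "\<dots> = (\<integral>\<^sup>+y. emeasure M (Pair y -` C) \<partial>?D) * emeasure ?Q' B"
        by (intro nn_integral_multc M.measurable_emeasure_Pair C)
      also have "(\<integral>\<^sup>+y. emeasure M (Pair y -` C) \<partial>?D) = emeasure (?D \<Otimes>\<^sub>M M) C"
        by (rule M.emeasure_pair_measure_alt[OF C, symmetric])
      finally show "emeasure (?D \<Otimes>\<^sub>M M) C * emeasure ?Q' B
        = emeasure (distr (?D \<Otimes>\<^sub>M (M \<Otimes>\<^sub>M ?Q')) ((K \<Otimes>\<^sub>M M) \<Otimes>\<^sub>M ?Q') (\<lambda>(y, x, f). ((y, x), f))) (C \<times> B)" ..
    qed
    finally show ?thesis .
  qed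
  show marg: "distr P (K \<Otimes>\<^sub>M M) (\<lambda>\<omega>. (Y \<omega>, \<xi> j \<omega>)) = ?D \<Otimes>\<^sub>M M"
  proof -
    have "distr P (K \<Otimes>\<^sub>M M) (\<lambda>\<omega>. (Y \<omega>, \<xi> j \<omega>))
      = distr (distr P ((K \<Otimes>\<^sub>M M) \<Otimes>\<^sub>M ?Q') (\<lambda>\<omega>. ((Y \<omega>, \<xi> j \<omega>), \<lambda>k\<in>J - {j}. \<xi> k \<omega>))) (K \<Otimes>\<^sub>M M) fst"
      by (simp only: distr_distr[OF measurable_fst measurable_Pair[OF measurable_Pair[OF Ym \<xi>m] rm']] o_def fst_conv)
    also have "\<dots> = distr ((?D \<Otimes>\<^sub>M M) \<Otimes>\<^sub>M ?Q') (K \<Otimes>\<^sub>M M) fst" by (simp only: joint)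
    also have "\<dots> = distr ((?D \<Otimes>\<^sub>M M) \<Otimes>\<^sub>M ?Q') (?D \<Otimes>\<^sub>M M) fst"
      by (rule distr_cong[OF refl _ refl], rule sets_pair_measure_cong[OF sets_distr[symmetric] refl])
    also have "\<dots> = ?D \<Otimes>\<^sub>M M" by (rule Q'.distr_pair_fst)
    finally show ?thesis .
  qed
  show "fresh P M \<xi> (J - {j}) (K \<Otimes>\<^sub>M M) (\<lambda>\<omega>. (Y \<omega>, \<xi> j \<omega>))"
    unfolding fresh_def using joint marg by simp
qed

text \<open>Plays the part of conditioning on \<open>Y\<close>: the copy is integrated out over the
  template space while \<open>Y\<close> is held fixed.\<close>

lemma nn_integral_fresh:
  assumes Y: "fresh P M \<xi> J K Y" and J: "J \<subseteq> I" and j: "j \<in> J"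
    and f: "(\<lambda>(y, a). f y a) \<in> borel_measurable (K \<Otimes>\<^sub>M M)"
  shows "(\<integral>\<^sup>+\<omega>. f (Y \<omega>) (\<xi> j \<omega>) \<partial>P) = (\<integral>\<^sup>+\<omega>. \<integral>\<^sup>+a. f (Y \<omega>) a \<partial>M \<partial>P)"
proof -
  interpret M: prob_space M by (rule prob_M)
  have [measurable]: "Y \<in> measurable P K" "\<xi> j \<in> measurable P M" using Y j J copies by (auto simp: fresh_def)
  have f' [measurable]: "(\<lambda>(y, a). f y a) \<in> borel_measurable (distr P K Y \<Otimes>\<^sub>M M)"
    using f by (simp cong: measurable_cong_sets sets_pair_measure_cong)
  have "(\<integral>\<^sup>+\<omega>. f (Y \<omega>) (\<xi> j \<omega>) \<partial>P) = (\<integral>\<^sup>+p. (\<lambda>(y, a). f y a) p \<partial>distr P (K \<Otimes>\<^sub>M M) (\<lambda>\<omega>. (Y \<omega>, \<xi> j \<omega>)))"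
    using f by (subst nn_integral_distr) auto
  also have "\<dots> = (\<integral>\<^sup>+p. (\<lambda>(y, a). f y a) p \<partial>(distr P K Y \<Otimes>\<^sub>M M))" by (simp add: fresh_step(2)[OF Y J j])
  also have "\<dots> = (\<integral>\<^sup>+y. \<integral>\<^sup>+a. f y a \<partial>M \<partial>distr P K Y)" by (subst M.nn_integral_fst[OF f', symmetric]) simp
  also have "\<dots> = (\<integral>\<^sup>+\<omega>. \<integral>\<^sup>+a. f (Y \<omega>) a \<partial>M \<partial>P)"
  proof -
    have "(\<lambda>y. \<integral>\<^sup>+a. f y a \<partial>M) \<in> borel_measurable K"
      using M.borel_measurable_nn_integral_fst[OF f] by simp
    then show ?thesis by (subst nn_integral_distr) simp_all
  qed
  finally show ?thesis .
qed

end

section \<open>One visit and one switch-over period\<close>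

lemma lst_eq_nn_integral:
  fixes X :: "'p \<Rightarrow> real ^ 'n::finite"
  assumes [measurable]: "X \<in> borel_measurable P"
  shows "lst P X u = enn2real (\<integral>\<^sup>+\<omega>. ennreal (exp (- inner u (X \<omega>))) \<partial>P)"
  unfolding lst_def by (rule integral_eq_nn_integral) auto

lemma inner_vec_upd_left: "inner (vec_upd u j a) y = inner u y + (a - u $ j) * y $ j"
  for u y :: "real ^ 'n::finite"
proof -
  have "vec_upd u j a = u + (a - u $ j) *\<^sub>R axis j 1"
    by (simp add: Finite_Cartesian_Product.vec_eq_iff vec_upd_def axis_def)
  then show ?thesis by (simp add: inner_add_left inner_axis')
qed

lemma exp_inner_add: "exp (- inner u (y + z)) = exp (- inner u y) * exp (- inner u z)"
  by (simp add: inner_add_right exp_add[symmetric])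

lemma measurable_vec_nth_borel [measurable]: "(\<lambda>x. x $ k) \<in> borel_measurable (borel :: (real ^ 'n::finite) measure)"
  by (intro borel_measurable_continuous_onI continuous_intros)

locale polling_copies = polling_template q W A S \<tau> M \<phi> \<phi>A \<F> \<eta> N
    + C: independent_copies P M \<xi> I
  for q :: "nat \<Rightarrow> 'n::finite"
    and W :: "real \<Rightarrow> 'a \<Rightarrow> real ^ 'n"
    and A :: "nat \<Rightarrow> real \<Rightarrow> 'a \<Rightarrow> real"
    and S :: "nat \<Rightarrow> 'a \<Rightarrow> real"
    and \<tau> :: "nat \<Rightarrow> real \<Rightarrow> 'a \<Rightarrow> ennreal"
    and M :: "'a measure" and \<phi> :: "real ^ 'n \<Rightarrow> real" and \<phi>A :: "nat \<Rightarrow> real ^ 'n \<Rightarrow> real"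
    and \<F> :: "nat \<Rightarrow> ennreal \<Rightarrow> 'a measure" and \<eta> :: "nat \<Rightarrow> real ^ 'n \<Rightarrow> real"
    and N :: nat
    and P :: "'p measure" and \<xi> :: "'k \<Rightarrow> 'p \<Rightarrow> 'a" and I :: "'k set"
begin

definition visit :: "nat \<Rightarrow> real ^ 'n \<Rightarrow> 'a \<Rightarrow> real ^ 'n" where
  "visit i y a = y - (y $ q i) *\<^sub>R axis (q i) 1 + R i (y $ q i) a"

lemma measurable_visit: "i \<in> {1..N} \<Longrightarrow> (\<lambda>(y, a). visit i y a) \<in> borel_measurable (borel \<Otimes>\<^sub>M M)"
proof -
  assume i: "i \<in> {1..N}"
  have "(\<lambda>p. ((fst p :: real ^ 'n) $ q i, snd p)) \<in> (borel \<Otimes>\<^sub>M M) \<rightarrow>\<^sub>M (borel \<Otimes>\<^sub>M M)"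
    by (intro measurable_Pair measurable_compose[OF measurable_fst] measurable_vec_nth_borel measurable_snd)
  from measurable_compose[OF this joint_R[OF i]]
  have [measurable]: "(\<lambda>p. R i (fst p $ q i) (snd p)) \<in> borel_measurable (borel \<Otimes>\<^sub>M M)" by simp
  have [measurable]: "(\<lambda>p. (fst p :: real ^ 'n) $ q i) \<in> borel_measurable (borel \<Otimes>\<^sub>M M)"
    by (intro measurable_compose[OF measurable_fst] measurable_vec_nth_borel)
  show ?thesis unfolding visit_def case_prod_beta' by measurable
qed

lemma visit_nonneg:
  assumes i: "i \<in> {1..N}" and y: "0 \<le> y"
  shows "0 \<le> visit i y a"
proof -
  have "0 \<le> y - (y $ q i) *\<^sub>R axis (q i) 1" using y by (auto simp: vec_le_def axis_def)
  moreover have "0 \<le> R i (y $ q i) a" using y by (intro R_nonneg i) (simp add: vec_le_def)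
  ultimately show ?thesis unfolding visit_def by (rule add_nonneg_nonneg)
qed

text \<open>Queue i loses its y_i units, contributing u_i y_i to the exponent, and receives their
  replacement, contributing - y_i \<eta>_i(u). Together this substitutes \<eta>_i(u) for
  u_i.\<close>

lemma visit_transform_point:
  assumes i: "i \<in> {1..N}" and y: "0 \<le> y" and u: "0 \<le> u"
  shows "(\<integral>\<^sup>+a. ennreal (exp (- inner u (visit i y a))) \<partial>M) = ennreal (exp (- inner (vec_upd u (q i) (\<eta> i u)) y))"
proof -
  have yi: "0 \<le> y $ q i" using y by (simp add: vec_le_def)
  have [measurable]: "R i (y $ q i) \<in> borel_measurable M"
    using measurable_Pair2[OF joint_R[OF i], of "y $ q i"] by simp
  have int: "integrable M (\<lambda>a. exp (- inner u (R i (y $ q i) a)))"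
    using transform_R[OF i yi u] not_integrable_integral_eq by fastforce
  have "exp (- inner u (visit i y a)) = exp (- inner u y + u $ q i * y $ q i) * exp (- inner u (R i (y $ q i) a))" for a
    by (simp add: visit_def inner_add_right inner_diff_right inner_axis exp_add[symmetric] mult.commute)
  then have "(\<integral>\<^sup>+a. ennreal (exp (- inner u (visit i y a))) \<partial>M)
    = ennreal (exp (- inner u y + u $ q i * y $ q i)) * (\<integral>\<^sup>+a. ennreal (exp (- inner u (R i (y $ q i) a))) \<partial>M)"
    by (simp add: ennreal_mult' nn_integral_cmult)
  also have "(\<integral>\<^sup>+a. ennreal (exp (- inner u (R i (y $ q i) a))) \<partial>M) = ennreal (exp (- (y $ q i * \<eta> i u)))"
    by (subst nn_integral_eq_integral[OF int]) (auto simp: transform_R[OF i yi u])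
  also have "ennreal (exp (- inner u y + u $ q i * y $ q i)) * ennreal (exp (- (y $ q i * \<eta> i u)))
    = ennreal (exp (- inner (vec_upd u (q i) (\<eta> i u)) y))"
    by (simp add: ennreal_mult'[symmetric] exp_add[symmetric] inner_vec_upd_left algebra_simps)
  finally show ?thesis .
qed

definition visit_time_transform :: "nat \<Rightarrow> real ^ 'n \<Rightarrow> real ^ 'n \<Rightarrow> 'a \<Rightarrow> ennreal" where
  "visit_time_transform i u y a =
     (\<integral>\<^sup>+t. ennreal (exp (- inner u (y + X i t a))) * indicator {0<..T i (y $ q i) a} t \<partial>lborel)"

lemma measurable_T_nth: "i \<in> {1..N} \<Longrightarrow> (\<lambda>(y, a). T i (y $ q i) a) \<in> borel_measurable (borel \<Otimes>\<^sub>M M)"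
proof -
  assume i: "i \<in> {1..N}"
  have "(\<lambda>p. ((fst p :: real ^ 'n) $ q i, snd p)) \<in> (borel \<Otimes>\<^sub>M M) \<rightarrow>\<^sub>M (borel \<Otimes>\<^sub>M M)"
    by (intro measurable_Pair measurable_compose[OF measurable_fst] measurable_vec_nth_borel measurable_snd)
  from measurable_compose[OF this joint_T[OF i]] show ?thesis by (simp add: case_prod_beta')
qed

lemma measurable_visit_time_transform:
  assumes i: "i \<in> {1..N}"
  shows "(\<lambda>(y, a). visit_time_transform i u y a) \<in> borel_measurable (borel \<Otimes>\<^sub>M M)"
proof -
  have "(\<lambda>p. (snd p, snd (fst p))) \<in> ((borel \<Otimes>\<^sub>M M) \<Otimes>\<^sub>M lborel) \<rightarrow>\<^sub>M (borel \<Otimes>\<^sub>M M)"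
    by (intro measurable_Pair measurable_compose[OF measurable_fst measurable_snd]) simp
  from measurable_compose[OF this joint_X[OF i]]
  have [measurable]: "(\<lambda>p. X i (snd p) (snd (fst p))) \<in> borel_measurable ((borel \<Otimes>\<^sub>M M) \<Otimes>\<^sub>M lborel)" by simp
  have [measurable]: "(\<lambda>p. indicator {0<..(\<lambda>(y, a). T i (y $ q i) a) (fst p)} (snd p) :: ennreal) \<in> borel_measurable ((borel \<Otimes>\<^sub>M M) \<Otimes>\<^sub>M lborel)"
    by (rule indicator_measurable_lborel[OF borel_measurable_const measurable_T_nth[OF i]])
  have [measurable]: "(\<lambda>p. fst (fst p)) \<in> borel_measurable ((borel \<Otimes>\<^sub>M M) \<Otimes>\<^sub>M lborel)" by measurable
  have "(\<lambda>p. ennreal (exp (- inner u (fst (fst p) + X i (snd p) (snd (fst p))))) * indicator {0<..(\<lambda>(y, a). T i (y $ q i) a) (fst p)} (snd p))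
    \<in> borel_measurable ((borel \<Otimes>\<^sub>M M) \<Otimes>\<^sub>M lborel)" by measurable
  from lborel.borel_measurable_nn_integral_fst[OF this] show ?thesis
    by (simp add: visit_time_transform_def case_prod_beta')
qed

text \<open>The starting workload y factors out as exp(- u y), which leaves \<open>V_eq\<close>
  divided by the exponent. Nonnegativity of \<open>r\<close> is recorded because numerator and
  denominator may both be negative and \<open>ennreal\<close> would turn a negative value into
  0.\<close>

lemma visit_time_transform_point:
  assumes i: "i \<in> {1..N}" and y: "0 \<le> y" and u: "0 \<le> u" and nz: "\<phi>A i u \<noteq> 0"
  defines "r \<equiv> (exp (- inner u y) - exp (- inner (vec_upd u (q i) (\<eta> i u)) y)) / \<phi>A i u"
  shows "(\<integral>\<^sup>+a. visit_time_transform i u y a \<partial>M) = ennreal r" and "0 \<le> r"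
proof -
  have yi: "0 \<le> y $ q i" using y by (simp add: vec_le_def)
  have meas: "(\<lambda>a. \<integral>\<^sup>+t. ennreal (exp (- inner u (X i t a))) * indicator {0<..T i (y $ q i) a} t \<partial>lborel) \<in> borel_measurable M"
    using lborel.borel_measurable_nn_integral_fst[OF visit_transform_pair(2)[OF i measurable_T[OF i]]] by simp
  have "visit_time_transform i u y a = ennreal (exp (- inner u y)) *
      (\<integral>\<^sup>+t. ennreal (exp (- inner u (X i t a))) * indicator {0<..T i (y $ q i) a} t \<partial>lborel)" if a: "a \<in> space M" for a
  proof -
    have [measurable]: "(\<lambda>t. X i t a) \<in> borel_measurable borel"
      using measurable_compose[OF measurable_Pair2'[OF a] joint_X[OF i]] by simp
    show ?thesis unfolding visit_time_transform_def
      by (subst nn_integral_cmult[symmetric])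
         (auto intro!: nn_integral_cong simp: exp_inner_add ennreal_mult' mult.assoc)
  qed
  then have "(\<integral>\<^sup>+a. visit_time_transform i u y a \<partial>M) = ennreal (exp (- inner u y)) * V i u (y $ q i)"
    unfolding V_def visit_transform_def nn_integral_cmult[OF meas, symmetric] by (intro nn_integral_cong)
  also have "V i u (y $ q i) = ennreal (enn2real (V i u (y $ q i)))"
    using V_identity(1)[OF i yi u] by simp
  also have V: "enn2real (V i u (y $ q i)) = (1 - exp (u $ q i * y $ q i - y $ q i * \<eta> i u)) / \<phi>A i u"
    using V_eq[OF i yi u] nz by (simp add: eq_divide_eq mult.commute)
  also have "ennreal (exp (- inner u y)) * ennreal ((1 - exp (u $ q i * y $ q i - y $ q i * \<eta> i u)) / \<phi>A i u) = ennreal r"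
    by (simp add: ennreal_mult'[symmetric] r_def right_diff_distrib exp_add[symmetric] inner_vec_upd_left algebra_simps)
  finally show "(\<integral>\<^sup>+a. visit_time_transform i u y a \<partial>M) = ennreal r" .
  have "r = exp (- inner u y) * enn2real (V i u (y $ q i))"
    unfolding V by (simp add: r_def right_diff_distrib exp_add[symmetric] inner_vec_upd_left algebra_simps)
  then show "0 \<le> r" by simp
qed

definition switch_time_transform :: "nat \<Rightarrow> real ^ 'n \<Rightarrow> real ^ 'n \<Rightarrow> 'a \<Rightarrow> 'a \<Rightarrow> ennreal" where
  "switch_time_transform i u y a b =
     (\<integral>\<^sup>+t. ennreal (exp (- inner u (y + W' t b))) * indicator {0<..S' i a} t \<partial>lborel)"

lemma measurable_switch_time_transform:
  assumes i: "i \<in> {1..N}"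
  shows "(\<lambda>p. switch_time_transform i u (fst (fst p)) (snd (fst p)) (snd p)) \<in> borel_measurable ((borel \<Otimes>\<^sub>M M) \<Otimes>\<^sub>M M)"
proof -
  let ?K = "(borel \<Otimes>\<^sub>M M) \<Otimes>\<^sub>M M"
  have "(\<lambda>p. (snd p, snd (fst p))) \<in> (?K \<Otimes>\<^sub>M lborel) \<rightarrow>\<^sub>M (borel \<Otimes>\<^sub>M M)"
    by (intro measurable_Pair measurable_compose[OF measurable_fst measurable_snd]) simp
  from measurable_compose[OF this joint_W']
  have [measurable]: "(\<lambda>p. W' (snd p) (snd (fst p))) \<in> borel_measurable (?K \<Otimes>\<^sub>M lborel)" by simp
  have [measurable]: "(\<lambda>p. fst (fst (fst p))) \<in> borel_measurable (?K \<Otimes>\<^sub>M lborel)" by measurable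
  have "(\<lambda>p. S' i (snd (fst p))) \<in> borel_measurable ?K"
    by (rule measurable_compose[OF measurable_compose[OF measurable_fst measurable_snd] measurable_S'[OF i]])
  then have [measurable]: "(\<lambda>p. indicator {0<..(\<lambda>p. S' i (snd (fst p))) (fst p)} (snd p) :: ennreal) \<in> borel_measurable (?K \<Otimes>\<^sub>M lborel)"
    by (rule indicator_measurable_lborel[OF borel_measurable_const])
  have "(\<lambda>p. ennreal (exp (- inner u (fst (fst (fst p)) + W' (snd p) (snd (fst p))))) * indicator {0<..(\<lambda>p. S' i (snd (fst p))) (fst p)} (snd p))
    \<in> borel_measurable (?K \<Otimes>\<^sub>M lborel)" by measurable
  from lborel.borel_measurable_nn_integral_fst[OF this] show ?thesis
    by (simp add: switch_time_transform_def)
qed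

section \<open>Visits starting from a random workload\<close>

context
  fixes J :: "'k set" and Y :: "'p \<Rightarrow> real ^ 'n"
  assumes J: "J \<subseteq> I" and Y: "fresh P M \<xi> J borel Y" and Y_nonneg: "AE \<omega> in P. 0 \<le> Y \<omega>"
begin

lemma measurable_Y [measurable]: "Y \<in> borel_measurable P"
  using Y by (simp add: fresh_def)

context
  fixes v :: 'k and i :: nat
  assumes v: "v \<in> J" and i: "i \<in> {1..N}"
begin

lemma fresh_visit: "fresh P M \<xi> (J - {v}) borel (\<lambda>\<omega>. visit i (Y \<omega>) (\<xi> v \<omega>))"
  using C.fresh_compose[OF C.fresh_step(1)[OF Y J v] _ measurable_visit[OF i]] J by auto

lemma AE_visit_nonneg: "AE \<omega> in P. 0 \<le> visit i (Y \<omega>) (\<xi> v \<omega>)"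
  using Y_nonneg by eventually_elim (rule visit_nonneg[OF i])

lemma lst_visit:
  assumes u: "0 \<le> u"
  shows "lst P (\<lambda>\<omega>. visit i (Y \<omega>) (\<xi> v \<omega>)) u = lst P Y (vec_upd u (q i) (\<eta> i u))"
proof -
  have [measurable]: "(\<lambda>\<omega>. visit i (Y \<omega>) (\<xi> v \<omega>)) \<in> borel_measurable P"
    using fresh_visit by (simp add: fresh_def)
  have m: "(\<lambda>(y, a). ennreal (exp (- inner u (visit i y a)))) \<in> borel_measurable (borel \<Otimes>\<^sub>M M)"
  proof -
    have [measurable]: "(\<lambda>p. visit i (fst p) (snd p)) \<in> borel_measurable (borel \<Otimes>\<^sub>M M)"
      using measurable_visit[OF i] by (simp add: case_prod_beta')
    show ?thesis unfolding case_prod_beta' by measurable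
  qed
  have "(\<integral>\<^sup>+\<omega>. ennreal (exp (- inner u (visit i (Y \<omega>) (\<xi> v \<omega>)))) \<partial>P)
    = (\<integral>\<^sup>+\<omega>. \<integral>\<^sup>+a. ennreal (exp (- inner u (visit i (Y \<omega>) a))) \<partial>M \<partial>P)"
    by (rule C.nn_integral_fresh[OF Y J v m])
  also have "\<dots> = (\<integral>\<^sup>+\<omega>. ennreal (exp (- inner (vec_upd u (q i) (\<eta> i u)) (Y \<omega>))) \<partial>P)"
    by (rule nn_integral_cong_AE, use Y_nonneg in eventually_elim) (rule visit_transform_point[OF i _ u])
  finally show ?thesis by (simp add: lst_eq_nn_integral)
qed

lemma visit_time_transform_mean:
  assumes u: "0 \<le> u" and nz: "\<phi>A i u \<noteq> 0"
  shows "(\<integral>\<^sup>+\<omega>. visit_time_transform i u (Y \<omega>) (\<xi> v \<omega>) \<partial>P)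
      = ennreal ((lst P Y u - lst P (\<lambda>\<omega>. visit i (Y \<omega>) (\<xi> v \<omega>)) u) / \<phi>A i u)"
    and "0 \<le> (lst P Y u - lst P (\<lambda>\<omega>. visit i (Y \<omega>) (\<xi> v \<omega>)) u) / \<phi>A i u"
proof -
  define w where "w = vec_upd u (q i) (\<eta> i u)"
  have w: "0 \<le> w" unfolding w_def
    using u subordinator_exponentD(1)[OF subordinator_exponent_\<eta>[OF i] u] by (rule vec_upd_nonneg)
  note int = lst_int[OF C.prob_space_axioms measurable_Y Y_nonneg]
  let ?r = "\<lambda>\<omega>. (exp (- inner u (Y \<omega>)) - exp (- inner w (Y \<omega>))) / \<phi>A i u"
  have r0: "AE \<omega> in P. 0 \<le> ?r \<omega>"
    using Y_nonneg by eventually_elim (use visit_time_transform_point(2)[OF i _ u nz] in \<open>auto simp: w_def\<close>)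
  have r_int: "integrable P ?r" using int[OF u] int[OF w] by simp
  have r_eq: "(\<integral>\<omega>. ?r \<omega> \<partial>P) = (lst P Y u - lst P (\<lambda>\<omega>. visit i (Y \<omega>) (\<xi> v \<omega>)) u) / \<phi>A i u"
    using int[OF u] int[OF w] by (simp only: lst_visit[OF u]) (simp add: lst_def w_def)
  have "(\<integral>\<^sup>+\<omega>. visit_time_transform i u (Y \<omega>) (\<xi> v \<omega>) \<partial>P)
    = (\<integral>\<^sup>+\<omega>. \<integral>\<^sup>+a. visit_time_transform i u (Y \<omega>) a \<partial>M \<partial>P)"
    by (rule C.nn_integral_fresh[OF Y J v measurable_visit_time_transform[OF i]])
  also have "\<dots> = (\<integral>\<^sup>+\<omega>. ennreal (?r \<omega>) \<partial>P)"
    by (rule nn_integral_cong_AE, use Y_nonneg in eventually_elim)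
       (simp add: visit_time_transform_point(1)[OF i _ u nz] w_def)
  also have "\<dots> = ennreal (\<integral>\<omega>. ?r \<omega> \<partial>P)" by (rule nn_integral_eq_integral[OF r_int r0])
  finally show "(\<integral>\<^sup>+\<omega>. visit_time_transform i u (Y \<omega>) (\<xi> v \<omega>) \<partial>P)
      = ennreal ((lst P Y u - lst P (\<lambda>\<omega>. visit i (Y \<omega>) (\<xi> v \<omega>)) u) / \<phi>A i u)"
    by (simp only: r_eq)
  show "0 \<le> (lst P Y u - lst P (\<lambda>\<omega>. visit i (Y \<omega>) (\<xi> v \<omega>)) u) / \<phi>A i u"
    unfolding r_eq[symmetric] using r0 by (rule integral_nonneg_AE)
qed

text \<open>With the workload held fixed, the mean visit time is linear in it by
  \<open>mean_T_linear\<close>; hence only the mean of the workload enters.\<close>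

lemma visit_time_mean:
  assumes int: "integrable P (\<lambda>\<omega>. Y \<omega> $ q i)"
  shows "has_bochner_integral P (\<lambda>\<omega>. T i (Y \<omega> $ q i) (\<xi> v \<omega>)) ((\<integral>a. T i 1 a \<partial>M) * (\<integral>\<omega>. Y \<omega> $ q i \<partial>P))"
proof (rule has_bochner_integral_nn_integral)
  have [measurable]: "\<xi> v \<in> P \<rightarrow>\<^sub>M M" using C.copies v J by auto
  show "(\<lambda>\<omega>. T i (Y \<omega> $ q i) (\<xi> v \<omega>)) \<in> borel_measurable P"
    using measurable_compose[OF measurable_Pair[OF measurable_Y] measurable_T_nth[OF i], of "\<xi> v"] by simp
  show "AE \<omega> in P. 0 \<le> T i (Y \<omega> $ q i) (\<xi> v \<omega>)" by (simp add: T_nonneg)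
  have yi: "AE \<omega> in P. 0 \<le> Y \<omega> $ q i" using Y_nonneg by eventually_elim (simp add: vec_le_def)
  show "0 \<le> (\<integral>a. T i 1 a \<partial>M) * (\<integral>\<omega>. Y \<omega> $ q i \<partial>P)"
    using yi by (intro mult_nonneg_nonneg mean_T_nonneg integral_nonneg_AE)
  have "(\<lambda>(y, a). ennreal (T i (y $ q i) a)) \<in> borel_measurable (borel \<Otimes>\<^sub>M M)"
    using measurable_compose[OF measurable_T_nth[OF i] measurable_ennreal] by (simp add: case_prod_beta')
  from C.nn_integral_fresh[OF Y J v this]
  have "(\<integral>\<^sup>+\<omega>. ennreal (T i (Y \<omega> $ q i) (\<xi> v \<omega>)) \<partial>P) = (\<integral>\<^sup>+\<omega>. \<integral>\<^sup>+a. ennreal (T i (Y \<omega> $ q i) a) \<partial>M \<partial>P)" .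
  also have "\<dots> = (\<integral>\<^sup>+\<omega>. ennreal ((\<integral>a. T i 1 a \<partial>M) * Y \<omega> $ q i) \<partial>P)"
  proof (rule nn_integral_cong_AE, use yi in eventually_elim)
    fix \<omega> assume y: "0 \<le> Y \<omega> $ q i"
    have "(\<integral>\<^sup>+a. ennreal (T i (Y \<omega> $ q i) a) \<partial>M) = ennreal (\<integral>a. T i (Y \<omega> $ q i) a \<partial>M)"
      by (rule nn_integral_eq_integral[OF visit_time(2)[OF i y]]) (simp add: T_nonneg)
    then show "(\<integral>\<^sup>+a. ennreal (T i (Y \<omega> $ q i) a) \<partial>M) = ennreal ((\<integral>a. T i 1 a \<partial>M) * Y \<omega> $ q i)"
      by (simp only: mean_T_linear[OF i y] mult.commute)
  qed
  also have "\<dots> = ennreal (\<integral>\<omega>. (\<integral>a. T i 1 a \<partial>M) * Y \<omega> $ q i \<partial>P)"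
  proof (rule nn_integral_eq_integral)
    show "AE \<omega> in P. 0 \<le> (\<integral>a. T i 1 a \<partial>M) * Y \<omega> $ q i"
      using yi by eventually_elim (intro mult_nonneg_nonneg mean_T_nonneg)
  qed (use int in simp)
  finally show "(\<integral>\<^sup>+\<omega>. ennreal (T i (Y \<omega> $ q i) (\<xi> v \<omega>)) \<partial>P) = ennreal ((\<integral>a. T i 1 a \<partial>M) * (\<integral>\<omega>. Y \<omega> $ q i \<partial>P))"
    by simp
qed

end

section \<open>Switch-over periods starting from a random workload\<close>

context
  fixes d w :: 'k and i :: nat
  assumes d: "d \<in> J" and w: "w \<in> J" "w \<noteq> d" and i: "i \<in> {1..N}"
begin

lemma fresh_duration: "fresh P M \<xi> (J - {d}) (borel \<Otimes>\<^sub>M M) (\<lambda>\<omega>. (Y \<omega>, \<xi> d \<omega>))"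
  by (rule C.fresh_step(1)[OF Y J d])

lemma W'_pair [measurable]: "(\<lambda>p. W' (S' i (snd (fst p))) (snd p)) \<in> borel_measurable ((borel \<Otimes>\<^sub>M M) \<Otimes>\<^sub>M M)"
proof -
  have "(\<lambda>p. S' i (snd (fst p))) \<in> borel_measurable ((borel \<Otimes>\<^sub>M M) \<Otimes>\<^sub>M M)"
    by (rule measurable_compose[OF measurable_compose[OF measurable_fst measurable_snd] measurable_S'[OF i]])
  then have "(\<lambda>p. (S' i (snd (fst p)), snd p)) \<in> ((borel \<Otimes>\<^sub>M M) \<Otimes>\<^sub>M M) \<rightarrow>\<^sub>M (borel \<Otimes>\<^sub>M M)"
    by (intro measurable_Pair measurable_snd)
  from measurable_compose[OF this joint_W'] show ?thesis by simp
qed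

lemma fresh_switch: "fresh P M \<xi> (J - {d} - {w}) borel (\<lambda>\<omega>. Y \<omega> + W' (S' i (\<xi> d \<omega>)) (\<xi> w \<omega>))"
proof -
  have sub: "J - {d} - {w} \<subseteq> I" using J by auto
  have fr: "fresh P M \<xi> (J - {d} - {w}) ((borel \<Otimes>\<^sub>M M) \<Otimes>\<^sub>M M) (\<lambda>\<omega>. ((Y \<omega>, \<xi> d \<omega>), \<xi> w \<omega>))"
    using w J by (intro C.fresh_step(1)[OF fresh_duration]) auto
  have m: "(\<lambda>p. fst (fst p) + W' (S' i (snd (fst p))) (snd p)) \<in> ((borel \<Otimes>\<^sub>M M) \<Otimes>\<^sub>M M) \<rightarrow>\<^sub>M borel"
    by measurable
  from C.fresh_compose[OF fr sub m] show ?thesis by simp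
qed

lemma AE_switch_nonneg: "AE \<omega> in P. 0 \<le> Y \<omega> + W' (S' i (\<xi> d \<omega>)) (\<xi> w \<omega>)"
  using Y_nonneg by eventually_elim (intro add_nonneg_nonneg W'_nonneg)

lemma nn_integral_switch:
  assumes f: "(\<lambda>p. f (fst (fst p)) (snd (fst p)) (snd p)) \<in> borel_measurable ((borel \<Otimes>\<^sub>M M) \<Otimes>\<^sub>M M)"
  shows "(\<integral>\<^sup>+\<omega>. f (Y \<omega>) (\<xi> d \<omega>) (\<xi> w \<omega>) \<partial>P) = (\<integral>\<^sup>+\<omega>. \<integral>\<^sup>+a. \<integral>\<^sup>+b. f (Y \<omega>) a b \<partial>M \<partial>M \<partial>P)"
proof -
  have "(\<integral>\<^sup>+\<omega>. f (Y \<omega>) (\<xi> d \<omega>) (\<xi> w \<omega>) \<partial>P) = (\<integral>\<^sup>+\<omega>. \<integral>\<^sup>+b. f (Y \<omega>) (\<xi> d \<omega>) b \<partial>M \<partial>P)"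
  proof -
    have "(\<lambda>(p, b). f (fst p) (snd p) b) \<in> borel_measurable ((borel \<Otimes>\<^sub>M M) \<Otimes>\<^sub>M M)"
      using f by (simp add: case_prod_beta')
    from C.nn_integral_fresh[OF fresh_duration _ _ this, of w] show ?thesis using J w by auto
  qed
  also have "\<dots> = (\<integral>\<^sup>+\<omega>. \<integral>\<^sup>+a. \<integral>\<^sup>+b. f (Y \<omega>) a b \<partial>M \<partial>M \<partial>P)"
  proof -
    have "(\<lambda>(y, a). \<integral>\<^sup>+b. f y a b \<partial>M) \<in> borel_measurable (borel \<Otimes>\<^sub>M M)"
      using borel_measurable_nn_integral_fst[OF f] by (simp add: case_prod_beta')
    from C.nn_integral_fresh[OF Y J d this] show ?thesis .
  qed
  finally show ?thesis .
qed

lemma W'_transform: "0 \<le> t \<Longrightarrow> 0 \<le> u \<Longrightarrow> (\<integral>\<^sup>+b. ennreal (exp (- inner u (W' t b))) \<partial>M) = ennreal (exp (- (t * \<phi> u)))"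
proof -
  assume t: "0 \<le> t" and u: "0 \<le> u"
  have [measurable]: "W t \<in> borel_measurable M" using W t by (auto simp: levy_subordinator_def levy_process_def)
  have l: "lst M (W t) u = exp (- (t * \<phi> u))" using \<phi> t u by (simp add: laplace_exponent_def)
  have "(\<integral>\<^sup>+b. ennreal (exp (- inner u (W' t b))) \<partial>M) = (\<integral>\<^sup>+b. ennreal (exp (- inner u (W t b))) \<partial>M)"
    by (rule nn_integral_cong_AE, use \<Omega>(2) in eventually_elim) (simp add: W'_def t)
  also have "\<dots> = ennreal (lst M (W t) u)"
    unfolding lst_def using lst_pos_integrable[of M "W t" u] l by (intro nn_integral_eq_integral) auto
  finally show ?thesis by (simp add: l)
qed

lemma S'_transform: "0 \<le> \<theta> \<Longrightarrow> has_bochner_integral M (\<lambda>a. exp (- (S' i a * \<theta>))) (lst M (S i) \<theta>)"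
proof -
  assume \<theta>: "0 \<le> \<theta>"
  have [measurable]: "S' i \<in> borel_measurable M" "S i \<in> borel_measurable M" using i S by auto
  have "AE a in M. exp (- (S' i a * \<theta>)) = exp (- (\<theta> * S i a))"
    using \<Omega>(2) by eventually_elim (simp add: S'_def mult.commute)
  moreover have "has_bochner_integral M (\<lambda>a. exp (- (\<theta> * S i a))) (lst M (S i) \<theta>)"
    using lst_S(1)[OF i \<theta>] by (simp add: has_bochner_integral_iff lst_def)
  ultimately show ?thesis by (subst has_bochner_integral_cong_AE) auto
qed

lemma lst_switch:
  assumes u: "0 \<le> u"
  shows "lst P (\<lambda>\<omega>. Y \<omega> + W' (S' i (\<xi> d \<omega>)) (\<xi> w \<omega>)) u = lst P Y u * lst M (S i) (\<phi> u)"
proof -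
  have \<theta>: "0 \<le> \<phi> u" by (rule subordinator_exponentD(1)[OF subordinator_exponent_\<phi> u])
  have [measurable]: "(\<lambda>\<omega>. Y \<omega> + W' (S' i (\<xi> d \<omega>)) (\<xi> w \<omega>)) \<in> borel_measurable P"
    using fresh_switch by (simp add: fresh_def)
  have [measurable]: "S' i \<in> borel_measurable M" using i by simp
  have "(\<integral>\<^sup>+\<omega>. ennreal (exp (- inner u (Y \<omega> + W' (S' i (\<xi> d \<omega>)) (\<xi> w \<omega>)))) \<partial>P)
    = (\<integral>\<^sup>+\<omega>. \<integral>\<^sup>+a. \<integral>\<^sup>+b. ennreal (exp (- inner u (Y \<omega> + W' (S' i a) b))) \<partial>M \<partial>M \<partial>P)"
    by (rule nn_integral_switch) measurable
  also have "\<dots> = (\<integral>\<^sup>+\<omega>. ennreal (exp (- inner u (Y \<omega>))) * ennreal (lst M (S i) (\<phi> u)) \<partial>P)"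
  proof (rule nn_integral_cong)
    fix \<omega>
    have [measurable]: "W' s \<in> borel_measurable M" for s
      using measurable_Pair2[OF joint_W', of s] by simp
    have "(\<integral>\<^sup>+a. \<integral>\<^sup>+b. ennreal (exp (- inner u (Y \<omega> + W' (S' i a) b))) \<partial>M \<partial>M)
      = (\<integral>\<^sup>+a. ennreal (exp (- inner u (Y \<omega>))) * ennreal (exp (- (S' i a * \<phi> u))) \<partial>M)"
      by (intro nn_integral_cong)
         (simp add: exp_inner_add ennreal_mult' nn_integral_cmult W'_transform[OF S'_nonneg[OF i] u])
    also have "\<dots> = ennreal (exp (- inner u (Y \<omega>))) * ennreal (lst M (S i) (\<phi> u))"
      using S'_transform[OF \<theta>] by (subst nn_integral_cmult) (auto simp: nn_integral_eq_integral has_bochner_integral_iff)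
    finally show "(\<integral>\<^sup>+a. \<integral>\<^sup>+b. ennreal (exp (- inner u (Y \<omega> + W' (S' i a) b))) \<partial>M \<partial>M)
      = ennreal (exp (- inner u (Y \<omega>))) * ennreal (lst M (S i) (\<phi> u))" .
  qed
  also have "\<dots> = (\<integral>\<^sup>+\<omega>. ennreal (exp (- inner u (Y \<omega>))) \<partial>P) * ennreal (lst M (S i) (\<phi> u))"
    by (rule nn_integral_multc) measurable
  finally show ?thesis
    using lst_S(2)[OF i \<theta>] by (simp add: lst_eq_nn_integral[of _ P] enn2real_mult)
qed

lemma switch_time_transform_mean:
  assumes u: "0 \<le> u" and nz: "\<phi> u \<noteq> 0"
  shows "(\<integral>\<^sup>+\<omega>. switch_time_transform i u (Y \<omega>) (\<xi> d \<omega>) (\<xi> w \<omega>) \<partial>P)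
      = ennreal ((lst P Y u - lst P (\<lambda>\<omega>. Y \<omega> + W' (S' i (\<xi> d \<omega>)) (\<xi> w \<omega>)) u) / \<phi> u)"
    and "0 \<le> (lst P Y u - lst P (\<lambda>\<omega>. Y \<omega> + W' (S' i (\<xi> d \<omega>)) (\<xi> w \<omega>)) u) / \<phi> u"
proof -
  have \<phi>0: "0 \<le> \<phi> u" by (rule subordinator_exponentD(1)[OF subordinator_exponent_\<phi> u])
  \<comment> \<open>The mean of the integral of exp(- t \<phi>(u)) over a switch-over
    period.\<close>
  define s where "s = (1 - lst M (S i) (\<phi> u)) / \<phi> u"
  have s0: "0 \<le> s" using lst_S(3)[OF i \<phi>0] \<phi>0 by (simp add: s_def)
  have Wt [measurable]: "W' t \<in> borel_measurable M" for t
    using measurable_Pair2[OF joint_W', of t] by simp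
  have [measurable]: "S' i \<in> borel_measurable M" using i by simp
  have point: "(\<integral>\<^sup>+b. switch_time_transform i u y a b \<partial>M)
      = ennreal (exp (- inner u y)) * ennreal ((1 - exp (- (S' i a * \<phi> u))) / \<phi> u)" for y a
  proof -
    interpret LM: pair_sigma_finite lborel M ..
    have [measurable]: "(\<lambda>p. W' (fst p) (snd p)) \<in> borel_measurable (lborel \<Otimes>\<^sub>M M)"
      using joint_W' by (simp add: case_prod_beta' cong: measurable_cong_sets sets_pair_measure_cong)
    have "(\<integral>\<^sup>+b. switch_time_transform i u y a b \<partial>M)
      = (\<integral>\<^sup>+t. \<integral>\<^sup>+b. ennreal (exp (- inner u (y + W' t b))) * indicator {0<..S' i a} t \<partial>M \<partial>lborel)"
      unfolding switch_time_transform_def by (rule LM.Fubini') (simp add: case_prod_beta')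
    also have "\<dots> = (\<integral>\<^sup>+t. ennreal (exp (- inner u y)) * (ennreal (exp (- ((t - 0) * \<phi> u))) * indicator {0<..S' i a} t) \<partial>lborel)"
    proof (rule nn_integral_cong)
      fix t :: real
      show "(\<integral>\<^sup>+b. ennreal (exp (- inner u (y + W' t b))) * indicator {0<..S' i a} t \<partial>M)
        = ennreal (exp (- inner u y)) * (ennreal (exp (- ((t - 0) * \<phi> u))) * indicator {0<..S' i a} t)"
        by (cases "t \<in> {0<..S' i a}")
           (auto simp: exp_inner_add ennreal_mult' nn_integral_cmult W'_transform[OF _ u])
    qed
    also have "\<dots> = ennreal (exp (- inner u y)) * (\<integral>\<^sup>+t. ennreal (exp (- ((t - 0) * \<phi> u))) * indicator {0<..S' i a} t \<partial>lborel)"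
      by (rule nn_integral_cmult) measurable
    also have "(\<integral>\<^sup>+t. ennreal (exp (- ((t - 0) * \<phi> u))) * indicator {0<..S' i a} t \<partial>lborel)
      = ennreal ((1 - exp (- (S' i a * \<phi> u))) / \<phi> u)"
      unfolding nn_integral_exp_interval[OF S'_nonneg[OF i]] using nz by simp
    finally show ?thesis .
  qed
  have "(\<integral>\<^sup>+\<omega>. switch_time_transform i u (Y \<omega>) (\<xi> d \<omega>) (\<xi> w \<omega>) \<partial>P)
    = (\<integral>\<^sup>+\<omega>. \<integral>\<^sup>+a. \<integral>\<^sup>+b. switch_time_transform i u (Y \<omega>) a b \<partial>M \<partial>M \<partial>P)"
    by (rule nn_integral_switch[OF measurable_switch_time_transform[OF i]])
  also have "\<dots> = (\<integral>\<^sup>+\<omega>. ennreal (exp (- inner u (Y \<omega>))) * ennreal s \<partial>P)"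
  proof (rule nn_integral_cong)
    fix \<omega>
    have "(\<integral>\<^sup>+a. ennreal ((1 - exp (- (S' i a * \<phi> u))) / \<phi> u) \<partial>M) = ennreal s"
    proof -
      have hb: "has_bochner_integral M (\<lambda>a. (1 - exp (- (S' i a * \<phi> u))) / \<phi> u) s"
        using S'_transform[OF \<phi>0] by (simp add: has_bochner_integral_iff s_def prob_space)
      have "0 \<le> (1 - exp (- (S' i a * \<phi> u))) / \<phi> u" for a
        using S'_nonneg[OF i, of a] \<phi>0 by (intro divide_nonneg_nonneg) auto
      then show ?thesis using hb by (subst nn_integral_eq_integral) (auto simp: has_bochner_integral_iff)
    qed
    then show "(\<integral>\<^sup>+a. \<integral>\<^sup>+b. switch_time_transform i u (Y \<omega>) a b \<partial>M \<partial>M) = ennreal (exp (- inner u (Y \<omega>))) * ennreal s"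
      unfolding point by (subst nn_integral_cmult) auto
  qed
  also have "\<dots> = (\<integral>\<^sup>+\<omega>. ennreal (exp (- inner u (Y \<omega>))) \<partial>P) * ennreal s"
    by (rule nn_integral_multc) measurable
  also have "(\<integral>\<^sup>+\<omega>. ennreal (exp (- inner u (Y \<omega>))) \<partial>P) = ennreal (lst P Y u)"
    unfolding lst_def
    by (rule nn_integral_eq_integral[OF lst_int[OF C.prob_space_axioms measurable_Y Y_nonneg u]]) simp
  also have "ennreal (lst P Y u) * ennreal s = ennreal (lst P Y u * s)" using s0 by (simp add: ennreal_mult'')
  finally have *: "(\<integral>\<^sup>+\<omega>. switch_time_transform i u (Y \<omega>) (\<xi> d \<omega>) (\<xi> w \<omega>) \<partial>P) = ennreal (lst P Y u * s)" .
  have eq: "lst P Y u * s = (lst P Y u - lst P (\<lambda>\<omega>. Y \<omega> + W' (S' i (\<xi> d \<omega>)) (\<xi> w \<omega>)) u) / \<phi> u"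
    by (simp add: lst_switch[OF u] s_def right_diff_distrib)
  show "(\<integral>\<^sup>+\<omega>. switch_time_transform i u (Y \<omega>) (\<xi> d \<omega>) (\<xi> w \<omega>) \<partial>P)
      = ennreal ((lst P Y u - lst P (\<lambda>\<omega>. Y \<omega> + W' (S' i (\<xi> d \<omega>)) (\<xi> w \<omega>)) u) / \<phi> u)"
    using * by (simp only: eq)
  show "0 \<le> (lst P Y u - lst P (\<lambda>\<omega>. Y \<omega> + W' (S' i (\<xi> d \<omega>)) (\<xi> w \<omega>)) u) / \<phi> u"
    unfolding eq[symmetric]
    using lst_pos[OF C.prob_space_axioms measurable_Y Y_nonneg u] s0 by (intro mult_nonneg_nonneg) auto
qed

lemma switch_time_mean: "has_bochner_integral P (\<lambda>\<omega>. S' i (\<xi> d \<omega>)) (\<integral>a. S i a \<partial>M)"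
proof -
  have d': "d \<in> I" using d J by auto
  have [measurable]: "S' i \<in> borel_measurable M" "S i \<in> borel_measurable M" "\<xi> d \<in> P \<rightarrow>\<^sub>M M"
    using i S C.copies(1)[OF d'] by auto
  have "AE a in M. S' i a = S i a" using \<Omega>(2) by eventually_elim (simp add: S'_def)
  moreover have "has_bochner_integral M (S i) (\<integral>a. S i a \<partial>M)" using ES i by (simp add: has_bochner_integral_iff)
  ultimately have hb: "has_bochner_integral (distr P M (\<xi> d)) (S' i) (\<integral>a. S i a \<partial>M)"
    unfolding C.copies(2)[OF d'] by (subst has_bochner_integral_cong_AE) auto
  then show ?thesis by (simp add: has_bochner_integral_iff integrable_distr_eq integral_distr)
qed

end

end

declare measurable_Y [measurable del] W'_pair [measurable del]

end

section \<open>Cycles and the embedded chain\<close>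

text \<open>The same polling system driven by the modified processes. Its workloads and epochs carry
  the prefix \<open>reg\<close> and coincide with the original ones on regular copies.\<close>

sublocale polling_template \<subseteq> reg: polling q W' A' S' \<tau>' .

lemma (in polling_copies) reg_after_visit: "reg.after_visit i y a = visit i y a"
  by (simp add: reg.after_visit_def visit_def R_def)

text \<open>The original workloads are only known to equal measurable ones almost surely;
  completeness makes them measurable, so that their integrals can be exchanged.\<close>

lemma measurable_AE_complete:
  assumes P: "complete_measure P" and g: "g \<in> measurable P K"
    and eq: "AE \<omega> in P. f \<omega> = g \<omega>" and sp: "\<And>\<omega>. \<omega> \<in> space P \<Longrightarrow> f \<omega> \<in> space K"
  shows "f \<in> measurable P K"
proof (rule measurableI)
  fix A assume A: "A \<in> sets K"
  show "f -` A \<inter> space P \<in> sets P"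
  proof (rule complete_measure.in_sets_AE[OF P])
    show "AE \<omega> in P. \<omega> \<in> g -` A \<inter> space P \<longleftrightarrow> \<omega> \<in> f -` A \<inter> space P"
      using eq by eventually_elim auto
  qed (use g A in auto)
qed (use sp in auto)

locale polling_system = polling_copies q W A S \<tau> M \<phi> \<phi>A \<F> \<eta> N P \<xi> "UNIV \<times> UNIV \<times> {1..N}"
  for q :: "nat \<Rightarrow> 'n::finite"
    and W :: "real \<Rightarrow> 'a \<Rightarrow> real ^ 'n"
    and A :: "nat \<Rightarrow> real \<Rightarrow> 'a \<Rightarrow> real"
    and S :: "nat \<Rightarrow> 'a \<Rightarrow> real"
    and \<tau> :: "nat \<Rightarrow> real \<Rightarrow> 'a \<Rightarrow> ennreal"
    and M :: "'a measure" and \<phi> :: "real ^ 'n \<Rightarrow> real" and \<phi>A :: "nat \<Rightarrow> real ^ 'n \<Rightarrow> real"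
    and \<F> :: "nat \<Rightarrow> ennreal \<Rightarrow> 'a measure" and \<eta> :: "nat \<Rightarrow> real ^ 'n \<Rightarrow> real"
    and N :: nat
    and P :: "'p measure" and \<xi> :: "nat \<times> role \<times> nat \<Rightarrow> 'p \<Rightarrow> 'a" +
  fixes m :: "nat \<Rightarrow> nat \<Rightarrow> real" and X0 B1 G :: "'p \<Rightarrow> real ^ 'n"
  assumes complete: "complete_measure P"
    and m: "\<forall>i\<in>{1..N}. \<forall>j\<in>{1..N}.
           ((\<lambda>h. kappa q \<eta> (h *\<^sub>R axis (q j) 1) $ q i) has_real_derivative m i j) (at 0 within {0..})"
    and spectral: "spectral_radius
           (Matrix.mat N N (\<lambda>(i, j). complex_of_real (m (Suc i) (Suc j)))) < 1"
    and G: "G \<in> borel_measurable P" "AE \<omega> in P. 0 \<le> G \<omega>"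
           "\<forall>u\<ge>0. lst P G u = immigration_lst M q S \<phi> \<eta> u"
           "integrable P (\<lambda>\<omega>. norm (G \<omega>))"
    and X0: "AE \<omega> in P. 0 \<le> X0 \<omega>"
           "indep_rv P borel X0 (PiM (UNIV \<times> UNIV \<times> {1..N}) (\<lambda>_. M))
              (\<lambda>\<omega>. \<lambda>k\<in>UNIV \<times> UNIV \<times> {1..N}. \<xi> k \<omega>)"
    and B1: "indep_rv P borel B1 (PiM (UNIV \<times> UNIV \<times> {1..N}) (\<lambda>_. M))
              (\<lambda>\<omega>. \<lambda>k\<in>UNIV \<times> UNIV \<times> {1..N}. \<xi> k \<omega>)"
           "converges_in_distribution P
              (\<lambda>n \<omega>. polling.embedded q W A S \<tau> (\<lambda>n r i. \<xi> (n, r, i) \<omega>) (X0 \<omega>) n) B1"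
begin

definition unused :: "nat \<Rightarrow> nat \<Rightarrow> (nat \<times> role \<times> nat) set" where
  "unused n k = {(n', r, i). (n < n' \<or> n' = n \<and> k < i) \<and> i \<in> {1..N}}"

lemma unused_subset: "unused n k \<subseteq> UNIV \<times> UNIV \<times> {1..N}"
  by (auto simp: unused_def)

lemma unused_0_0: "unused 0 0 = UNIV \<times> UNIV \<times> {1..N}"
  by (auto simp: unused_def)

lemma unused_N: "unused n N = unused (Suc n) 0"
  by (auto simp: unused_def)

lemma unused_Suc:
  "unused n k - {(n, Visit, Suc k)} - {(n, Duration, Suc k)} - {(n, Inflow, Suc k)} = unused n (Suc k)"
proof -
  have "r = Visit \<or> r = Duration \<or> r = Inflow" for r by (cases r) auto
  then show ?thesis by (auto simp: unused_def)
qed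

lemma N_pos: "N \<in> {1..N}" "0 < N"
  by (auto simp: N Suc_le_eq)

lemma freshI': "indep_rv P borel Y (PiM (UNIV \<times> UNIV \<times> {1..N}) (\<lambda>_. M))
    (\<lambda>\<omega>. \<lambda>k\<in>UNIV \<times> UNIV \<times> {1..N}. \<xi> k \<omega>) \<Longrightarrow> fresh P M \<xi> (unused 0 0) borel Y"
  unfolding unused_0_0 by (rule C.freshI) (use N_pos in auto)

text \<open>Serves two purposes: with \<open>Y\<close> the n-th embedded workload it is a step of
  the chain, with n = 0 and \<open>Y\<close> equal to \<open>B1\<close> it is the stationary
  cycle.\<close>

definition cyc :: "nat \<Rightarrow> ('p \<Rightarrow> real ^ 'n) \<Rightarrow> nat \<Rightarrow> 'p \<Rightarrow> real ^ 'n" where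
  "cyc n Y k \<omega> = reg.workload (\<lambda>r i. \<xi> (n, r, i) \<omega>) (Y \<omega>) k"

definition cyc_end :: "nat \<Rightarrow> ('p \<Rightarrow> real ^ 'n) \<Rightarrow> nat \<Rightarrow> 'p \<Rightarrow> real ^ 'n" where
  "cyc_end n Y k \<omega> = visit (Suc k) (cyc n Y k \<omega>) (\<xi> (n, Visit, Suc k) \<omega>)"

lemma cyc_0: "cyc n Y 0 = Y"
  by (simp add: cyc_def fun_eq_iff)

lemma cyc_Suc: "cyc n Y (Suc k) = (\<lambda>\<omega>. cyc_end n Y k \<omega> +
    W' (S' (Suc k) (\<xi> (n, Duration, Suc k) \<omega>)) (\<xi> (n, Inflow, Suc k) \<omega>))"
  by (simp add: cyc_def cyc_end_def fun_eq_iff reg_after_visit)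

context
  fixes n :: nat and Y :: "'p \<Rightarrow> real ^ 'n"
  assumes Y: "fresh P M \<xi> (unused n 0) borel Y" and Y_nonneg: "AE \<omega> in P. 0 \<le> Y \<omega>"
begin

lemma visit_step:
  assumes k: "k < N" and f: "fresh P M \<xi> (unused n k) borel (cyc n Y k)" and nn: "AE \<omega> in P. 0 \<le> cyc n Y k \<omega>"
  shows "fresh P M \<xi> (unused n k - {(n, Visit, Suc k)}) borel (cyc_end n Y k)"
    and "AE \<omega> in P. 0 \<le> cyc_end n Y k \<omega>"
proof -
  have v: "(n, Visit, Suc k) \<in> unused n k" and i: "Suc k \<in> {1..N}" using k by (auto simp: unused_def)
  show "fresh P M \<xi> (unused n k - {(n, Visit, Suc k)}) borel (cyc_end n Y k)"
    using fresh_visit[OF unused_subset f nn v i] by (simp add: cyc_end_def[abs_def])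
  show "AE \<omega> in P. 0 \<le> cyc_end n Y k \<omega>"
    using AE_visit_nonneg[OF unused_subset f nn v i] by (simp add: cyc_end_def)
qed

lemma switch_indices:
  assumes "k < N"
  shows "unused n k - {(n, Visit, Suc k)} \<subseteq> UNIV \<times> UNIV \<times> {1..N}"
    "(n, Duration, Suc k) \<in> unused n k - {(n, Visit, Suc k)}"
    "(n, Inflow, Suc k) \<in> unused n k - {(n, Visit, Suc k)}" "(n, Inflow, Suc k) \<noteq> (n, Duration, Suc k)"
    "Suc k \<in> {1..N}"
  using assms unused_subset by (auto simp: unused_def)

lemma cyc_fresh: "k \<le> N \<Longrightarrow> fresh P M \<xi> (unused n k) borel (cyc n Y k) \<and> (AE \<omega> in P. 0 \<le> cyc n Y k \<omega>)"
proof (induction k)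
  case 0 then show ?case using Y Y_nonneg by (simp add: cyc_0)
next
  case (Suc k)
  then have k: "k < N" and f: "fresh P M \<xi> (unused n k) borel (cyc n Y k)" and nn: "AE \<omega> in P. 0 \<le> cyc n Y k \<omega>" by auto
  note E = visit_step[OF k f nn]
  note s = switch_indices[OF k]
  show ?case
    using fresh_switch[OF s(1) E s(2-5)] AE_switch_nonneg[OF s(1) E s(2-5)]
    unfolding cyc_Suc unused_Suc by simp
qed

lemma cyc_measurable: "k \<le> N \<Longrightarrow> cyc n Y k \<in> borel_measurable P"
  using cyc_fresh by (auto simp: fresh_def)

lemma cyc_end_fresh: "k < N \<Longrightarrow> fresh P M \<xi> (unused n k - {(n, Visit, Suc k)}) borel (cyc_end n Y k)"
    "k < N \<Longrightarrow> AE \<omega> in P. 0 \<le> cyc_end n Y k \<omega>"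
  using visit_step cyc_fresh by auto

lemma cyc_end_measurable: "k < N \<Longrightarrow> cyc_end n Y k \<in> borel_measurable P"
  using cyc_end_fresh by (auto simp: fresh_def)

lemma lst_cyc_end:
  assumes k: "k < N" and u: "0 \<le> u"
  shows "lst P (cyc_end n Y k) u = lst P (cyc n Y k) (vec_upd u (q (Suc k)) (\<eta> (Suc k) u))"
proof -
  have v: "(n, Visit, Suc k) \<in> unused n k" and i: "Suc k \<in> {1..N}" using k by (auto simp: unused_def)
  show ?thesis
    using lst_visit[OF unused_subset _ _ v i u, of "cyc n Y k"] cyc_fresh[of k] k by (simp add: cyc_end_def[abs_def])
qed

lemma lst_cyc_Suc:
  assumes k: "k < N" and u: "0 \<le> u"
  shows "lst P (cyc n Y (Suc k)) u = lst P (cyc_end n Y k) u * lst M (S (Suc k)) (\<phi> u)"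
  unfolding cyc_Suc
  by (rule lst_switch[OF switch_indices(1)[OF k] cyc_end_fresh[OF k] switch_indices(2-5)[OF k] u])

text \<open>The cycle is read backwards from queue N. Undoing a switch-over period splits off a
  factor at the current argument, and undoing a visit replaces one coordinate of the argument by an
  exponent, which is precisely a step of \<open>kappa_rec\<close>.\<close>

lemma lst_cyc_rec:
  assumes u: "0 \<le> u"
  shows "k \<le> N \<Longrightarrow> lst P (cyc n Y N) u = lst P (cyc n Y (N - k)) (kappa_rec q \<eta> u k) *
    (\<Prod>i\<in>{Suc (N - k)..N}. lst M (S i) (\<phi> (kappa_tail q \<eta> i u)))"
proof (induction k)
  case (Suc k)
  \<comment> \<open>Step k of the recursion handles queue N - k, which is
    \<open>Suc i\<close>.\<close>
  define i where "i = N - Suc k"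
  have i: "Suc i = N - k" "i < N" using Suc.prems by (auto simp: i_def)
  define v where "v = kappa_rec q \<eta> u k"
  have v: "0 \<le> v" unfolding v_def
    using Suc.prems u subordinator_exponent_\<eta> by (intro kappa_rec_nonneg) (auto simp: N)
  have "kappa_rec q \<eta> u (CARD('n) - Suc i) = kappa_tail q \<eta> (Suc i) u"
    using q i by (intro kappa_rec_eq_tail) (auto simp: N)
  then have vt: "kappa_tail q \<eta> (Suc i) u = v" using i Suc.prems by (simp add: v_def N)
  have vS: "vec_upd v (q (Suc i)) (\<eta> (Suc i) v) = kappa_rec q \<eta> u (Suc k)"
    unfolding i(1) by (simp add: Let_def v_def N)
  have "lst P (cyc n Y N) u = lst P (cyc n Y (Suc i)) v * (\<Prod>i\<in>{Suc (N - k)..N}. lst M (S i) (\<phi> (kappa_tail q \<eta> i u)))"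
    using Suc by (simp add: v_def i(1))
  also have "lst P (cyc n Y (Suc i)) v = lst P (cyc n Y i) (kappa_rec q \<eta> u (Suc k)) * lst M (S (Suc i)) (\<phi> (kappa_tail q \<eta> (Suc i) u))"
    by (simp only: lst_cyc_Suc[OF i(2) v] lst_cyc_end[OF i(2) v] vS vt)
  also have "\<dots> * (\<Prod>i\<in>{Suc (N - k)..N}. lst M (S i) (\<phi> (kappa_tail q \<eta> i u)))
    = lst P (cyc n Y i) (kappa_rec q \<eta> u (Suc k)) * (\<Prod>i\<in>{Suc i..N}. lst M (S i) (\<phi> (kappa_tail q \<eta> i u)))"
  proof -
    have "{Suc i..N} = insert (Suc i) {Suc (N - k)..N}" using i by auto
    moreover have "Suc i \<notin> {Suc (N - k)..N}" using i by auto
    ultimately show ?thesis by (simp add: mult.assoc)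
  qed
  finally show ?case by (simp add: i_def)
qed simp

lemma lst_cycle:
  assumes u: "0 \<le> u"
  shows "lst P (cyc n Y N) u = lst P Y (kappa q \<eta> u) * immigration_lst M q S \<phi> \<eta> u"
  using lst_cyc_rec[OF u, of N] by (simp add: cyc_0 kappa_def immigration_lst_def N[symmetric])

end

definition emb :: "nat \<Rightarrow> 'p \<Rightarrow> real ^ 'n" where
  "emb n \<omega> = reg.embedded (\<lambda>n r i. \<xi> (n, r, i) \<omega>) (X0 \<omega>) n"

lemma emb_Suc: "emb (Suc n) = cyc n (emb n) N"
  by (simp add: emb_def cyc_def fun_eq_iff N[symmetric])

lemma emb_fresh: "fresh P M \<xi> (unused n 0) borel (emb n) \<and> (AE \<omega> in P. 0 \<le> emb n \<omega>)"
proof (induction n)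
  case 0
  have "emb 0 = X0" by (simp add: emb_def fun_eq_iff)
  then show ?case using freshI'[OF X0(2)] X0(1) by simp
next
  case (Suc n)
  then show ?case using cyc_fresh[of n "emb n" N] unfolding emb_Suc unused_N by simp
qed

lemma emb_measurable [measurable]: "emb n \<in> borel_measurable P"
  using emb_fresh by (auto simp: fresh_def)

lemma lst_emb_Suc: "0 \<le> u \<Longrightarrow> lst P (emb (Suc n)) u = lst P (emb n) (kappa q \<eta> u) * immigration_lst M q S \<phi> \<eta> u"
  unfolding emb_Suc using emb_fresh by (intro lst_cycle) auto

lemma subordinator_exponent_\<eta>': "i \<in> {1..CARD('n)} \<Longrightarrow> subordinator_exponent (\<eta> i)"
  using subordinator_exponent_\<eta> by (simp add: N)

lemma kappa_nonneg': "0 \<le> u \<Longrightarrow> 0 \<le> kappa q \<eta> u"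
  by (rule kappa_nonneg[OF subordinator_exponent_\<eta>'])

lemma lst_emb: "0 \<le> u \<Longrightarrow> lst P (emb n) u = lst P X0 ((kappa q \<eta> ^^ n) u) * (\<Prod>k<n. immigration_lst M q S \<phi> \<eta> ((kappa q \<eta> ^^ k) u))"
proof (induction n arbitrary: u)
  case 0
  have "emb 0 = X0" by (simp add: emb_def fun_eq_iff)
  then show ?case by simp
next
  case (Suc n)
  have "lst P (emb (Suc n)) u = lst P X0 ((kappa q \<eta> ^^ n) (kappa q \<eta> u)) *
    (\<Prod>k<n. immigration_lst M q S \<phi> \<eta> ((kappa q \<eta> ^^ k) (kappa q \<eta> u))) * immigration_lst M q S \<phi> \<eta> u"
    by (simp only: lst_emb_Suc[OF Suc.prems] Suc.IH[OF kappa_nonneg'[OF Suc.prems]])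
  then show ?case unfolding prod.lessThan_Suc_shift by (simp add: funpow_swap1 ac_simps)
qed

section \<open>Transfer between the original and the modified chain\<close>

lemma AE_regular_copies: "AE \<omega> in P. \<forall>k\<in>UNIV \<times> UNIV \<times> {1..N}. \<xi> k \<omega> \<in> \<Omega>"
proof (rule AE_ball_countable[THEN iffD2, OF _ ballI])
  have "countable (UNIV :: role set)"
  proof -
    have "(UNIV :: role set) = {Visit, Inflow, Duration}" using role.exhaust by auto
    then show ?thesis by (metis countable_finite finite.emptyI finite_insert)
  qed
  then show "countable (UNIV \<times> UNIV \<times> {1..N} :: (nat \<times> role \<times> nat) set)"
    by (intro countable_SIGMA) auto
  fix k assume k: "k \<in> (UNIV :: nat set) \<times> (UNIV :: role set) \<times> {1..N}"
  have "AE a in distr P M (\<xi> k). a \<in> \<Omega>" by (subst C.copies(2)[OF k]) (rule \<Omega>(2))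
  then show "AE \<omega> in P. \<xi> k \<omega> \<in> \<Omega>" using C.copies(1)[OF k] by (subst (asm) AE_distr_iff) auto
qed

text \<open>Nonnegativity is part of the induction, since the modified replacement agrees with the
  given one only for nonnegative workloads.\<close>

lemma (in polling_copies) workload_regular:
  assumes d: "\<And>r i. i \<in> {1..N} \<Longrightarrow> d r i \<in> \<Omega>" and x: "0 \<le> x"
  shows "k \<le> N \<Longrightarrow> workload d x k = reg.workload d x k \<and> 0 \<le> reg.workload d x k"
proof (induction k)
  case (Suc k)
  have i: "Suc k \<in> {1..N}" using Suc.prems by auto
  define y where "y = reg.workload d x k"
  have y: "workload d x k = y" "0 \<le> y" using Suc by (auto simp: y_def)
  have yi: "0 \<le> y $ q (Suc k)" using y by (simp add: vec_le_def)
  have "after_visit (Suc k) y (d Visit (Suc k)) = visit (Suc k) y (d Visit (Suc k))"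
    by (simp add: after_visit_def visit_def R_eq_replacement[OF yi d[OF i]])
  moreover have "S (Suc k) (d Duration (Suc k)) = S' (Suc k) (d Duration (Suc k))" using d[OF i] by (simp add: S'_def)
  moreover have "W s (d Inflow (Suc k)) = W' s (d Inflow (Suc k))" if "0 \<le> s" for s
    using d[OF i] that by (simp add: W'_def)
  ultimately show ?case
    using S'_nonneg[OF i] W'_nonneg visit_nonneg[OF i y(2)]
    by (simp add: y y_def[symmetric] reg_after_visit)
qed (use x in simp)

lemma AE_embedded: "AE \<omega> in P. \<forall>n. embedded (\<lambda>n r i. \<xi> (n, r, i) \<omega>) (X0 \<omega>) n = emb n \<omega> \<and> 0 \<le> emb n \<omega>"
  using AE_regular_copies X0(1)
proof eventually_elim
  case (elim \<omega>)
  have "embedded (\<lambda>n r i. \<xi> (n, r, i) \<omega>) (X0 \<omega>) n = emb n \<omega> \<and> 0 \<le> emb n \<omega>" for n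
  proof (induction n)
    case (Suc n)
    have "workload (\<lambda>r i. \<xi> (n, r, i) \<omega>) (emb n \<omega>) N = reg.workload (\<lambda>r i. \<xi> (n, r, i) \<omega>) (emb n \<omega>) N
      \<and> 0 \<le> reg.workload (\<lambda>r i. \<xi> (n, r, i) \<omega>) (emb n \<omega>) N"
      using elim(1) Suc by (intro workload_regular) auto
    then show ?case using Suc by (simp add: emb_def N[symmetric])
  qed (use elim in \<open>simp add: emb_def\<close>)
  then show ?case by blast
qed

text \<open>Convergence in distribution is assumed for the original chain and needed for the
  modified one. The two agree almost surely, and completeness gives the measurability required to
  compare the integrals.\<close>

lemma limit_test_function:
  fixes f :: "real ^ 'n \<Rightarrow> real"
  assumes "continuous_on UNIV f" "bounded (range f)"
  shows "(\<lambda>n. \<integral>\<omega>. f (emb n \<omega>) \<partial>P) \<longlonglongrightarrow> (\<integral>\<omega>. f (B1 \<omega>) \<partial>P)"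
proof -
  have [measurable]: "f \<in> borel_measurable borel" using assms(1) by (rule borel_measurable_continuous_onI)
  have "(\<integral>\<omega>. f (embedded (\<lambda>n r i. \<xi> (n, r, i) \<omega>) (X0 \<omega>) n) \<partial>P) = (\<integral>\<omega>. f (emb n \<omega>) \<partial>P)" for n
  proof (rule integral_cong_AE)
    show "AE \<omega> in P. f (embedded (\<lambda>n r i. \<xi> (n, r, i) \<omega>) (X0 \<omega>) n) = f (emb n \<omega>)"
      using AE_embedded by eventually_elim auto
    then show "(\<lambda>\<omega>. f (embedded (\<lambda>n r i. \<xi> (n, r, i) \<omega>) (X0 \<omega>) n)) \<in> borel_measurable P"
      by (rule measurable_AE_complete[OF complete, where g = "\<lambda>\<omega>. f (emb n \<omega>)", rotated]) (simp, measurable)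
  qed measurable
  then show ?thesis using B1(2)[unfolded converges_in_distribution_def, rule_format, OF conjI[OF assms]] by simp
qed

lemma B1_measurable [measurable]: "B1 \<in> borel_measurable P"
  using B1(1) by (simp add: indep_rv_def)

lemma B1_fresh: "fresh P M \<xi> (unused 0 0) borel B1"
  by (rule freshI'[OF B1(1)])

text \<open>The function exp(- u x) is unbounded on the whole space; composed with
  \<open>pos_part\<close> it is a bounded continuous test function with unchanged values on the
  nonnegative orthant.\<close>

definition pos_part :: "real ^ 'n \<Rightarrow> real ^ 'n" where
  "pos_part x = (\<chi> k. max (x $ k) 0)"

lemma pos_part: "0 \<le> pos_part x" "0 \<le> x \<Longrightarrow> pos_part x = x" "pos_part x = x \<Longrightarrow> 0 \<le> x"
    "continuous_on UNIV pos_part"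
proof -
  show "0 \<le> pos_part x" by (auto simp: pos_part_def vec_le_def)
  then show "pos_part x = x \<Longrightarrow> 0 \<le> x" by simp
  show "0 \<le> x \<Longrightarrow> pos_part x = x"
    by (auto simp: pos_part_def vec_le_def Finite_Cartesian_Product.vec_eq_iff max_def intro: antisym)
  show "continuous_on UNIV pos_part"
    unfolding pos_part_def by (intro continuous_intros continuous_on_vec_lambda)
qed

text \<open>The nonnegative orthant is closed: the truncated distance from x to
  \<open>pos_part x\<close> is a bounded continuous function vanishing exactly there, and its mean
  passes to the limit.\<close>

lemma B1_nonneg: "AE \<omega> in P. 0 \<le> B1 \<omega>"
proof -
  let ?f = "\<lambda>x. min 1 (norm (pos_part x - x))"
  have c: "continuous_on UNIV ?f" by (intro continuous_intros pos_part)
  have [measurable]: "?f \<in> borel_measurable borel" using c by (rule borel_measurable_continuous_onI)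
  have "bounded (range ?f)" by (intro boundedI[of _ 1]) auto
  from limit_test_function[OF c this]
  have "(\<lambda>n. \<integral>\<omega>. ?f (emb n \<omega>) \<partial>P) \<longlonglongrightarrow> (\<integral>\<omega>. ?f (B1 \<omega>) \<partial>P)" .
  moreover have "(\<integral>\<omega>. ?f (emb n \<omega>) \<partial>P) = 0" for n
  proof -
    have "AE \<omega> in P. ?f (emb n \<omega>) = 0" using emb_fresh[of n, THEN conjunct2] by eventually_elim (simp add: pos_part(2))
    then have "(\<integral>\<omega>. ?f (emb n \<omega>) \<partial>P) = (\<integral>\<omega>. 0 \<partial>P)" by (intro integral_cong_AE) measurable
    then show ?thesis by simp
  qed
  ultimately have z: "(\<integral>\<omega>. ?f (B1 \<omega>) \<partial>P) = 0" by (simp add: LIMSEQ_const_iff)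
  have "integrable P (\<lambda>\<omega>. ?f (B1 \<omega>))" by (rule C.integrable_const_bound[where B=1]) auto
  then have "AE \<omega> in P. ?f (B1 \<omega>) = 0" using z by (subst (asm) integral_nonneg_eq_0_iff_AE) auto
  then show ?thesis
  proof eventually_elim
    case (elim \<omega>)
    then have "pos_part (B1 \<omega>) = B1 \<omega>" by (simp add: min_def split: if_splits)
    then show ?case by (rule pos_part(3))
  qed
qed

lemma lst_emb_limit:
  assumes u: "0 \<le> u"
  shows "(\<lambda>n. lst P (emb n) u) \<longlonglongrightarrow> lst P B1 u"
proof -
  let ?f = "\<lambda>x. exp (- inner u (pos_part x))"
  have c: "continuous_on UNIV ?f" by (intro continuous_intros pos_part)
  have [measurable]: "?f \<in> borel_measurable borel" using c by (rule borel_measurable_continuous_onI)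
  have "bounded (range ?f)" by (intro boundedI[of _ 1]) (auto simp: inner_nonneg_vec u pos_part)
  from limit_test_function[OF c this]
  have "(\<lambda>n. \<integral>\<omega>. ?f (emb n \<omega>) \<partial>P) \<longlonglongrightarrow> (\<integral>\<omega>. ?f (B1 \<omega>) \<partial>P)" .
  moreover have "(\<integral>\<omega>. ?f (Z \<omega>) \<partial>P) = lst P Z u" if [measurable]: "Z \<in> borel_measurable P" and Z: "AE \<omega> in P. 0 \<le> Z \<omega>" for Z
    unfolding lst_def
  proof (rule integral_cong_AE)
    show "AE \<omega> in P. ?f (Z \<omega>) = exp (- inner u (Z \<omega>))" using Z by eventually_elim (simp add: pos_part)
  qed measurable
  ultimately show ?thesis using emb_fresh B1_nonneg by (simp add: emb_measurable)
qed

section \<open>The infinite product and finite means in the stationary cycle\<close>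

definition mean_immigration :: real where "mean_immigration = (\<integral>\<omega>. norm (G \<omega>) \<partial>P)"

lemma one_minus_immigration_lst_le: "0 \<le> mean_immigration" "0 \<le> u \<Longrightarrow> 1 - immigration_lst M q S \<phi> \<eta> u \<le> total u * mean_immigration"
  unfolding mean_immigration_def using one_minus_lst_le[OF C.prob_space_axioms G(1,2) _ G(4), of u] G(3) by auto

lemma immigration_le_1: "0 \<le> u \<Longrightarrow> immigration_lst M q S \<phi> \<eta> u \<le> 1"
  using lst_le_1[OF C.prob_space_axioms G(1,2)] G(3) by metis

lemma kappa_geometric: "\<exists>c \<rho>. 0 \<le> c \<and> 0 < \<rho> \<and> \<rho> < 1 \<and>
    (\<forall>u\<ge>0. \<forall>k. 0 \<le> (kappa q \<eta> ^^ k) u \<and> total ((kappa q \<eta> ^^ k) u) \<le> c * \<rho> ^ k * total u)"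
  by (rule kappa_iterates_geometric[OF subordinator_exponent_\<eta>' N q m spectral])

lemma X0_measurable [measurable]: "X0 \<in> borel_measurable P"
  using X0(2) by (simp add: indep_rv_def)

text \<open>The initial workload is forgotten because the iterates of \<kappa> tend to 0. Dominated
  convergence is used, as \<open>X0\<close> need not have a mean.\<close>

lemma lst_X0_limit:
  assumes u: "0 \<le> u"
  shows "(\<lambda>n. lst P X0 ((kappa q \<eta> ^^ n) u)) \<longlonglongrightarrow> 1"
proof -
  obtain c \<rho> where c: "0 \<le> c" "0 < \<rho>" "\<rho> < 1"
    and k: "\<And>u k. 0 \<le> u \<Longrightarrow> 0 \<le> (kappa q \<eta> ^^ k) u \<and> total ((kappa q \<eta> ^^ k) u) \<le> c * \<rho> ^ k * total u"
    using kappa_geometric by blast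
  have "(\<lambda>n. \<integral>\<omega>. exp (- inner ((kappa q \<eta> ^^ n) u) (X0 \<omega>)) \<partial>P) \<longlonglongrightarrow> (\<integral>\<omega>. 1 \<partial>P)"
  proof (rule integral_dominated_convergence[where w="\<lambda>_. 1"])
    show "AE \<omega> in P. norm (exp (- inner ((kappa q \<eta> ^^ n) u) (X0 \<omega>))) \<le> 1" for n
      using X0(1) by eventually_elim (simp add: inner_nonneg_vec k[OF u])
    show "AE \<omega> in P. (\<lambda>n. exp (- inner ((kappa q \<eta> ^^ n) u) (X0 \<omega>))) \<longlonglongrightarrow> 1"
      using X0(1)
    proof eventually_elim
      case (elim \<omega>)
      have "(\<lambda>n. inner ((kappa q \<eta> ^^ n) u) (X0 \<omega>)) \<longlonglongrightarrow> 0"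
      proof (rule tendsto_sandwich[of "\<lambda>_. 0" _ _ "\<lambda>n. c * \<rho> ^ n * total u * norm (X0 \<omega>)"])
        show "\<forall>\<^sub>F n in sequentially. inner ((kappa q \<eta> ^^ n) u) (X0 \<omega>) \<le> c * \<rho> ^ n * total u * norm (X0 \<omega>)"
        proof (intro always_eventually allI)
          fix n
          have "inner ((kappa q \<eta> ^^ n) u) (X0 \<omega>) \<le> total ((kappa q \<eta> ^^ n) u) * norm (X0 \<omega>)"
            using k[OF u] by (intro inner_le_total) auto
          also have "\<dots> \<le> c * \<rho> ^ n * total u * norm (X0 \<omega>)" using k[OF u] by (intro mult_right_mono) auto
          finally show "inner ((kappa q \<eta> ^^ n) u) (X0 \<omega>) \<le> c * \<rho> ^ n * total u * norm (X0 \<omega>)" .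
        qed
        have "(\<lambda>n. c * \<rho> ^ n * total u * norm (X0 \<omega>)) \<longlonglongrightarrow> c * 0 * total u * norm (X0 \<omega>)"
          using c by (intro tendsto_intros LIMSEQ_power_zero) auto
        then show "(\<lambda>n. c * \<rho> ^ n * total u * norm (X0 \<omega>)) \<longlonglongrightarrow> 0" by simp
      qed (use elim k[OF u] in \<open>auto intro!: always_eventually inner_nonneg_vec\<close>)
      from tendsto_exp[OF tendsto_minus[OF this]] show ?case by simp
    qed
  qed auto
  then show ?thesis by (simp add: lst_def C.prob_space)
qed

lemma immigration_product_limit:
  assumes u: "0 \<le> u"
  shows "(\<lambda>n. \<Prod>k<n. immigration_lst M q S \<phi> \<eta> ((kappa q \<eta> ^^ k) u)) \<longlonglongrightarrow> lst P B1 u"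
proof -
  let ?x = "\<lambda>n. lst P X0 ((kappa q \<eta> ^^ n) u)"
  have nn: "0 \<le> (kappa q \<eta> ^^ n) u" for n
    using u by (induction n) (auto intro: kappa_nonneg')
  have pos: "?x n \<noteq> 0" for n
    using lst_pos[OF C.prob_space_axioms X0_measurable X0(1) nn[of n]] by simp
  have "(\<lambda>n. lst P (emb n) u / ?x n) \<longlonglongrightarrow> lst P B1 u / 1"
    by (intro tendsto_divide lst_emb_limit lst_X0_limit u) simp
  then show ?thesis using pos by (simp add: lst_emb[OF u])
qed

text \<open>\<open>has_prod\<close> requires more than convergence of the partial products: here the
  limit must be nonzero, which holds because a transform of a nonnegative vector is
  positive.\<close>

lemma immigration_has_prod:
  assumes u: "0 \<le> u"
  shows "(\<lambda>k. immigration_lst M q S \<phi> \<eta> ((kappa q \<eta> ^^ k) u)) has_prod lst P B1 u"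
proof -
  have "lst P B1 u \<noteq> 0"
    using lst_pos[OF C.prob_space_axioms B1_measurable B1_nonneg u] by simp
  moreover have "(\<lambda>n. \<Prod>k\<le>n. immigration_lst M q S \<phi> \<eta> ((kappa q \<eta> ^^ k) u)) \<longlonglongrightarrow> lst P B1 u"
    using LIMSEQ_Suc[OF immigration_product_limit[OF u]] by (simp add: lessThan_Suc_atMost)
  ultimately show ?thesis by (simp add: has_prod_def raw_has_prod_def)
qed

lemma lst_B1_stationary:
  assumes u: "0 \<le> u"
  shows "lst P B1 u = lst P B1 (kappa q \<eta> u) * immigration_lst M q S \<phi> \<eta> u"
proof (rule LIMSEQ_unique[OF LIMSEQ_Suc[OF lst_emb_limit[OF u]]])
  show "(\<lambda>n. lst P (emb (Suc n)) u) \<longlonglongrightarrow> lst P B1 (kappa q \<eta> u) * immigration_lst M q S \<phi> \<eta> u"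
    unfolding lst_emb_Suc[OF u] by (intro tendsto_intros lst_emb_limit kappa_nonneg' u)
qed

lemma one_minus_prod_le:
  fixes f :: "nat \<Rightarrow> real"
  assumes "\<And>k. 0 \<le> f k" "\<And>k. f k \<le> 1"
  shows "1 - (\<Prod>k<n. f k) \<le> (\<Sum>k<n. 1 - f k)"
proof (induction n)
  case (Suc n)
  have p: "(\<Prod>k<n. f k) \<le> 1" using assms by (intro prod_le_1) auto
  have "0 \<le> (1 - (\<Prod>k<n. f k)) * (1 - f n)" using p assms by (intro mult_nonneg_nonneg) auto
  then have "1 - (\<Prod>k<n. f k) * f n \<le> (1 - (\<Prod>k<n. f k)) + (1 - f n)" by (simp add: algebra_simps)
  then show ?case using Suc by simp
qed simp

text \<open>One minus a product of numbers in [0, 1] is at most the sum of the defects. Each defect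
  is bounded by the mean immigration times the size of an iterate of \<kappa>, and the geometric
  series sums up. By \<open>integrable_norm_linear\<close> this is a finite mean of
  \<open>B1\<close>.\<close>

lemma B1_linear: "\<exists>c\<ge>0. \<forall>u\<ge>0. 1 - lst P B1 u \<le> c * total u"
proof -
  obtain c \<rho> where c: "0 \<le> c" "0 < \<rho>" "\<rho> < 1"
    and k: "\<And>u k. 0 \<le> u \<Longrightarrow> 0 \<le> (kappa q \<eta> ^^ k) u \<and> total ((kappa q \<eta> ^^ k) u) \<le> c * \<rho> ^ k * total u"
    using kappa_geometric by blast
  have "1 - lst P B1 u \<le> mean_immigration * c / (1 - \<rho>) * total u" if u: "0 \<le> u" for u
  proof (rule LIMSEQ_le_const2[OF tendsto_diff[OF tendsto_const immigration_product_limit[OF u]]])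
    have tot: "0 \<le> total u" using u by (auto simp: vec_le_def intro: sum_nonneg)
    have "1 - (\<Prod>k<n. immigration_lst M q S \<phi> \<eta> ((kappa q \<eta> ^^ k) u)) \<le> mean_immigration * c / (1 - \<rho>) * total u" for n
    proof -
      have "1 - (\<Prod>k<n. immigration_lst M q S \<phi> \<eta> ((kappa q \<eta> ^^ k) u))
        \<le> (\<Sum>k<n. 1 - immigration_lst M q S \<phi> \<eta> ((kappa q \<eta> ^^ k) u))"
        using k[OF u] immigration_le_1 immigration_lst_bounds(1)
        by (intro one_minus_prod_le) (auto intro: less_imp_le)
      also have "\<dots> \<le> (\<Sum>k<n. c * \<rho> ^ k * total u * mean_immigration)"
      proof (intro sum_mono)
        fix j
        have "1 - immigration_lst M q S \<phi> \<eta> ((kappa q \<eta> ^^ j) u) \<le> total ((kappa q \<eta> ^^ j) u) * mean_immigration"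
          using k[OF u] by (intro one_minus_immigration_lst_le) auto
        also have "\<dots> \<le> c * \<rho> ^ j * total u * mean_immigration" using k[OF u] one_minus_immigration_lst_le(1) by (intro mult_right_mono) auto
        finally show "1 - immigration_lst M q S \<phi> \<eta> ((kappa q \<eta> ^^ j) u) \<le> c * \<rho> ^ j * total u * mean_immigration" .
      qed
      also have "\<dots> = mean_immigration * c * total u * (\<Sum>k<n. \<rho> ^ k)"
        unfolding sum_distrib_left[of "mean_immigration * c * total u"] by (intro sum.cong refl) (simp only: ac_simps)
      also have "\<dots> \<le> mean_immigration * c * total u * (1 / (1 - \<rho>))"
      proof (intro mult_left_mono)
        have "(\<Sum>k<n. \<rho> ^ k) \<le> (\<Sum>k. \<rho> ^ k)" using c by (intro sum_le_suminf summable_geometric) auto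
        then show "(\<Sum>k<n. \<rho> ^ k) \<le> 1 / (1 - \<rho>)" using c by (simp add: suminf_geometric)
      qed (use one_minus_immigration_lst_le(1) c tot in auto)
      finally show ?thesis by (simp add: ac_simps)
    qed
    then show "\<exists>n0. \<forall>n\<ge>n0. 1 - (\<Prod>k<n. immigration_lst M q S \<phi> \<eta> ((kappa q \<eta> ^^ k) u)) \<le> mean_immigration * c / (1 - \<rho>) * total u" by blast
  qed
  then show ?thesis using one_minus_immigration_lst_le(1) c by (intro exI[of _ "mean_immigration * c / (1 - \<rho>)"]) auto
qed

lemma integrable_norm_linear:
  fixes Z :: "'p \<Rightarrow> real ^ 'n"
  assumes "Z \<in> borel_measurable P" "AE \<omega> in P. 0 \<le> Z \<omega>" and c: "\<And>u. 0 \<le> u \<Longrightarrow> 1 - lst P Z u \<le> c * total u"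
  shows "integrable P (\<lambda>\<omega>. norm (Z \<omega>))"
proof (rule integrable_norm_of_lst[OF C.prob_space_axioms assms(1,2)])
  have "1 - lst P Z (hseq n *\<^sub>R (\<chi> k. 1)) \<le> c * real CARD('n) * hseq n" for n
    using c[of "hseq n *\<^sub>R (\<chi> k. 1)"] hseq[of n] by (simp add: vec_le_def)
  then show "\<forall>\<^sub>F n in sequentially. 1 - lst P Z (hseq n *\<^sub>R (\<chi> k. 1)) \<le> c * real CARD('n) * hseq n" by simp
qed

text \<open>The linear bound on 1 - transform survives each period: a visit enlarges the argument by
  the linearly bounded \<eta>, and a switch-over period adds a defect governed by the linearly
  bounded \<phi>. This makes the means in the denominator genuine.\<close>

lemma cyc_integrable: "k \<le> N \<Longrightarrow> integrable P (\<lambda>\<omega>. norm (cyc 0 B1 k \<omega>))"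
proof (induction k)
  case 0
  then show ?case using B1_linear B1_nonneg by (auto simp: cyc_0 intro!: integrable_norm_linear)
next
  case (Suc k)
  then have k: "k < N" by simp
  have i: "Suc k \<in> {1..N}" using k by auto
  note f = cyc_fresh[OF B1_fresh B1_nonneg]
  have meas: "cyc 0 B1 k \<in> borel_measurable P" "cyc 0 B1 (Suc k) \<in> borel_measurable P"
    using f[of k] f[of "Suc k"] k by (auto simp: fresh_def)
  obtain a where a: "0 \<le> a" "\<And>u. 0 \<le> u \<Longrightarrow> \<phi> u \<le> a * total u" using \<phi>_linear_bound[OF one_minus_immigration_lst_le] by blast
  obtain b where b: "0 \<le> b" "\<And>u. 0 \<le> u \<Longrightarrow> \<eta> (Suc k) u \<le> b * total u"
    using \<eta>_linear_bound[OF i \<phi>_linear_bound[OF one_minus_immigration_lst_le]] by blast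
  define e where "e = (\<integral>\<omega>. norm (cyc 0 B1 k \<omega>) \<partial>P)"
  define s where "s = (\<integral>\<omega>. S (Suc k) \<omega> \<partial>M)"
  have e0: "0 \<le> e" by (simp add: e_def)
  have "AE \<omega> in M. 0 < S (Suc k) \<omega>" using S i by auto
  then have s0: "0 \<le> s" unfolding s_def by (intro integral_nonneg_AE, eventually_elim) simp
  show ?case
  proof (rule integrable_norm_linear[OF meas(2)])
    show "AE \<omega> in P. 0 \<le> cyc 0 B1 (Suc k) \<omega>" using f[of "Suc k"] Suc.prems by simp
    fix u :: "real ^ 'n" assume u: "0 \<le> u"
    have tot: "0 \<le> total u" using u by (auto simp: vec_le_def intro: sum_nonneg)
    define v where "v = vec_upd u (q (Suc k)) (\<eta> (Suc k) u)"
    have \<eta>0: "0 \<le> \<eta> (Suc k) u" by (rule subordinator_exponentD(1)[OF subordinator_exponent_\<eta>[OF i] u])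
    have \<phi>0: "0 \<le> \<phi> u" by (rule subordinator_exponentD(1)[OF subordinator_exponent_\<phi> u])
    have v: "0 \<le> v" unfolding v_def using u \<eta>0 by (rule vec_upd_nonneg)
    have "total v \<le> total (u + \<eta> (Suc k) u *\<^sub>R axis (q (Suc k)) 1)"
      using u by (intro sum_mono) (auto simp: v_def vec_upd_def axis_def vec_le_def)
    also have "\<dots> = total u + total (\<eta> (Suc k) u *\<^sub>R axis (q (Suc k)) 1)"
      by (simp only: vector_add_component sum.distrib)
    also have "total (\<eta> (Suc k) u *\<^sub>R axis (q (Suc k)) 1 :: real ^ 'n) = \<eta> (Suc k) u"
      by (simp add: axis_def if_distrib cong: if_cong)
    also have "total u + \<eta> (Suc k) u \<le> (1 + b) * total u" using b(2)[OF u] by (simp add: distrib_right)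
    finally have tv: "total v \<le> (1 + b) * total u" .
    let ?x = "lst P (cyc 0 B1 k) v" and ?y = "lst M (S (Suc k)) (\<phi> u)"
    have eq: "lst P (cyc 0 B1 (Suc k)) u = ?x * ?y"
      using lst_cyc_Suc[OF B1_fresh B1_nonneg k u] lst_cyc_end[OF B1_fresh B1_nonneg k u] by (simp add: v_def)
    have "?x \<le> 1" "?y \<le> 1"
      using lst_le_1[OF C.prob_space_axioms meas(1) _ v] f[of k] k lst_S(3)[OF i \<phi>0] by auto
    then have "0 \<le> (1 - ?x) * (1 - ?y)" by (intro mult_nonneg_nonneg) auto
    then have "1 - ?x * ?y \<le> (1 - ?x) + (1 - ?y)" by (simp add: algebra_simps)
    also have "1 - ?x \<le> total v * e"
      unfolding e_def using f[of k] k Suc by (intro one_minus_lst_le[OF C.prob_space_axioms meas(1) _ v]) auto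
    also have "\<dots> \<le> (1 + b) * total u * e" using tv e0 by (rule mult_right_mono)
    also have "1 - ?y \<le> \<phi> u * s" unfolding s_def by (rule lst_S(4)[OF i \<phi>0])
    also have "\<dots> \<le> a * total u * s" using a(2)[OF u] s0 by (rule mult_right_mono)
    finally have "1 - ?x * ?y \<le> (1 + b) * total u * e + a * total u * s" by simp
    then show "1 - lst P (cyc 0 B1 (Suc k)) u \<le> ((1 + b) * e + a * s) * total u"
      unfolding eq by (simp add: algebra_simps)
  qed
qed

end

section \<open>The workload within a cycle\<close>

lemma nn_integral_shift:
  fixes h :: "real \<Rightarrow> ennreal"
  assumes "h \<in> borel_measurable borel"
  shows "(\<integral>\<^sup>+t. h (t - b) \<partial>lborel) = (\<integral>\<^sup>+t. h t \<partial>lborel)"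
  using nn_integral_real_affine[of "\<lambda>t. h (t - b)" 1 b] assms by simp

text \<open>The time integral is split at the epochs of the cycle and each piece is shifted to start
  at 0. Measurability of the path and the sign of the epoch are carried through the induction
  because the next split uses them.\<close>

lemma (in polling) nn_integral_fluid_upto:
  fixes f :: "real ^ 'n \<Rightarrow> ennreal"
  assumes S: "\<And>i. i \<in> {1..K} \<Longrightarrow> 0 \<le> S i (d Duration i)"
    and X: "\<And>i. i \<in> {1..K} \<Longrightarrow> (\<lambda>t. net_input i t (d Visit i)) \<in> borel_measurable borel"
    and W: "\<And>i. i \<in> {1..K} \<Longrightarrow> (\<lambda>t. W t (d Inflow i)) \<in> borel_measurable borel"
    and f [measurable]: "f \<in> borel_measurable borel"
  shows "k \<le> K \<Longrightarrow> 0 \<le> epoch d x k \<and> (\<lambda>t. fluid_upto d x k t) \<in> borel_measurable borel \<and>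
    (\<integral>\<^sup>+t. f (fluid_upto d x k t) * indicator {0<..epoch d x k} t \<partial>lborel) =
    (\<Sum>j<k. (\<integral>\<^sup>+t. f (workload_begin d x (Suc j) + net_input (Suc j) t (d Visit (Suc j))) * indicator {0<..visit_length d x (Suc j)} t \<partial>lborel)
      + (\<integral>\<^sup>+t. f (workload_end d x (Suc j) + W t (d Inflow (Suc j))) * indicator {0<..S (Suc j) (d Duration (Suc j))} t \<partial>lborel))"
proof (induction k)
  case 0
  have "fluid_upto d x 0 = (\<lambda>_. x)" by (simp add: fun_eq_iff)
  then show ?case by simp
next
  case (Suc k)
  have i: "Suc k \<in> {1..K}" using Suc.prems by auto
  define b where "b = epoch d x k"
  define v where "v = visit_length d x (Suc k)"
  define s where "s = S (Suc k) (d Duration (Suc k))"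
  define y where "y = workload_begin d x (Suc k)"
  define z where "z = workload_end d x (Suc k)"
  have b: "0 \<le> b" and [measurable]: "(\<lambda>t. fluid_upto d x k t) \<in> borel_measurable borel"
    using Suc by (auto simp: b_def)
  have v: "0 \<le> v" by (simp add: v_def visit_length_def)
  have s: "0 \<le> s" unfolding s_def by (rule S[OF i])
  note [measurable] = X[OF i] W[OF i]
  have e: "epoch d x (Suc k) = b + v + s" by (simp add: b_def v_def s_def)
  have fl: "fluid_upto d x (Suc k) t = (if t < b then fluid_upto d x k t
      else if t < b + v then y + net_input (Suc k) (t - b) (d Visit (Suc k))
      else z + W (t - (b + v)) (d Inflow (Suc k)))" for t
    by (simp add: Let_def b_def v_def y_def z_def)
  have [measurable]: "(\<lambda>t. net_input (Suc k) (t - b) (d Visit (Suc k))) \<in> borel_measurable borel"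
    by (rule measurable_compose[OF _ X[OF i]]) simp
  have [measurable]: "(\<lambda>t. W (t - (b + v)) (d Inflow (Suc k))) \<in> borel_measurable borel"
    by (rule measurable_compose[OF _ W[OF i]]) simp
  have m: "(\<lambda>t. fluid_upto d x (Suc k) t) \<in> borel_measurable borel"
    unfolding fl by measurable
  define hv where "hv t = f (y + net_input (Suc k) t (d Visit (Suc k))) * indicator {0<..v} t" for t
  define hs where "hs t = f (z + W t (d Inflow (Suc k))) * indicator {0<..s} t" for t
  have [measurable]: "hv \<in> borel_measurable borel" "hs \<in> borel_measurable borel"
    unfolding hv_def hs_def by measurable
  have "(\<integral>\<^sup>+t. f (fluid_upto d x (Suc k) t) * indicator {0<..b + v + s} t \<partial>lborel)
    = (\<integral>\<^sup>+t. f (fluid_upto d x k t) * indicator {0<..b} t + (hv (t - b) + hs (t - (b + v))) \<partial>lborel)"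
  \<comment> \<open>The paths switch at left-closed times whereas the integrals run over left-open
    intervals; the two switching points are a null set and are discarded.\<close>
  proof (rule nn_integral_cong_AE, use AE_lborel_singleton[of b] AE_lborel_singleton[of "b + v"] in eventually_elim)
    fix t assume t: "t \<noteq> b" "t \<noteq> b + v"
    consider "t < b" | "b < t" "t < b + v" | "b + v < t" using t by linarith
    then show "f (fluid_upto d x (Suc k) t) * indicator {0<..b + v + s} t
      = f (fluid_upto d x k t) * indicator {0<..b} t + (hv (t - b) + hs (t - (b + v)))"
    proof cases
      case 1
      then have "hv (t - b) = 0" "hs (t - (b + v)) = 0" using v by (auto simp: hv_def hs_def)
      moreover have "(indicator {0<..b + v + s} t :: ennreal) = indicator {0<..b} t"
        using 1 v s by (auto simp: indicator_def)
      ultimately show ?thesis using 1 by (simp add: fl del: fluid_upto.simps)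
    next
      case 2
      then have "hs (t - (b + v)) = 0" by (auto simp: hs_def)
      then show ?thesis using 2 b s by (simp add: fl hv_def indicator_def del: fluid_upto.simps)
    next
      case 3
      then have "hv (t - b) = 0" by (auto simp: hv_def)
      then show ?thesis using 3 b v by (simp add: fl hs_def indicator_def del: fluid_upto.simps)
    qed
  qed
  also have "\<dots> = (\<integral>\<^sup>+t. f (fluid_upto d x k t) * indicator {0<..b} t \<partial>lborel)
      + ((\<integral>\<^sup>+t. hv (t - b) \<partial>lborel) + (\<integral>\<^sup>+t. hs (t - (b + v)) \<partial>lborel))"
    by (simp add: nn_integral_add)
  also have "\<dots> = (\<integral>\<^sup>+t. f (fluid_upto d x k t) * indicator {0<..b} t \<partial>lborel)
      + ((\<integral>\<^sup>+t. hv t \<partial>lborel) + (\<integral>\<^sup>+t. hs t \<partial>lborel))"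
    by (simp add: nn_integral_shift)
  finally show ?case
    using Suc b v s m unfolding e by (simp del: fluid_upto.simps add: b_def hv_def hs_def v_def s_def y_def z_def)
qed

text \<open>Paths are compared at nonnegative times only, because the modifications vanish at
  negative ones.\<close>

lemma (in polling_copies) cycle_regular:
  assumes d: "\<And>r i. i \<in> {1..N} \<Longrightarrow> d r i \<in> \<Omega>" and x: "0 \<le> x"
  shows "k \<le> N \<Longrightarrow> epoch d x k = reg.epoch d x k \<and> (\<forall>t\<ge>0. fluid_upto d x k t = reg.fluid_upto d x k t)"
    and "k < N \<Longrightarrow> workload_begin d x (Suc k) = reg.workload d x k"
    and "k < N \<Longrightarrow> workload_end d x (Suc k) = visit (Suc k) (reg.workload d x k) (d Visit (Suc k))"
    and "k < N \<Longrightarrow> visit_length d x (Suc k) = T (Suc k) (reg.workload d x k $ q (Suc k)) (d Visit (Suc k))"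
proof -
  have w: "workload d x k = reg.workload d x k" "0 \<le> reg.workload d x k $ q j" if "k \<le> N" for k j
    using workload_regular[OF d x that] by (auto simp: vec_le_def)
  have beg: "workload_begin d x (Suc k) = reg.workload d x k" if "k < N" for k
    using w[of k] that by (simp add: workload_begin_def)
  have en: "workload_end d x (Suc k) = visit (Suc k) (reg.workload d x k) (d Visit (Suc k))" if k: "k < N" for k
  proof -
    have "d Visit (Suc k) \<in> \<Omega>" using k by (intro d) auto
    then show ?thesis
      using w(2)[of k "Suc k"] k by (simp add: workload_end_def beg after_visit_def visit_def R_eq_replacement)
  qed
  have len: "visit_length d x (Suc k) = T (Suc k) (reg.workload d x k $ q (Suc k)) (d Visit (Suc k))" if k: "k < N" for k
  proof -
    have "d Visit (Suc k) \<in> \<Omega>" using k by (intro d) auto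
    then show ?thesis
      using w(2)[of k "Suc k"] k by (simp add: visit_length_def beg T_def \<tau>'_def)
  qed
  show "k < N \<Longrightarrow> workload_begin d x (Suc k) = reg.workload d x k"
    "k < N \<Longrightarrow> workload_end d x (Suc k) = visit (Suc k) (reg.workload d x k) (d Visit (Suc k))"
    "k < N \<Longrightarrow> visit_length d x (Suc k) = T (Suc k) (reg.workload d x k $ q (Suc k)) (d Visit (Suc k))"
    using beg en len by auto
  show "k \<le> N \<Longrightarrow> epoch d x k = reg.epoch d x k \<and> (\<forall>t\<ge>0. fluid_upto d x k t = reg.fluid_upto d x k t)"
  proof (induction k)
    case (Suc k)
    have i: "Suc k \<in> {1..N}" and k: "k < N" using Suc.prems by auto
    have len': "reg.visit_length d x (Suc k) = visit_length d x (Suc k)"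
      by (simp add: len[OF k] reg.visit_length_def reg.workload_begin_def T_def)
    have beg': "reg.workload_begin d x (Suc k) = workload_begin d x (Suc k)"
      by (simp add: beg[OF k] reg.workload_begin_def)
    have en': "reg.workload_end d x (Suc k) = workload_end d x (Suc k)"
      by (simp add: en[OF k] reg.workload_end_def reg.workload_begin_def reg_after_visit)
    have SS: "S (Suc k) (d Duration (Suc k)) = S' (Suc k) (d Duration (Suc k))" using d[OF i] by (simp add: S'_def)
    have ep: "epoch d x k = reg.epoch d x k" and fu: "\<And>t. 0 \<le> t \<Longrightarrow> fluid_upto d x k t = reg.fluid_upto d x k t"
      using Suc by auto
    have net: "net_input (Suc k) t (d Visit (Suc k)) = reg.net_input (Suc k) t (d Visit (Suc k))" if "0 \<le> t" for t
      using that d[OF i] X_eq[of "Suc k" t "d Visit (Suc k)"] by (simp add: X_def)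
    have inf: "W t (d Inflow (Suc k)) = W' t (d Inflow (Suc k))" if "0 \<le> t" for t
      using that d[OF i] by (simp add: W'_def)
    show ?case
      by (simp add: Let_def ep fu net inf len' beg' en' SS)
  qed simp
qed

context polling_system
begin

section \<open>Mean cycle length and mean time integral of the transform\<close>

lemma cyc_AE:
  "AE \<omega> in P. (\<forall>k<N. workload_begin (\<lambda>r i. \<xi> (0, r, i) \<omega>) (B1 \<omega>) (Suc k) = cyc 0 B1 k \<omega>
      \<and> workload_end (\<lambda>r i. \<xi> (0, r, i) \<omega>) (B1 \<omega>) (Suc k) = cyc_end 0 B1 k \<omega>
      \<and> visit_length (\<lambda>r i. \<xi> (0, r, i) \<omega>) (B1 \<omega>) (Suc k) = T (Suc k) (cyc 0 B1 k \<omega> $ q (Suc k)) (\<xi> (0, Visit, Suc k) \<omega>))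
    \<and> cycle_length (\<lambda>r i. \<xi> (0, r, i) \<omega>) (B1 \<omega>) = reg.epoch (\<lambda>r i. \<xi> (0, r, i) \<omega>) (B1 \<omega>) N
    \<and> (\<forall>t\<ge>0. fluid (\<lambda>r i. \<xi> (0, r, i) \<omega>) (B1 \<omega>) t = reg.fluid_upto (\<lambda>r i. \<xi> (0, r, i) \<omega>) (B1 \<omega>) N t)"
  using AE_regular_copies B1_nonneg
proof eventually_elim
  case (elim \<omega>)
  have d: "\<xi> (0, r, i) \<omega> \<in> \<Omega>" if "i \<in> {1..N}" for r i using elim(1) that by auto
  show ?case
    using cycle_regular[of "\<lambda>r i. \<xi> (0, r, i) \<omega>" "B1 \<omega>", OF d elim(2)]
    by (simp add: cyc_def cyc_end_def cycle_length_def fluid_def N[symmetric])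
qed

lemma lst_AE_eq:
  fixes Y Z :: "'p \<Rightarrow> real ^ 'n"
  assumes [measurable]: "Z \<in> borel_measurable P" and eq: "AE \<omega> in P. Y \<omega> = Z \<omega>"
  shows "lst P Y u = lst P Z u"
proof -
  have [measurable]: "Y \<in> borel_measurable P"
    by (rule measurable_AE_complete[OF complete assms(1) eq]) simp
  show ?thesis unfolding lst_def
    by (intro integral_cong_AE, measurable, use eq in eventually_elim) simp
qed

abbreviation dr :: "'p \<Rightarrow> role \<Rightarrow> nat \<Rightarrow> 'a" where
  "dr \<omega> r i \<equiv> \<xi> (0, r, i) \<omega>"

lemma reg_cycle_length:
  "reg.epoch (dr \<omega>) (B1 \<omega>) k = (\<Sum>j<k. T (Suc j) (cyc 0 B1 j \<omega> $ q (Suc j)) (\<xi> (0, Visit, Suc j) \<omega>)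
    + S' (Suc j) (\<xi> (0, Duration, Suc j) \<omega>))"
  by (induction k) (simp_all add: reg.visit_length_def reg.workload_begin_def T_def cyc_def)

lemma visit_index: "k < N \<Longrightarrow> (0, Visit, Suc k) \<in> unused 0 k" "k < N \<Longrightarrow> Suc k \<in> {1..N}"
  by (auto simp: unused_def)

lemma mean_cycle_length:
  "has_bochner_integral P (\<lambda>\<omega>. reg.epoch (dr \<omega>) (B1 \<omega>) N)
    ((\<Sum>i=1..N. \<integral>a. S i a \<partial>M) + (\<Sum>i=1..N. (\<integral>a. T i 1 a \<partial>M) * (\<integral>\<omega>. cyc 0 B1 (i - 1) \<omega> $ q i \<partial>P)))"
proof -
  have "has_bochner_integral P (\<lambda>\<omega>. T (Suc k) (cyc 0 B1 k \<omega> $ q (Suc k)) (\<xi> (0, Visit, Suc k) \<omega>)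
      + S' (Suc k) (\<xi> (0, Duration, Suc k) \<omega>))
    ((\<integral>a. T (Suc k) 1 a \<partial>M) * (\<integral>\<omega>. cyc 0 B1 k \<omega> $ q (Suc k) \<partial>P) + (\<integral>a. S (Suc k) a \<partial>M))" if k: "k < N" for k
  proof (intro has_bochner_integral_add)
    have f: "fresh P M \<xi> (unused 0 k) borel (cyc 0 B1 k)" "AE \<omega> in P. 0 \<le> cyc 0 B1 k \<omega>"
      using cyc_fresh[OF B1_fresh B1_nonneg, of k] k by auto
    have [measurable]: "cyc 0 B1 k \<in> borel_measurable P" using f by (simp add: fresh_def)
    have "integrable P (\<lambda>\<omega>. cyc 0 B1 k \<omega> $ q (Suc k))"
    proof (rule Bochner_Integration.integrable_bound[OF cyc_integrable])
      show "AE \<omega> in P. norm (cyc 0 B1 k \<omega> $ q (Suc k)) \<le> norm (norm (cyc 0 B1 k \<omega>))"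
        using component_le_norm_cart by (intro AE_I2) (simp add: component_le_norm_cart)
    qed (use k in auto)
    then show "has_bochner_integral P (\<lambda>\<omega>. T (Suc k) (cyc 0 B1 k \<omega> $ q (Suc k)) (\<xi> (0, Visit, Suc k) \<omega>))
        ((\<integral>a. T (Suc k) 1 a \<partial>M) * (\<integral>\<omega>. cyc 0 B1 k \<omega> $ q (Suc k) \<partial>P))"
      by (rule visit_time_mean[OF unused_subset f visit_index[OF k]])
    show "has_bochner_integral P (\<lambda>\<omega>. S' (Suc k) (\<xi> (0, Duration, Suc k) \<omega>)) (\<integral>a. S (Suc k) a \<partial>M)"
      by (rule switch_time_mean[OF switch_indices(1)[OF B1_fresh B1_nonneg k] cyc_end_fresh[OF B1_fresh B1_nonneg k]
            switch_indices(2-5)[OF B1_fresh B1_nonneg k]])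
  qed
  then have "has_bochner_integral P (\<lambda>\<omega>. reg.epoch (dr \<omega>) (B1 \<omega>) N)
    (\<Sum>k<N. (\<integral>a. T (Suc k) 1 a \<partial>M) * (\<integral>\<omega>. cyc 0 B1 k \<omega> $ q (Suc k) \<partial>P) + (\<integral>a. S (Suc k) a \<partial>M))"
    unfolding reg_cycle_length by (intro has_bochner_integral_sum) auto
  also have "(\<Sum>k<N. (\<integral>a. T (Suc k) 1 a \<partial>M) * (\<integral>\<omega>. cyc 0 B1 k \<omega> $ q (Suc k) \<partial>P) + (\<integral>a. S (Suc k) a \<partial>M))
    = (\<Sum>i=1..N. (\<integral>a. T i 1 a \<partial>M) * (\<integral>\<omega>. cyc 0 B1 (i - 1) \<omega> $ q i \<partial>P) + (\<integral>a. S i a \<partial>M))"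
    by (rule sum.reindex_bij_witness[of _ "\<lambda>i. i - 1" Suc]) auto
  finally show ?thesis by (simp add: sum.distrib add.commute)
qed

text \<open>Working with nonnegative integrals, periods can be summed and averaged without
  integrability conditions. Nonnegativity of the sum of reals is stated so that
  \<open>ennreal\<close> can be undone afterwards; the measurability claims serve the passage to
  Bochner integrals.\<close>

lemma fluid_transform:
  assumes u: "0 \<le> u" and nz: "\<phi> u \<noteq> 0" "\<forall>i\<in>{1..N}. \<phi>A i u \<noteq> 0"
  shows "(\<integral>\<^sup>+\<omega>. \<integral>\<^sup>+t. ennreal (exp (- inner u (reg.fluid_upto (dr \<omega>) (B1 \<omega>) N t)))
        * indicator {0<..reg.epoch (dr \<omega>) (B1 \<omega>) N} t \<partial>lborel \<partial>P)
      = ennreal (\<Sum>k<N. (lst P (cyc 0 B1 k) u - lst P (cyc_end 0 B1 k) u) / \<phi>A (Suc k) u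
        + (lst P (cyc_end 0 B1 k) u - lst P (cyc 0 B1 (Suc k)) u) / \<phi> u)"
    and "0 \<le> (\<Sum>k<N. (lst P (cyc 0 B1 k) u - lst P (cyc_end 0 B1 k) u) / \<phi>A (Suc k) u
        + (lst P (cyc_end 0 B1 k) u - lst P (cyc 0 B1 (Suc k)) u) / \<phi> u)"
    and "(\<lambda>\<omega>. \<integral>\<^sup>+t. ennreal (exp (- inner u (reg.fluid_upto (dr \<omega>) (B1 \<omega>) N t)))
        * indicator {0<..reg.epoch (dr \<omega>) (B1 \<omega>) N} t \<partial>lborel) \<in> borel_measurable P"
    and "\<And>\<omega>. \<omega> \<in> space P \<Longrightarrow> (\<lambda>t. reg.fluid_upto (dr \<omega>) (B1 \<omega>) N t) \<in> borel_measurable borel"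
proof -
  let ?v = "\<lambda>k \<omega>. visit_time_transform (Suc k) u (cyc 0 B1 k \<omega>) (\<xi> (0, Visit, Suc k) \<omega>)"
  let ?s = "\<lambda>k \<omega>. switch_time_transform (Suc k) u (cyc_end 0 B1 k \<omega>) (\<xi> (0, Duration, Suc k) \<omega>) (\<xi> (0, Inflow, Suc k) \<omega>)"
  let ?rv = "\<lambda>k. (lst P (cyc 0 B1 k) u - lst P (cyc_end 0 B1 k) u) / \<phi>A (Suc k) u"
  let ?rs = "\<lambda>k. (lst P (cyc_end 0 B1 k) u - lst P (cyc 0 B1 (Suc k)) u) / \<phi> u"
  have cop: "\<xi> (0, r, i) \<in> P \<rightarrow>\<^sub>M M" if "i \<in> {1..N}" for r i using that by (intro C.copies) auto
  have *: "(\<lambda>t. reg.fluid_upto (dr \<omega>) (B1 \<omega>) N t) \<in> borel_measurable borel \<and>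
      (\<integral>\<^sup>+t. ennreal (exp (- inner u (reg.fluid_upto (dr \<omega>) (B1 \<omega>) N t)))
        * indicator {0<..reg.epoch (dr \<omega>) (B1 \<omega>) N} t \<partial>lborel) = (\<Sum>k<N. ?v k \<omega> + ?s k \<omega>)"
    if w: "\<omega> \<in> space P" for \<omega>
  proof -
    have sp: "\<xi> (0, r, i) \<omega> \<in> space M" if "i \<in> {1..N}" for r i using measurable_space[OF cop[OF that] w] .
    have X: "(\<lambda>t. reg.net_input i t (\<xi> (0, Visit, i) \<omega>)) \<in> borel_measurable borel" if i: "i \<in> {1..N}" for i
      using measurable_compose[OF measurable_Pair2'[OF sp[OF i]] joint_X[OF i]] by (simp add: X_def)
    have W: "(\<lambda>t. W' t (\<xi> (0, Inflow, i) \<omega>)) \<in> borel_measurable borel" if i: "i \<in> {1..N}" for i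
      using measurable_compose[OF measurable_Pair2'[OF sp[OF i]] joint_W'] by simp
    have f: "(\<lambda>y. ennreal (exp (- inner u y))) \<in> borel_measurable borel" by measurable
    note r = reg.nn_integral_fluid_upto[of N "dr \<omega>", OF S'_nonneg X W f order_refl, of "B1 \<omega>"]
    have "(\<Sum>k<N. ?v k \<omega> + ?s k \<omega>) = (\<Sum>j<N. (\<integral>\<^sup>+t. ennreal (exp (- inner u (reg.workload_begin (dr \<omega>) (B1 \<omega>) (Suc j) + reg.net_input (Suc j) t (\<xi> (0, Visit, Suc j) \<omega>)))) * indicator {0<..reg.visit_length (dr \<omega>) (B1 \<omega>) (Suc j)} t \<partial>lborel)
      + (\<integral>\<^sup>+t. ennreal (exp (- inner u (reg.workload_end (dr \<omega>) (B1 \<omega>) (Suc j) + W' t (\<xi> (0, Inflow, Suc j) \<omega>)))) * indicator {0<..S' (Suc j) (\<xi> (0, Duration, Suc j) \<omega>)} t \<partial>lborel))"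
      by (simp add: visit_time_transform_def switch_time_transform_def reg.visit_length_def reg.workload_begin_def
            reg.workload_end_def reg_after_visit cyc_def cyc_end_def X_def T_def)
    then show ?thesis using r by simp
  qed
  show "\<And>\<omega>. \<omega> \<in> space P \<Longrightarrow> (\<lambda>t. reg.fluid_upto (dr \<omega>) (B1 \<omega>) N t) \<in> borel_measurable borel"
    using * by auto
  have v: "?v k \<in> borel_measurable P" "(\<integral>\<^sup>+\<omega>. ?v k \<omega> \<partial>P) = ennreal (?rv k)" "0 \<le> ?rv k" if k: "k < N" for k
  proof -
    have f: "fresh P M \<xi> (unused 0 k) borel (cyc 0 B1 k)" "AE \<omega> in P. 0 \<le> cyc 0 B1 k \<omega>"
      using cyc_fresh[OF B1_fresh B1_nonneg, of k] k by auto
    have [measurable]: "cyc 0 B1 k \<in> borel_measurable P" using f by (simp add: fresh_def)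
    note [measurable] = cop[OF visit_index(2)[OF k]]
    have "(\<lambda>\<omega>. (cyc 0 B1 k \<omega>, \<xi> (0, Visit, Suc k) \<omega>)) \<in> P \<rightarrow>\<^sub>M (borel \<Otimes>\<^sub>M M)" by measurable
    from measurable_compose[OF this measurable_visit_time_transform[OF visit_index(2)[OF k]]]
    show "?v k \<in> borel_measurable P" by simp
    show "(\<integral>\<^sup>+\<omega>. ?v k \<omega> \<partial>P) = ennreal (?rv k)" "0 \<le> ?rv k"
      using visit_time_transform_mean[OF unused_subset f visit_index[OF k] u nz(2)[rule_format, OF visit_index(2)[OF k]]]
      by (simp_all add: cyc_end_def[abs_def])
  qed
  have s: "?s k \<in> borel_measurable P" "(\<integral>\<^sup>+\<omega>. ?s k \<omega> \<partial>P) = ennreal (?rs k)" "0 \<le> ?rs k" if k: "k < N" for k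
  proof -
    note f = cyc_end_fresh[OF B1_fresh B1_nonneg k]
    note i = switch_indices[OF B1_fresh B1_nonneg k]
    have [measurable]: "cyc_end 0 B1 k \<in> borel_measurable P" using f by (simp add: fresh_def)
    note [measurable] = cop[OF visit_index(2)[OF k]]
    have "(\<lambda>\<omega>. ((cyc_end 0 B1 k \<omega>, \<xi> (0, Duration, Suc k) \<omega>), \<xi> (0, Inflow, Suc k) \<omega>)) \<in> P \<rightarrow>\<^sub>M ((borel \<Otimes>\<^sub>M M) \<Otimes>\<^sub>M M)"
      by measurable
    from measurable_compose[OF this measurable_switch_time_transform[OF i(5)]]
    show "?s k \<in> borel_measurable P" by simp
    show "(\<integral>\<^sup>+\<omega>. ?s k \<omega> \<partial>P) = ennreal (?rs k)" "0 \<le> ?rs k"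
      using switch_time_transform_mean[OF i(1) f i(2-5) u nz(1)] by (simp_all add: cyc_Suc)
  qed
  show "(\<lambda>\<omega>. \<integral>\<^sup>+t. ennreal (exp (- inner u (reg.fluid_upto (dr \<omega>) (B1 \<omega>) N t)))
        * indicator {0<..reg.epoch (dr \<omega>) (B1 \<omega>) N} t \<partial>lborel) \<in> borel_measurable P"
    by (subst measurable_cong[where g="\<lambda>\<omega>. \<Sum>k<N. ?v k \<omega> + ?s k \<omega>"])
       (use * v s in \<open>auto intro!: borel_measurable_sum borel_measurable_add\<close>)
  show "0 \<le> (\<Sum>k<N. ?rv k + ?rs k)" using v(3) s(3) by (intro sum_nonneg add_nonneg_nonneg) auto
  have "(\<integral>\<^sup>+\<omega>. \<integral>\<^sup>+t. ennreal (exp (- inner u (reg.fluid_upto (dr \<omega>) (B1 \<omega>) N t)))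
        * indicator {0<..reg.epoch (dr \<omega>) (B1 \<omega>) N} t \<partial>lborel \<partial>P)
      = (\<integral>\<^sup>+\<omega>. (\<Sum>k<N. ?v k \<omega> + ?s k \<omega>) \<partial>P)"
    using * by (intro nn_integral_cong) auto
  also have "\<dots> = (\<Sum>k<N. \<integral>\<^sup>+\<omega>. ?v k \<omega> + ?s k \<omega> \<partial>P)"
    using v(1) s(1) by (intro nn_integral_sum borel_measurable_add) auto
  also have "\<dots> = (\<Sum>k<N. ennreal (?rv k + ?rs k))"
    by (intro sum.cong refl, subst nn_integral_add) (simp_all add: v s ennreal_plus)
  also have "\<dots> = ennreal (\<Sum>k<N. ?rv k + ?rs k)"
    using v(3) s(3) by (intro sum_ennreal add_nonneg_nonneg) auto
  finally show "(\<integral>\<^sup>+\<omega>. \<integral>\<^sup>+t. ennreal (exp (- inner u (reg.fluid_upto (dr \<omega>) (B1 \<omega>) N t)))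
        * indicator {0<..reg.epoch (dr \<omega>) (B1 \<omega>) N} t \<partial>lborel \<partial>P)
      = ennreal (\<Sum>k<N. ?rv k + ?rs k)" .
qed

lemma integral_fluid:
  assumes u: "0 \<le> u" and nz: "\<phi> u \<noteq> 0" "\<forall>i\<in>{1..N}. \<phi>A i u \<noteq> 0"
  shows "(\<integral>\<omega>. (LINT t:{0..cycle_length (dr \<omega>) (B1 \<omega>)}|lborel. exp (- inner u (fluid (dr \<omega>) (B1 \<omega>) t))) \<partial>P)
      = (\<Sum>k<N. (lst P (cyc 0 B1 k) u - lst P (cyc_end 0 B1 k) u) / \<phi>A (Suc k) u
        + (lst P (cyc_end 0 B1 k) u - lst P (cyc 0 B1 (Suc k)) u) / \<phi> u)" (is "?L = ?R")
proof -
  note ft = fluid_transform[OF u nz]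
  let ?v = "\<lambda>\<omega>. \<integral>\<^sup>+t. ennreal (exp (- inner u (reg.fluid_upto (dr \<omega>) (B1 \<omega>) N t)))
        * indicator {0<..reg.epoch (dr \<omega>) (B1 \<omega>) N} t \<partial>lborel"
  \<comment> \<open>The mean is finite, so the inner integral is almost surely finite and
    \<open>enn2real\<close> preserves it.\<close>
  have fin: "AE \<omega> in P. ?v \<omega> \<noteq> \<infinity>"
    using ft(1) by (intro nn_integral_noteq_infinite ft(3)) auto
  have eq: "AE \<omega> in P. (LINT t:{0..cycle_length (dr \<omega>) (B1 \<omega>)}|lborel. exp (- inner u (fluid (dr \<omega>) (B1 \<omega>) t))) = enn2real (?v \<omega>)"
    using cyc_AE AE_space
  proof eventually_elim
    case (elim \<omega>)
    define c where "c = reg.epoch (dr \<omega>) (B1 \<omega>) N"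
    note [measurable] = ft(4)[OF elim(2)]
    have "(LINT t:{0..cycle_length (dr \<omega>) (B1 \<omega>)}|lborel. exp (- inner u (fluid (dr \<omega>) (B1 \<omega>) t)))
      = (\<integral>t. indicator {0..c} t * exp (- inner u (reg.fluid_upto (dr \<omega>) (B1 \<omega>) N t)) \<partial>lborel)"
      unfolding set_lebesgue_integral_def using elim(1)
      by (intro Bochner_Integration.integral_cong refl) (auto simp: c_def indicator_def)
    also have "\<dots> = enn2real (\<integral>\<^sup>+t. ennreal (indicator {0..c} t * exp (- inner u (reg.fluid_upto (dr \<omega>) (B1 \<omega>) N t))) \<partial>lborel)"
      by (rule integral_eq_nn_integral) auto
    \<comment> \<open>Closed and half-open time intervals differ only by the point 0.\<close>
    also have "(\<integral>\<^sup>+t. ennreal (indicator {0..c} t * exp (- inner u (reg.fluid_upto (dr \<omega>) (B1 \<omega>) N t))) \<partial>lborel) = ?v \<omega>"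
      by (rule nn_integral_cong_AE, use AE_lborel_singleton[of 0] in eventually_elim)
         (auto simp: indicator_def c_def)
    finally show ?case .
  qed
  have "?L = (\<integral>\<omega>. enn2real (?v \<omega>) \<partial>P)"
  proof (rule integral_cong_AE[OF _ _ eq])
    show m: "(\<lambda>\<omega>. enn2real (?v \<omega>)) \<in> borel_measurable P" using ft(3) by measurable
    show "(\<lambda>\<omega>. LINT t:{0..cycle_length (dr \<omega>) (B1 \<omega>)}|lborel. exp (- inner u (fluid (dr \<omega>) (B1 \<omega>) t))) \<in> borel_measurable P"
      by (rule measurable_AE_complete[OF complete m eq]) simp
  qed
  also have "\<dots> = enn2real (\<integral>\<^sup>+\<omega>. ennreal (enn2real (?v \<omega>)) \<partial>P)"
    using ft(3) by (intro integral_eq_nn_integral) auto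
  also have "(\<integral>\<^sup>+\<omega>. ennreal (enn2real (?v \<omega>)) \<partial>P) = (\<integral>\<^sup>+\<omega>. ?v \<omega> \<partial>P)"
    by (rule nn_integral_cong_AE, use fin in eventually_elim) (simp add: top.not_eq_extremum)
  finally show ?thesis using ft(1,2) by simp
qed

end

theorem theorem3:
  fixes M :: "'a measure" and P :: "'p measure"
    and q :: "nat \<Rightarrow> 'n::finite"
    and W :: "real \<Rightarrow> 'a \<Rightarrow> real ^ 'n" and \<phi> :: "real ^ 'n \<Rightarrow> real"
    and A :: "nat \<Rightarrow> real \<Rightarrow> 'a \<Rightarrow> real" and \<phi>A :: "nat \<Rightarrow> real ^ 'n \<Rightarrow> real"
    and S :: "nat \<Rightarrow> 'a \<Rightarrow> real"
    and \<F> :: "nat \<Rightarrow> ennreal \<Rightarrow> 'a measure"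
    and \<tau> :: "nat \<Rightarrow> real \<Rightarrow> 'a \<Rightarrow> ennreal" and \<eta> :: "nat \<Rightarrow> real ^ 'n \<Rightarrow> real"
    and m :: "nat \<Rightarrow> nat \<Rightarrow> real"
    and \<xi> :: "nat \<times> role \<times> nat \<Rightarrow> 'p \<Rightarrow> 'a"
    and X0 B1 G :: "'p \<Rightarrow> real ^ 'n"
    and B E :: "nat \<Rightarrow> 'p \<Rightarrow> real ^ 'n"
    and C :: "'p \<Rightarrow> real" and Fl :: "real \<Rightarrow> 'p \<Rightarrow> real ^ 'n"
    and N :: nat
  assumes N: "N = CARD('n)" and q: "bij_betw q {1..N} UNIV"
    \<comment> \<open>inputs, switch-over times and disciplines\<close>
    and M: "prob_space M"
    and W: "levy_subordinator M W" "AE \<omega> in M. cadlag (\<lambda>t. W t \<omega>)"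
    and \<phi>: "laplace_exponent M W \<phi>"
    and S: "\<forall>i\<in>{1..N}. S i \<in> borel_measurable M \<and> (AE \<omega> in M. 0 < S i \<omega>)"
    and A: "\<forall>i\<in>{1..N}. spectrally_positive_levy M (A i) \<and> (\<integral>\<omega>. A i 1 \<omega> \<partial>M) < 0"
    and \<phi>A: "\<forall>i\<in>{1..N}. laplace_exponent M (polling.net_input q W A i) (\<phi>A i)"
    and \<F>: "\<forall>i\<in>{1..N}. augmented_right_continuous_filtration M (\<F> i) \<and>
           levy_process_wrt M (\<F> i) (polling.net_input q W A i)"
    and \<tau>_measurable: "\<forall>i\<in>{1..N}. (\<lambda>(x, \<omega>). \<tau> i x \<omega>)
           \<in> borel_measurable (restrict_space borel {0..} \<Otimes>\<^sub>M M)"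
    and a: "\<forall>i\<in>{1..N}. \<forall>x\<ge>0. stopping_time (\<F> i) (\<tau> i x)"
    and b: "\<forall>i\<in>{1..N}. \<forall>x\<ge>0. AE \<omega> in M. \<tau> i x \<omega> \<le> hitting_time (A i) x \<omega>"
    and c: "\<forall>i\<in>{1..N}. levy_subordinator M (polling.replacement q W A \<tau> i) \<and>
           laplace_exponent M (polling.replacement q W A \<tau> i) (\<eta> i)"
    \<comment> \<open>independent copies for the successive visits and switch-over periods\<close>
    and P: "prob_space P" "complete_measure P"
    and \<xi>: "\<forall>k\<in>UNIV \<times> UNIV \<times> {1..N}. \<xi> k \<in> measurable P M \<and> distr P M (\<xi> k) = M"
           "prob_space.indep_vars P (\<lambda>_. M) \<xi> (UNIV \<times> UNIV \<times> {1..N})"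
    \<comment> \<open>conditions for stability\<close>
    and m: "\<forall>i\<in>{1..N}. \<forall>j\<in>{1..N}.
           ((\<lambda>h. kappa q \<eta> (h *\<^sub>R axis (q j) 1) $ q i) has_real_derivative m i j) (at 0 within {0..})"
    and spectral: "spectral_radius
           (Matrix.mat N N (\<lambda>(i, j). complex_of_real (m (Suc i) (Suc j)))) < 1"
    and G: "G \<in> borel_measurable P" "AE \<omega> in P. 0 \<le> G \<omega>"
           "\<forall>u\<ge>0. lst P G u = immigration_lst M q S \<phi> \<eta> u"
           "integrable P (\<lambda>\<omega>. norm (G \<omega>))"
    and ES: "\<forall>i\<in>{1..N}. integrable M (S i)"
    \<comment> \<open>steady state: \<open>B1\<close> has the limiting distribution of the workload at arrivals at queue 1\<close>
    and X0: "AE \<omega> in P. 0 \<le> X0 \<omega>"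
           "indep_rv P borel X0 (PiM (UNIV \<times> UNIV \<times> {1..N}) (\<lambda>_. M))
              (\<lambda>\<omega>. \<lambda>k\<in>UNIV \<times> UNIV \<times> {1..N}. \<xi> k \<omega>)"
    and B1: "indep_rv P borel B1 (PiM (UNIV \<times> UNIV \<times> {1..N}) (\<lambda>_. M))
              (\<lambda>\<omega>. \<lambda>k\<in>UNIV \<times> UNIV \<times> {1..N}. \<xi> k \<omega>)"
           "converges_in_distribution P
              (\<lambda>n \<omega>. polling.embedded q W A S \<tau> (\<lambda>n r i. \<xi> (n, r, i) \<omega>) (X0 \<omega>) n) B1"
    \<comment> \<open>a cycle started in stationarity\<close>
    and B: "B = (\<lambda>i \<omega>. polling.workload_begin q W A S \<tau> (\<lambda>r i. \<xi> (0, r, i) \<omega>) (B1 \<omega>) i)"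
    and E: "E = (\<lambda>i \<omega>. polling.workload_end q W A S \<tau> (\<lambda>r i. \<xi> (0, r, i) \<omega>) (B1 \<omega>) i)"
    and C: "C = (\<lambda>\<omega>. polling.cycle_length q W A S \<tau> (\<lambda>r i. \<xi> (0, r, i) \<omega>) (B1 \<omega>))"
    and Fl: "Fl = (\<lambda>t \<omega>. polling.fluid q W A S \<tau> (\<lambda>r i. \<xi> (0, r, i) \<omega>) (B1 \<omega>) t)"
  shows "(\<forall>u\<ge>0. \<phi> u \<noteq> 0 \<and> (\<forall>i\<in>{1..N}. \<phi>A i u \<noteq> 0) \<longrightarrow>
            steady_state_lst P C Fl u =
              (\<Sum>i=1..N. (lst P (B i) u - lst P (E i) u) / \<phi>A i u
                 + (lst P (E i) u - lst P (B (if i = N then 1 else i + 1)) u) / \<phi> u)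
              / ((\<Sum>i=1..N. \<integral>\<omega>. S i \<omega> \<partial>M)
                 + (\<Sum>i=1..N. (\<integral>\<omega>. enn2real (\<tau> i 1 \<omega>) \<partial>M) * (\<integral>\<omega>. B i \<omega> $ q i \<partial>P))))
       \<and> (\<forall>u\<ge>0. \<forall>i\<in>{1..N}.
            lst P (B (if i = N then 1 else i + 1)) u = lst P (E i) u * lst M (S i) (\<phi> u)
            \<and> lst P (E i) u = lst P (B i) (vec_upd u (q i) (\<eta> i u)))
       \<and> (\<forall>u\<ge>0. (\<lambda>k. immigration_lst M q S \<phi> \<eta> ((kappa q \<eta> ^^ k) u)) has_prod lst P (B 1) u)"
proof -
  interpret polling_system q W A S \<tau> M \<phi> \<phi>A \<F> \<eta> N P \<xi> m X0 B1 G
  proof -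
    interpret P: prob_space P by fact
    have "polling_template q W A S \<tau> M \<phi> \<phi>A \<F> \<eta> N"
      unfolding polling_template_def using N q M W \<phi> S A \<phi>A \<F> \<tau>_measurable a b c ES by blast
    moreover have "independent_copies P M \<xi> (UNIV \<times> UNIV \<times> {1..N})"
      unfolding independent_copies_def independent_copies_axioms_def using P M \<xi> by blast
    ultimately show "polling_system q W A S \<tau> M \<phi> \<phi>A \<F> \<eta> N P \<xi> m X0 B1 G"
      unfolding polling_system_def polling_copies_def polling_system_axioms_def
      using P(2) m spectral G X0 B1 by blast
  qed
  have meas: "cyc 0 B1 k \<in> borel_measurable P" if "k \<le> N" for k
    using cyc_measurable[OF B1_fresh B1_nonneg that] .
  have meas_end: "cyc_end 0 B1 k \<in> borel_measurable P" if "k < N" for k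
    using cyc_end_measurable[OF B1_fresh B1_nonneg that] .
  have B_eq: "AE \<omega> in P. B (Suc k) \<omega> = cyc 0 B1 k \<omega>" and E_eq: "AE \<omega> in P. E (Suc k) \<omega> = cyc_end 0 B1 k \<omega>" if "k < N" for k
    using cyc_AE that unfolding B E by (auto elim!: eventually_mono)
  have lst_B: "lst P (B (Suc k)) u = lst P (cyc 0 B1 k) u" and lst_E: "lst P (E (Suc k)) u = lst P (cyc_end 0 B1 k) u"
    if "k < N" for k u
    using that meas[of k] meas_end[of k] B_eq[OF that] E_eq[OF that] by (auto intro: lst_AE_eq)
  have lst_B1: "lst P (B 1) u = lst P B1 u" for u
    using lst_B[of 0 u] N_pos by (simp add: cyc_0)
  \<comment> \<open>This closes the cycle: after queue N the workload has the same transform as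
    \<open>B1\<close>, by stationarity.\<close>
  have lst_next: "lst P (B (if Suc k = N then 1 else Suc k + 1)) u = lst P (cyc 0 B1 (Suc k)) u"
    if k: "k < N" and u: "0 \<le> u" for k u
  proof (cases "Suc k = N")
    case True
    then show ?thesis
      using lst_B1[of u] lst_cycle[OF B1_fresh B1_nonneg u] lst_B1_stationary[OF u] by simp
  qed (use k lst_B[of "Suc k" u] in simp)
  have ex_Suc: "\<exists>k<N. i = Suc k" if "i \<in> {1..N}" for i
    using that by (intro exI[of _ "i - 1"]) auto
  have part2: "lst P (B (if i = N then 1 else i + 1)) u = lst P (E i) u * lst M (S i) (\<phi> u)
      \<and> lst P (E i) u = lst P (B i) (vec_upd u (q i) (\<eta> i u))" if u: "0 \<le> u" and i: "i \<in> {1..N}" for u i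
  proof -
    obtain k where k: "k < N" "i = Suc k" using ex_Suc[OF i] by auto
    show ?thesis
      unfolding k(2) lst_next[OF k(1) u] lst_B[OF k(1)] lst_E[OF k(1)]
      using lst_cyc_Suc[OF B1_fresh B1_nonneg k(1) u] lst_cyc_end[OF B1_fresh B1_nonneg k(1) u] by simp
  qed
  have mean_C: "(\<integral>\<omega>. C \<omega> \<partial>P) = (\<Sum>i=1..N. \<integral>\<omega>. S i \<omega> \<partial>M)
      + (\<Sum>i=1..N. (\<integral>\<omega>. enn2real (\<tau> i 1 \<omega>) \<partial>M) * (\<integral>\<omega>. B i \<omega> $ q i \<partial>P))"
  proof -
    have C_eq: "AE \<omega> in P. C \<omega> = reg.epoch (dr \<omega>) (B1 \<omega>) N"
      using cyc_AE unfolding C by (auto elim!: eventually_mono)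
    have ep: "(\<lambda>\<omega>. reg.epoch (dr \<omega>) (B1 \<omega>) N) \<in> borel_measurable P"
      using mean_cycle_length by (rule borel_measurable_has_bochner_integral)
    have "(\<integral>\<omega>. C \<omega> \<partial>P) = (\<integral>\<omega>. reg.epoch (dr \<omega>) (B1 \<omega>) N \<partial>P)"
      by (rule integral_cong_AE[OF measurable_AE_complete[OF complete ep C_eq] ep C_eq]) simp
    also have "\<dots> = (\<Sum>i=1..N. \<integral>\<omega>. S i \<omega> \<partial>M)
      + (\<Sum>i=1..N. (\<integral>a. T i 1 a \<partial>M) * (\<integral>\<omega>. cyc 0 B1 (i - 1) \<omega> $ q i \<partial>P))"
      using mean_cycle_length by (rule has_bochner_integral_integral_eq)
    also have "(\<Sum>i=1..N. (\<integral>a. T i 1 a \<partial>M) * (\<integral>\<omega>. cyc 0 B1 (i - 1) \<omega> $ q i \<partial>P))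
      = (\<Sum>i=1..N. (\<integral>\<omega>. enn2real (\<tau> i 1 \<omega>) \<partial>M) * (\<integral>\<omega>. B i \<omega> $ q i \<partial>P))"
    proof (intro sum.cong refl arg_cong2[where f="(*)"])
      fix i assume i: "i \<in> {1..N}"
      obtain k where k: "k < N" "i = Suc k" using ex_Suc[OF i] by auto
      have [measurable]: "\<tau> i 1 \<in> borel_measurable M"
        using measurable_Pair2[OF \<tau>_measurable[rule_format, OF i], of 1] by (simp add: space_restrict_space)
      show "(\<integral>a. T i 1 a \<partial>M) = (\<integral>\<omega>. enn2real (\<tau> i 1 \<omega>) \<partial>M)"
      proof (rule integral_cong_AE)
        show "AE a in M. T i 1 a = enn2real (\<tau> i 1 a)"
          using \<Omega>(2) by eventually_elim (simp add: T_def \<tau>'_def)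
      qed (use i in measurable)
      note [measurable] = meas[OF less_imp_le[OF k(1)]]
      have [measurable]: "B i \<in> borel_measurable P"
        unfolding k(2) by (rule measurable_AE_complete[OF complete _ B_eq[OF k(1)]]) simp_all
      show "(\<integral>\<omega>. cyc 0 B1 (i - 1) \<omega> $ q i \<partial>P) = (\<integral>\<omega>. B i \<omega> $ q i \<partial>P)"
      proof (rule integral_cong_AE)
        show "AE \<omega> in P. cyc 0 B1 (i - 1) \<omega> $ q i = B i \<omega> $ q i"
          using B_eq[OF k(1)] by eventually_elim (simp add: k(2))
        show "(\<lambda>\<omega>. cyc 0 B1 (i - 1) \<omega> $ q i) \<in> borel_measurable P"
          unfolding k(2) diff_Suc_1 by measurable
      qed measurable
    qed
    finally show ?thesis .
  qed
  have part1: "steady_state_lst P C Fl u =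
      (\<Sum>i=1..N. (lst P (B i) u - lst P (E i) u) / \<phi>A i u
         + (lst P (E i) u - lst P (B (if i = N then 1 else i + 1)) u) / \<phi> u)
      / ((\<Sum>i=1..N. \<integral>\<omega>. S i \<omega> \<partial>M)
         + (\<Sum>i=1..N. (\<integral>\<omega>. enn2real (\<tau> i 1 \<omega>) \<partial>M) * (\<integral>\<omega>. B i \<omega> $ q i \<partial>P)))"
    if u: "0 \<le> u" and nz: "\<phi> u \<noteq> 0 \<and> (\<forall>i\<in>{1..N}. \<phi>A i u \<noteq> 0)" for u
  proof -
    have "(\<integral>\<omega>. (LINT t:{0..C \<omega>}|lborel. exp (- inner u (Fl t \<omega>))) \<partial>P)
      = (\<Sum>k<N. (lst P (cyc 0 B1 k) u - lst P (cyc_end 0 B1 k) u) / \<phi>A (Suc k) u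
        + (lst P (cyc_end 0 B1 k) u - lst P (cyc 0 B1 (Suc k)) u) / \<phi> u)"
      unfolding C Fl using integral_fluid[OF u] nz by simp
    also have "\<dots> = (\<Sum>k<N. (lst P (B (Suc k)) u - lst P (E (Suc k)) u) / \<phi>A (Suc k) u
        + (lst P (E (Suc k)) u - lst P (B (if Suc k = N then 1 else Suc k + 1)) u) / \<phi> u)"
      by (intro sum.cong refl) (simp only: lessThan_iff lst_B lst_E lst_next[OF _ u])
    also have "\<dots> = (\<Sum>i=1..N. (lst P (B i) u - lst P (E i) u) / \<phi>A i u
         + (lst P (E i) u - lst P (B (if i = N then 1 else i + 1)) u) / \<phi> u)"
      by (rule sum.reindex_bij_witness[of _ "\<lambda>i. i - 1" Suc]) auto
    finally show ?thesis unfolding steady_state_lst_def mean_C by simp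
  qed
  show ?thesis
    using part1 part2 immigration_has_prod lst_B1 by simp
qed

end
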